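(* Let $\phi_1$ be the smallest eigenvalue of the $N\times N$ Jacobi $\beta$-Ensemble with $\beta=2$, $\alpha_1\in\mathbb{N}_0=\{0,1,2,\dots\}$ and $\alpha_2>-1$, and let $F_{\phi_1}(\xi)=\mathbb{P}(\phi_1\le\xi)$ and $F_{N^2\phi_1}(x)=\mathbb{P}(N^2\phi_1\le x)$ be the probability distribution functions of $\phi_1$ and $N^2\phi_1$. For $0<\xi<1$, $$F_{\phi_1}(\xi)=1-(-1)^{N\alpha_1}\prod_{i=1}^{\alpha_1}(N+\alpha_2+i)_N\;(1-\xi)^{N(\alpha_1+\alpha_2+N)}\det\left(\frac{1}{(N+i-j)!}\,p_{N+i-j}^{\,j-1,\alpha_2+j-1}\Big(\frac{-\xi}{1-\xi}\Big)\right)_{i,j=1}^{\alpha_1}.$$ As $N\to\infty$ we have, for $x>0$, $$F_{N^2\phi_1}(x)=1-e^{-x}\det\big(I_{j-i}(2\sqrt{x})\big)_{i,j=1}^{\alpha_1}+\frac{x}{N}(\alpha_1+\alpha_2)e^{-x}\det\big(I_{2+j-i}(2\sqrt{x})\big)_{i,j=1}^{\alpha_1}+O\Big(\frac{1}{N^2}\Big).$$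
   Context: Jacobi $\beta$-Ensemble with $\beta=2$: for $\alpha_1,\alpha_2>-1$ the (unordered) eigenvalues $x_1,\dots,x_N\in[0,1]$ have joint probability density proportional to $\prod_{i=1}^N x_i^{\alpha_1}(1-x_i)^{\alpha_2}\prod_{1\le i<j\le N}|x_j-x_i|^{2}$ on $[0,1]^N$; the sorted eigenvalues are $0\le\phi_1\le\dots\le\phi_N\le1$. $(a)_m=\prod_{j=0}^{m-1}(a+j)$ is the Pochhammer symbol. For $a,b>-1$ and integer $m\ge0$, $p_m^{a,b}(x)$ denotes the $m$th monic Jacobi polynomial, orthogonal with respect to the measure $x^a(1-x)^b\,dx$ on $[0,1]$. Entries $\frac{1}{m!}p_m^{a,b}$ with $m<0$ are interpreted as $0$. $I_\nu(z)=\sum_{k\ge0}\frac{(z/2)^{\nu+2k}}{k!\,\Gamma(\nu+k+1)}$ is the modified Bessel function of the first kind, with $1/\Gamma=0$ at non-positive integers, so $I_{-n}=I_n$ for integers $n$. Determinants of size $0\times0$ equal $1$. *)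

theory Defs
  imports
    "HOL-Probability.Probability"
    "HOL-Computational_Algebra.Polynomial"
    "HOL-Library.Landau_Symbols"
    "Jordan_Normal_Form.Determinant"
begin

text \<open>
  Jacobi ensemble with \<open>\<beta> = 2\<close>: the unordered eigenvalues are the coordinates \<open>x 0, \<dots>, x (N - 1)\<close>
  of a point of the product space indexed by \<open>{..<N}\<close>.
  (\<^term>\<open>0 powr 0 = (0::real)\<close> in Isabelle, so for a zero exponent the weight differs from the
  usual one on a Lebesgue null set, which does not change the ensemble.)
\<close>

definition jacobi_weight :: "nat \<Rightarrow> real \<Rightarrow> real \<Rightarrow> (nat \<Rightarrow> real) \<Rightarrow> real" where
  "jacobi_weight N \<alpha>\<^sub>1 \<alpha>\<^sub>2 x =
     indicator (PiE {..<N} (\<lambda>_. {0..1})) x *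
     ((\<Prod>i<N. x i powr \<alpha>\<^sub>1 * (1 - x i) powr \<alpha>\<^sub>2) * (\<Prod>j<N. \<Prod>i<j. \<bar>x j - x i\<bar> ^ 2))"

definition jacobi_ensemble :: "nat \<Rightarrow> real \<Rightarrow> real \<Rightarrow> (nat \<Rightarrow> real) measure" where
  "jacobi_ensemble N \<alpha>\<^sub>1 \<alpha>\<^sub>2 =
     (let L = PiM {..<N} (\<lambda>_. lborel);
          Z = integral\<^sup>L L (jacobi_weight N \<alpha>\<^sub>1 \<alpha>\<^sub>2)
      in density L (\<lambda>x. ennreal (jacobi_weight N \<alpha>\<^sub>1 \<alpha>\<^sub>2 x / Z)))"

definition smallest_eigenvalue :: "nat \<Rightarrow> (nat \<Rightarrow> real) \<Rightarrow> real" where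
  "smallest_eigenvalue N x = Min (x ` {..<N})"

definition F_smallest :: "nat \<Rightarrow> real \<Rightarrow> real \<Rightarrow> real \<Rightarrow> real" where
  "F_smallest N \<alpha>\<^sub>1 \<alpha>\<^sub>2 = cdf (distr (jacobi_ensemble N \<alpha>\<^sub>1 \<alpha>\<^sub>2) borel (smallest_eigenvalue N))"

definition F_scaled_smallest :: "nat \<Rightarrow> real \<Rightarrow> real \<Rightarrow> real \<Rightarrow> real" where
  "F_scaled_smallest N \<alpha>\<^sub>1 \<alpha>\<^sub>2 =
     cdf (distr (jacobi_ensemble N \<alpha>\<^sub>1 \<alpha>\<^sub>2) borel (\<lambda>x. real N ^ 2 * smallest_eigenvalue N x))"

definition is_monic_jacobi :: "nat \<Rightarrow> real \<Rightarrow> real \<Rightarrow> real poly \<Rightarrow> bool" where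
  "is_monic_jacobi m a b p \<longleftrightarrow>
     degree p = m \<and> lead_coeff p = 1 \<and>
     (\<forall>q. degree q < m \<longrightarrow>
        (LINT x:{0..1}|lborel. poly p x * poly q x * (x powr a * (1 - x) powr b)) = 0)"

text \<open>For \<open>a, b > -1\<close> there is exactly one such polynomial.\<close>

definition monic_jacobi :: "nat \<Rightarrow> real \<Rightarrow> real \<Rightarrow> real poly" where
  "monic_jacobi m a b = (THE p. is_monic_jacobi m a b p)"

text \<open>The value \<open>p\<^sub>m\<^sup>a\<^sup>,\<^sup>b(x) / m!\<close>, read as \<open>0\<close> for \<open>m < 0\<close>.\<close>

definition jacobi_entry :: "int \<Rightarrow> real \<Rightarrow> real \<Rightarrow> real \<Rightarrow> real" where
  "jacobi_entry m a b x =
     (if m < 0 then 0 else 1 / fact (nat m) * poly (monic_jacobi (nat m) a b) x)"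

text \<open>
  Only meant for \<open>z > 0\<close>, because of the convention \<^term>\<open>0 powr 0 = (0::real)\<close>.
  The reciprocal Gamma function \<^const>\<open>rGamma\<close> vanishes at the non-positive integers.
\<close>

definition bessel_I :: "real \<Rightarrow> real \<Rightarrow> real" where
  "bessel_I \<nu> z =
     (\<Sum>k. (z / 2) powr (\<nu> + 2 * real k) / fact k * rGamma (\<nu> + real k + 1))"

text \<open>
  \<open>det\<^sub>1 n f\<close> is the determinant of \<open>(f i j)\<close> with \<open>i, j = 1, \<dots>, n\<close>; the library matrices are
  indexed from \<open>0\<close>. For \<open>n = 0\<close> it is \<open>1\<close>.
\<close>

definition det\<^sub>1 :: "nat \<Rightarrow> (nat \<Rightarrow> nat \<Rightarrow> real) \<Rightarrow> real" where
  "det\<^sub>1 n f = Determinant.det (mat n n (\<lambda>(i, j). f (i + 1) (j + 1)))"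

end

theory Submission
  imports Defs "Jordan_Normal_Form.Char_Poly" "HOL-Real_Asymp.Real_Asymp"
begin

text \<open>
  By Andreief's identity and the substitution \<open>x = \<xi> + (1 - \<xi>) y\<close>, the probability that all
  eigenvalues exceed \<open>\<xi>\<close> is \<open>(1 - \<xi>) powr (N (N + n + b))\<close> times \<open>H(t) / H(0)\<close>, where \<open>n = \<alpha>\<^sub>1\<close>, \<open>b = \<alpha>\<^sub>2\<close>,
  \<open>t = -\<xi> / (1 - \<xi>)\<close> and \<open>H(t)\<close> is the Hankel determinant of the weight \<open>(y - t)\<^sup>n (1 - y)\<^sup>b\<close> on
  \<open>[0, 1]\<close>. Christoffel's theorem expresses \<open>H(t)\<close> by the Taylor coefficients at \<open>t\<close> of \<open>n\<close>
  monic polynomials of degrees \<open>N, \<dots>, N + n - 1\<close> that are orthogonal for \<open>(1 - y)\<^sup>b\<close> to all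
  polynomials of degree below \<open>N\<close>. Taking the orthogonal polynomials themselves gives the formula at
  finite \<open>N\<close>. Taking instead \<open>X\<^sup>i p\<close> with \<open>p\<close> the \<open>N\<close>th Jacobi polynomial for the exponents \<open>i, b\<close>
  gives entries that converge termwise under \<open>\<xi> = x / N\<^sup>2\<close>, with an explicit correction of order
  \<open>1 / N\<close>: the result is \<open>f(x) + (n + b) x f'(x) / N\<close> with \<open>f\<close> the limit
  \<open>exp (- x) det (I\<^sub>j\<^sub>-\<^sub>i (2 sqrt x))\<close>.

  It remains to see that \<open>f'(x) = - exp (- x) det (I\<^sub>2\<^sub>+\<^sub>j\<^sub>-\<^sub>i (2 sqrt x))\<close>. This goes by induction on
  the size: Sylvester's determinant identity relates the Toeplitz determinants of three consecutive
  sizes, and the three-term recurrence of the Bessel functions relates the ways of shifting one row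
  or column.
\<close>

section \<open>Determinants\<close>

text \<open>Why a single derivative collects all terms of order \<open>1 / N\<close>: the power of
  \<open>1 - \<xi>\<close> contributes the factor \<open>- x (n + b)\<close>, while row
  \<open>i\<close> of the determinant contributes \<open>i + b + 1\<close> times the same entries
  with the Bessel order raised by one. A raised row repeats the next row, so only the last one
  survives, and its weight is again \<open>n + b\<close>. The three-term recurrence turns raising
  into \<open>x\<close> times lowering, and for the functions
  \<open>x powr (m / 2) * I_m(2 sqrt x)\<close> lowering the order is differentiation. The obstacle
  in the derivative formula is that the induction relates the sizes \<open>m\<close>,
  \<open>m + 1\<close>, \<open>m + 2\<close> through a product with the determinant of size
  \<open>m\<close>, which has to be cancelled. That determinant is therefore shown to be nonzero for
  \<open>x > 0\<close>, as a Gram determinant. The error bounds must be uniform in the summation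
  index of the entries. They lose a geometric factor only, which amounts to rescaling the argument
  of a Bessel series.\<close>

definition fdet :: "nat \<Rightarrow> (nat \<Rightarrow> nat \<Rightarrow> real) \<Rightarrow> real" where
  "fdet n f = Determinant.det (mat n n (\<lambda>(i, j). f i j))"

text \<open>The Leibniz expansion reduces differentiation, limits, expansions in
  \<open>1 / N\<close> and Andreief's identity to statements about finite products.\<close>

lemma fdet_perm:
  "fdet n f = (\<Sum>p | p permutes {..<n}. of_int (sign p) * (\<Prod>i<n. f i (p i)))"
proof -
  have "fdet n f = (\<Sum>p\<in>{p. p permutes {0..<n}}. signof p * (\<Prod>i = 0..<n. mat n n (\<lambda>(i, j). f i j) $$ (i, p i)))"
    unfolding fdet_def by (rule det_def') simp
  also have "\<dots> = (\<Sum>p\<in>{p. p permutes {0..<n}}. of_int (sign p) * (\<Prod>i = 0..<n. f i (p i)))"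
  proof (intro sum.cong refl arg_cong2[where f = "(*)"] prod.cong)
    fix p i assume "p \<in> {p. p permutes {0..<n}}" and i: "i \<in> {0..<n}"
    then have "p permutes {0..<n}" by blast
    from permutes_in_image[OF this, of i] i have "p i < n" by simp
    with i show "mat n n (\<lambda>(i, j). f i j) $$ (i, p i) = f i (p i)" by simp
  qed
  finally show ?thesis unfolding atLeast0LessThan .
qed

lemma fdet_cong: "(\<And>i j. i < n \<Longrightarrow> j < n \<Longrightarrow> f i j = g i j) \<Longrightarrow> fdet n f = fdet n g"
  unfolding fdet_def by (intro arg_cong[where f = Determinant.det] eq_matI) auto

lemma fdet_0 [simp]: "fdet 0 f = 1"
  by (simp add: fdet_def)

lemma fdet_1: "fdet (Suc 0) f = f 0 0"
  unfolding fdet_def by (subst det_single) auto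

lemma fdet_transpose: "fdet n (\<lambda>i j. f j i) = fdet n f"
  unfolding fdet_def
  by (subst det_transpose[of _ n, symmetric])
     (auto intro!: arg_cong[where f = Determinant.det] eq_matI)

lemma fdet_permute_rows:
  assumes "p permutes {..<n}"
  shows "fdet n (\<lambda>i j. f (p i) j) = of_int (sign p) * fdet n f"
proof -
  have p: "p permutes {0..<n}" using assms by (simp add: atLeast0LessThan)
  have "mat n n (\<lambda>(i, j). f (p i) j) = mat n n (\<lambda>(i, j). mat n n (\<lambda>(i, j). f i j) $$ (p i, j))"
    using permutes_in_image[OF p] by (intro eq_matI) auto
  then show ?thesis
    unfolding fdet_def using det_permute_rows[OF _ p, of "mat n n (\<lambda>(i, j). f i j)"] by simp
qed

lemma fdet_identical_rows:
  assumes "i < n" "j < n" "i \<noteq> j" "\<And>k. k < n \<Longrightarrow> f i k = f j k"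
  shows "fdet n f = 0"
  unfolding fdet_def
  by (rule det_identical_rows[of _ n i j]) (use assms in \<open>auto intro!: eq_vecI\<close>)

lemma fdet_mult: "fdet n (\<lambda>i j. \<Sum>k<n. f i k * g k j) = fdet n f * fdet n g"
proof -
  have "mat n n (\<lambda>(i, j). \<Sum>k<n. f i k * g k j) = mat n n (\<lambda>(i, j). f i j) * mat n n (\<lambda>(i, j). g i j)"
    by (intro eq_matI) (auto simp: scalar_prod_def atLeast0LessThan intro!: sum.cong)
  then show ?thesis
    unfolding fdet_def by (simp add: det_mult[of _ n])
qed

lemma fdet_scale:
  "fdet n (\<lambda>i j. a i * b j * f i j) = (\<Prod>i<n. a i) * (\<Prod>j<n. b j) * fdet n f"
proof -
  have "(\<Prod>i<n. b (p i)) = (\<Prod>j<n. b j)" if "p permutes {..<n}" for p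
    using prod.permute[OF that, of b] by (simp add: o_def)
  then show ?thesis
    unfolding fdet_perm by (auto simp: prod.distrib sum_distrib_left mult_ac intro!: sum.cong)
qed

lemma fdet_lower_triangular:
  assumes "\<And>i j. i < j \<Longrightarrow> j < n \<Longrightarrow> f i j = 0"
  shows "fdet n f = (\<Prod>i<n. f i i)"
proof -
  have "prod_list (diag_mat (mat n n (\<lambda>(i, j). f i j))) = (\<Prod>i<n. f i i)"
    by (subst prod_list_diag_prod) (auto simp: atLeast0LessThan)
  then show ?thesis
    unfolding fdet_def by (subst det_lower_triangular[of n]) (use assms in auto)
qed

lemma fdet_upper_triangular:
  assumes "\<And>i j. j < i \<Longrightarrow> i < n \<Longrightarrow> f i j = 0"
  shows "fdet n f = (\<Prod>i<n. f i i)"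
  using fdet_lower_triangular[of n "\<lambda>i j. f j i"] assms by (simp add: fdet_transpose[of n f])

lemma fdet_block:
  assumes "\<And>i j. i < n \<Longrightarrow> n \<le> j \<Longrightarrow> j < n + m \<Longrightarrow> f i j = 0"
  shows "fdet (n + m) f = fdet n f * fdet m (\<lambda>i j. f (n + i) (n + j))"
proof -
  have "mat (n + m) (n + m) (\<lambda>(i, j). f i j) =
     four_block_mat (mat n n (\<lambda>(i, j). f i j)) (0\<^sub>m n m) (mat m n (\<lambda>(i, j). f (n + i) j))
       (mat m m (\<lambda>(i, j). f (n + i) (n + j)))"
    by (intro eq_matI) (use assms in auto)
  then show ?thesis
    unfolding fdet_def by (simp add: det_four_block_mat_upper_right_zero[of _ n _ m])
qed

lemma fdet_swap_cols:
  "fdet (k + n) f = (-1) ^ (k * n) * fdet (k + n) (\<lambda>i j. f i (if j < k then j + n else j - k))"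
  unfolding fdet_def
  by (subst det_swap_cols)
     (auto intro!: arg_cong[where f = Determinant.det] eq_matI)

text \<open>The derivative of the determinant at \<open>A\<close> in the direction \<open>B\<close>.\<close>

definition fdet' :: "nat \<Rightarrow> (nat \<Rightarrow> nat \<Rightarrow> real) \<Rightarrow> (nat \<Rightarrow> nat \<Rightarrow> real) \<Rightarrow> real" where
  "fdet' n A B = (\<Sum>r<n. fdet n (\<lambda>i j. if i = r then B i j else A i j))"

lemma fdet'_perm:
  "fdet' n A B = (\<Sum>p | p permutes {..<n}. of_int (sign p) *
     (\<Sum>r<n. B r (p r) * (\<Prod>i\<in>{..<n}-{r}. A i (p i))))"
proof -
  have "(\<Prod>i<n. if i = r then B i (p i) else A i (p i)) = B r (p r) * (\<Prod>i\<in>{..<n}-{r}. A i (p i))"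
    if "r < n" for r and p :: "nat \<Rightarrow> nat"
    using that by (subst prod.remove[of _ r]) (auto intro!: prod.cong)
  then show ?thesis
    unfolding fdet'_def fdet_perm
    by (subst sum.swap) (simp add: sum_distrib_left)
qed

text \<open>In the Leibniz sum one entry \<open>(r, p r)\<close> of each product is replaced, which
  favours neither rows nor columns; the inverse permutation exchanges them. So \<open>fdet'\<close>
  can be evaluated row by row or column by column.\<close>

lemma fdet'_transpose: "fdet' n (\<lambda>i j. A j i) (\<lambda>i j. B j i) = fdet' n A B"
proof -
  let ?g = "\<lambda>A B p. of_int (sign p) * (\<Sum>r<n. B r (p r) * (\<Prod>i\<in>{..<n}-{r}. A i (p i))) :: real"
  have "?g (\<lambda>i j. A j i) (\<lambda>i j. B j i) (Hilbert_Choice.inv p) = ?g A B p" if p: "p permutes {..<n}" for p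
  proof -
    have "(\<Sum>r<n. B (Hilbert_Choice.inv p r) r * (\<Prod>i\<in>{..<n}-{r}. A (Hilbert_Choice.inv p i) i)) =
          (\<Sum>q<n. B (Hilbert_Choice.inv p (p q)) (p q) * (\<Prod>i\<in>{..<n}-{p q}. A (Hilbert_Choice.inv p i) i))"
      by (subst sum.permute[OF p]) (simp add: o_def)
    also have "\<dots> = (\<Sum>q<n. B q (p q) * (\<Prod>i\<in>{..<n}-{q}. A i (p i)))"
    proof (intro sum.cong refl)
      fix q assume "q \<in> {..<n}"
      have "{..<n} - {p q} = p ` ({..<n} - {q})"
        by (subst image_set_diff[OF permutes_inj[OF p]]) (simp add: permutes_image[OF p])
      moreover have "inj_on p ({..<n} - {q})"
        using permutes_inj[OF p] by (rule inj_on_subset) simp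
      ultimately have "(\<Prod>i\<in>{..<n}-{p q}. A (Hilbert_Choice.inv p i) i) =
          (\<Prod>i\<in>{..<n}-{q}. A (Hilbert_Choice.inv p (p i)) (p i))"
        by (simp only: prod.reindex o_def)
      then show "B (Hilbert_Choice.inv p (p q)) (p q) * (\<Prod>i\<in>{..<n}-{p q}. A (Hilbert_Choice.inv p i) i) =
          B q (p q) * (\<Prod>i\<in>{..<n}-{q}. A i (p i))"
        by (simp only: permutes_inverses[OF p])
    qed
    finally have "(\<Sum>r<n. B (Hilbert_Choice.inv p r) r * (\<Prod>i\<in>{..<n}-{r}. A (Hilbert_Choice.inv p i) i)) =
       (\<Sum>q<n. B q (p q) * (\<Prod>i\<in>{..<n}-{q}. A i (p i)))" .
    moreover have "sign (Hilbert_Choice.inv p) = sign p"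
      using p by (intro sign_inverse) (auto simp: permutation_permutes)
    ultimately show ?thesis by simp
  qed
  then show ?thesis
    unfolding fdet'_perm
    by (subst sum_permutations_inverse) (intro sum.cong refl, simp)
qed

lemma fdet'_cong:
  "(\<And>i j. i < n \<Longrightarrow> j < n \<Longrightarrow> A i j = A' i j) \<Longrightarrow> (\<And>i j. i < n \<Longrightarrow> j < n \<Longrightarrow> B i j = B' i j) \<Longrightarrow>
     fdet' n A B = fdet' n A' B'"
  unfolding fdet'_def by (intro sum.cong fdet_cong refl) auto

lemma fdet'_linear:
  "fdet' n A (\<lambda>i j. c * B i j + d * C i j) = c * fdet' n A B + d * fdet' n A C"
  unfolding fdet'_perm
  by (simp add: algebra_simps sum.distrib sum_distrib_left)

text \<open>Along every permutation \<open>p\<close> the weights \<open>r i - c (p i)\<close> add up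
  to the same number, by which each Leibniz product is multiplied.\<close>

lemma fdet'_weights:
  assumes "\<And>i j. i < n \<Longrightarrow> j < n \<Longrightarrow> B i j = (r i - c j) * A i j"
  shows "fdet' n A B = ((\<Sum>i<n. r i) - (\<Sum>j<n. c j)) * fdet n A"
proof -
  have *: "(\<Sum>k<n. B k (p k) * (\<Prod>i\<in>{..<n}-{k}. A i (p i))) =
        ((\<Sum>i<n. r i) - (\<Sum>j<n. c j)) * (\<Prod>i<n. A i (p i))" if p: "p permutes {..<n}" for p
  proof -
    have "(\<Sum>k<n. B k (p k) * (\<Prod>i\<in>{..<n}-{k}. A i (p i))) =
          (\<Sum>k<n. (r k - c (p k)) * (\<Prod>i<n. A i (p i)))"
    proof (intro sum.cong refl)
      fix k assume "k \<in> {..<n}"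
      moreover from this have "p k < n" using permutes_in_image[OF p, of k] by auto
      ultimately show "B k (p k) * (\<Prod>i\<in>{..<n}-{k}. A i (p i)) = (r k - c (p k)) * (\<Prod>i<n. A i (p i))"
        by (subst (2) prod.remove[of _ k]) (auto simp: assms)
    qed
    also have "\<dots> = ((\<Sum>k<n. r k) - (\<Sum>k<n. c (p k))) * (\<Prod>i<n. A i (p i))"
      by (simp only: sum_distrib_right[symmetric] sum_subtractf)
    also have "(\<Sum>k<n. c (p k)) = (\<Sum>k<n. c k)"
      using sum.permute[OF p, of c] by (simp add: o_def)
    finally show ?thesis .
  qed
  have "fdet' n A B = (\<Sum>p | p permutes {..<n}. of_int (sign p) *
     (((\<Sum>i<n. r i) - (\<Sum>j<n. c j)) * (\<Prod>i<n. A i (p i))))"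
    unfolding fdet'_perm by (intro sum.cong refl arg_cong2[where f = "(*)"] *) auto
  then show ?thesis
    by (simp add: fdet_perm sum_distrib_left mult_ac)
qed

lemma has_field_derivative_fdet:
  assumes "\<And>i j. i < n \<Longrightarrow> j < n \<Longrightarrow> ((\<lambda>x. A x i j) has_field_derivative B i j) (at x)"
  shows "((\<lambda>x. fdet n (A x)) has_field_derivative fdet' n (A x) B) (at x)"
proof -
  have "((\<lambda>x. \<Prod>i<n. A x i (p i)) has_field_derivative (\<Sum>r<n. B r (p r) * (\<Prod>i\<in>{..<n}-{r}. A x i (p i)))) (at x)"
    if p: "p permutes {..<n}" for p
    by (rule has_field_derivative_prod) (use p permutes_in_image[OF p] assms in auto)
  then show ?thesis
    unfolding fdet_perm fdet'_perm
    by (intro DERIV_sum DERIV_cmult) auto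
qed

lemma tendsto_fdet:
  assumes "\<And>i j. i < n \<Longrightarrow> j < n \<Longrightarrow> ((\<lambda>x. A x i j) \<longlongrightarrow> B i j) F"
  shows "((\<lambda>x. fdet n (A x)) \<longlongrightarrow> fdet n B) F"
proof -
  have "((\<lambda>x. \<Prod>i<n. A x i (p i)) \<longlongrightarrow> (\<Prod>i<n. B i (p i))) F" if p: "p permutes {..<n}" for p
  proof (rule tendsto_prod)
    fix i assume "i \<in> {..<n}"
    moreover from this have "p i < n" using permutes_in_image[OF p, of i] by simp
    ultimately show "((\<lambda>x. A x i (p i)) \<longlongrightarrow> B i (p i)) F" using assms by simp
  qed
  then show ?thesis
    unfolding fdet_perm by (intro tendsto_sum tendsto_mult tendsto_const) blast
qed

lemma fdet_swap_initial_rows: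
  assumes "k + l \<le> n"
  shows "fdet n f = (-1) ^ (k * l) *
    fdet n (\<lambda>i j. f (if i < l then i + k else if i < k + l then i - l else i) j)"
proof -
  have "mat n n (\<lambda>(i, j). mat n n (\<lambda>(i, j). f i j) $$ (if i < l then i + k else if i < k + l then i - l else i, j)) =
        mat n n (\<lambda>(i, j). f (if i < l then i + k else if i < k + l then i - l else i) j)"
    by (rule eq_matI) (use assms in auto)
  then show ?thesis
    unfolding fdet_def using det_swap_initial_rows[of "mat n n (\<lambda>(i, j). f i j)" n k l] assms by simp
qed

lemma fdet_swap_initial_cols:
  assumes "k + l \<le> n"
  shows "fdet n f = (-1) ^ (k * l) *
    fdet n (\<lambda>i j. f i (if j < l then j + k else if j < k + l then j - l else j))"
  using fdet_swap_initial_rows[OF assms, of "\<lambda>i j. f j i"]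
  unfolding fdet_transpose[of n f]
  unfolding fdet_transpose[of n "\<lambda>i j. f i (if j < l then j + k else if j < k + l then j - l else j)"] .

section \<open>Sylvester's determinant identity\<close>

lemma fdet_left_inverse:
  assumes "fdet n f \<noteq> 0"
  obtains g where "\<And>i j. i < n \<Longrightarrow> j < n \<Longrightarrow> (\<Sum>k<n. g i k * f k j) = (if i = j then 1 else 0)"
proof -
  define A where "A = mat n n (\<lambda>(i, j). f i j)"
  have A: "A \<in> carrier_mat n n" by (simp add: A_def)
  have adj: "adj_mat A \<in> carrier_mat n n" and eq: "adj_mat A * A = Determinant.det A \<cdot>\<^sub>m 1\<^sub>m n"
    using adj_mat[OF A] by auto
  have *: "(\<Sum>k<n. adj_mat A $$ (i, k) * f k j) = fdet n f * (if i = j then 1 else 0)"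
    if "i < n" "j < n" for i j
  proof -
    have "(\<Sum>k<n. adj_mat A $$ (i, k) * f k j) = (adj_mat A * A) $$ (i, j)"
      using that A adj by (auto simp: scalar_prod_def atLeast0LessThan A_def intro!: sum.cong)
    also have "\<dots> = fdet n f * (if i = j then 1 else 0)"
      using that unfolding eq by (simp add: fdet_def A_def)
    finally show ?thesis .
  qed
  show ?thesis
    by (rule that[of "\<lambda>i k. adj_mat A $$ (i, k) / fdet n f"])
       (use assms * in \<open>simp add: sum_divide_distrib[symmetric]\<close>)
qed

text \<open>A Schur complement: \<open>c r\<close> writes row \<open>r\<close>, restricted to the
  leading \<open>m\<close> columns, as a combination of the leading \<open>m\<close> rows. The
  selectors \<open>r\<close> and \<open>q\<close> allow any rows and columns of \<open>f\<close> as
  border, so that several minors share one elimination.\<close>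

lemma fdet_bordered:
  assumes c: "\<And>r j. j < m \<Longrightarrow> (\<Sum>k<m. c r k * f k j) = f r j"
  shows "fdet (m + l) (\<lambda>i j. f (if i < m then i else r i) (if j < m then j else q j)) =
     fdet m f * fdet l (\<lambda>i j. f (r (m + i)) (q (m + j)) - (\<Sum>k<m. c (r (m + i)) k * f k (q (m + j))))"
proof -
  let ?F = "\<lambda>i j. f (if i < m then i else r i) (if j < m then j else q j)"
  \<comment> \<open>Multiplication by the unit lower triangular matrix \<open>L\<close> subtracts
    these combinations from the bordering rows.\<close>
  define L where "L i k = (if k = i then 1 else if k < m \<and> m \<le> i then - c (r i) k else 0)" for i k
  have "fdet (m + l) L = 1"
    by (subst fdet_lower_triangular) (auto simp: L_def)
  then have "fdet (m + l) ?F = fdet (m + l) (\<lambda>i j. \<Sum>k<m + l. L i k * ?F k j)"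
    unfolding fdet_mult by simp
  \<comment> \<open>Transposed because \<open>fdet_block\<close> has its zero block in the upper
    right corner.\<close>
  also have "\<dots> = fdet (m + l) (\<lambda>j i. \<Sum>k<m + l. L i k * ?F k j)"
    by (rule fdet_transpose[symmetric])
  also have LF: "(\<Sum>k<m + l. L i k * ?F k j) =
      ?F i j - (if i < m then 0 else \<Sum>k<m. c (r i) k * ?F k j)" if "i < m + l" for i j
  proof (cases "i < m")
    case True
    then have "(\<Sum>k<m + l. L i k * ?F k j) = (\<Sum>k<m + l. if k = i then ?F i j else 0)"
      by (intro sum.cong) (auto simp: L_def)
    then show ?thesis using True that by simp
  next
    case False
    have "(\<Sum>k<m + l. L i k * ?F k j) =
        (\<Sum>k<m + l. (if k = i then ?F i j else 0) - (if k < m then c (r i) k * ?F k j else 0))"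
      using False by (intro sum.cong) (auto simp: L_def)
    also have "\<dots> = ?F i j - (\<Sum>k<m + l. if k < m then c (r i) k * ?F k j else 0)"
      using that by (simp add: sum_subtractf)
    also have "(\<Sum>k<m + l. if k < m then c (r i) k * ?F k j else 0) = (\<Sum>k<m. c (r i) k * ?F k j)"
      by (rule sum.mono_neutral_cong_right) auto
    finally show ?thesis using False by simp
  qed
  have "fdet (m + l) (\<lambda>j i. \<Sum>k<m + l. L i k * ?F k j) =
     fdet (m + l) (\<lambda>j i. ?F i j - (if i < m then 0 else \<Sum>k<m. c (r i) k * ?F k j))"
    by (rule fdet_cong) (rule LF)
  also have "\<dots> = fdet m (\<lambda>j i. ?F i j - (if i < m then 0 else \<Sum>k<m. c (r i) k * ?F k j)) *
     fdet l (\<lambda>j i. ?F (m + i) (m + j) - (if m + i < m then 0 else \<Sum>k<m. c (r (m + i)) k * ?F k (m + j)))"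
    by (rule fdet_block) (simp add: c)
  also have "fdet m (\<lambda>j i. ?F i j - (if i < m then 0 else \<Sum>k<m. c (r i) k * ?F k j)) = fdet m (\<lambda>j i. f i j)"
    by (rule fdet_cong) simp
  also have "\<dots> = fdet m f" by (rule fdet_transpose)
  also have "fdet l (\<lambda>j i. ?F (m + i) (m + j) - (if m + i < m then 0 else \<Sum>k<m. c (r (m + i)) k * ?F k (m + j))) =
     fdet l (\<lambda>j i. f (r (m + i)) (q (m + j)) - (\<Sum>k<m. c (r (m + i)) k * f k (q (m + j))))"
    by (rule fdet_cong) simp
  also have "\<dots> = fdet l (\<lambda>i j. f (r (m + i)) (q (m + j)) - (\<Sum>k<m. c (r (m + i)) k * f k (q (m + j))))"
    by (rule fdet_transpose)
  finally show ?thesis .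
qed

lemma fdet_2: "fdet 2 f = f 0 0 * f 1 1 - f 0 1 * f 1 0"
proof -
  have two: "{..<2::nat} = {0, 1}" by auto
  have "{p. p permutes {..<2::nat}} = {id, Transposition.transpose 0 1}"
    unfolding two permutes_doubleton_iff by blast
  moreover have "id \<noteq> Transposition.transpose (0::nat) 1"
  proof
    assume "id = Transposition.transpose (0::nat) 1"
    from fun_cong[OF this, of 0] show False by simp
  qed
  ultimately show ?thesis
    unfolding fdet_perm by (simp add: two sign_swap_id)
qed

text \<open>The minors share the leading block, so each of the larger ones is
  \<open>fdet m f\<close> times a determinant of size 1 or 2 in the reduced entries
  \<open>e\<close>; what remains is the formula for size 2.\<close>

lemma fdet_sylvester_regular:
  assumes "fdet m f \<noteq> 0"
  shows "fdet (m + 2) f * fdet m f =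
     fdet (m + 1) f * fdet (m + 1) (\<lambda>i j. f (if i < m then i else i + 1) (if j < m then j else j + 1)) -
     fdet (m + 1) (\<lambda>i j. f i (if j < m then j else j + 1)) * fdet (m + 1) (\<lambda>i j. f (if i < m then i else i + 1) j)"
proof -
  obtain g where g: "\<And>i j. i < m \<Longrightarrow> j < m \<Longrightarrow> (\<Sum>k<m. g i k * f k j) = (if i = j then 1 else 0)"
    using fdet_left_inverse[OF assms] by blast
  define c where "c r k = (\<Sum>i<m. f r i * g i k)" for r k
  have c: "(\<Sum>k<m. c r k * f k j) = f r j" if "j < m" for r j
  proof -
    have "(\<Sum>k<m. c r k * f k j) = (\<Sum>i<m. f r i * (\<Sum>k<m. g i k * f k j))"
      unfolding c_def sum_distrib_left sum_distrib_right by (subst sum.swap) (simp add: mult.assoc)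
    also have "\<dots> = (\<Sum>i<m. if i = j then f r j else 0)"
      using that by (intro sum.cong) (auto simp: g)
    finally show ?thesis using that by simp
  qed
  define e where "e r q = f r q - (\<Sum>k<m. c r k * f k q)" for r q
  note B = fdet_bordered[of m c f, OF c]
  have B1: "fdet (m + 1) (\<lambda>i j. f (if i < m then i else r i) (if j < m then j else q j)) = fdet m f * e (r m) (q m)" for r q
    using B[of 1 r q] by (simp add: fdet_1 e_def)
  have 1: "fdet (m + 2) f = fdet m f * (e m m * e (m + 1) (m + 1) - e m (m + 1) * e (m + 1) m)"
    using B[of 2 "\<lambda>i. i" "\<lambda>i. i"] by (simp add: fdet_2 e_def)
  have 2: "fdet (m + 1) f = fdet m f * e m m"
    using B1[of "\<lambda>i. i" "\<lambda>i. i"] by simp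
  have 3: "fdet (m + 1) (\<lambda>i j. f (if i < m then i else i + 1) (if j < m then j else j + 1)) = fdet m f * e (m + 1) (m + 1)"
    using B1[of "\<lambda>i. i + 1" "\<lambda>i. i + 1"] by simp
  have 4: "fdet (m + 1) (\<lambda>i j. f i (if j < m then j else j + 1)) = fdet m f * e m (m + 1)"
    using B1[of "\<lambda>i. i" "\<lambda>i. i + 1"] by simp
  have 5: "fdet (m + 1) (\<lambda>i j. f (if i < m then i else i + 1) j) = fdet m f * e (m + 1) m"
    using B1[of "\<lambda>i. i + 1" "\<lambda>i. i"] by simp
  show ?thesis unfolding 1 2 3 4 5 by (simp add: algebra_simps)
qed

text \<open>The regular case extends to all matrices by perturbing the diagonal.\<close>

lemma fdet_sylvester:
  "fdet (m + 2) f * fdet m f =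
     fdet (m + 1) f * fdet (m + 1) (\<lambda>i j. f (if i < m then i else i + 1) (if j < m then j else j + 1)) -
     fdet (m + 1) (\<lambda>i j. f i (if j < m then j else j + 1)) * fdet (m + 1) (\<lambda>i j. f (if i < m then i else i + 1) j)"
proof -
  define g where "g \<epsilon> i j = f i j + (if i = j then \<epsilon> else 0)" for \<epsilon> :: real and i j
  have lim: "((\<lambda>\<epsilon>. g \<epsilon> i j) \<longlongrightarrow> f i j) (at 0)" for i j
    unfolding g_def by (cases "i = j") (auto intro!: tendsto_eq_intros)
  \<comment> \<open>The sign makes \<open>fdet m (g \<epsilon>)\<close> the characteristic
    polynomial of \<open>A\<close> at \<open>\<epsilon>\<close>, which has finitely many
    roots.\<close>
  define A where "A = mat m m (\<lambda>(i, j). - f i j)"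
  have A: "A \<in> carrier_mat m m" by (simp add: A_def)
  have "fdet m (g \<epsilon>) = poly (char_poly A) \<epsilon>" for \<epsilon>
    unfolding char_poly_matrix[OF A] fdet_def
    by (intro arg_cong[where f = Determinant.det] eq_matI) (auto simp: A_def char_matrix_def g_def)
  moreover have "char_poly A \<noteq> 0"
    using degree_monic_char_poly[OF A] by auto
  ultimately have "finite {\<epsilon>. fdet m (g \<epsilon>) = 0}"
    using poly_roots_finite[of "char_poly A"] by simp
  then have "open (- ({\<epsilon>. fdet m (g \<epsilon>) = 0} - {0}))"
    by (intro open_Compl finite_imp_closed) simp
  then have "eventually (\<lambda>\<epsilon>. \<epsilon> \<in> - ({\<epsilon>. fdet m (g \<epsilon>) = 0} - {0})) (nhds 0)"
    by (rule eventually_nhds_in_open) simp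
  then have ev: "eventually (\<lambda>\<epsilon>. fdet m (g \<epsilon>) \<noteq> 0) (at 0)"
    unfolding eventually_at_filter by eventually_elim auto
  let ?lhs = "\<lambda>f. fdet (m + 2) f * fdet m f"
  let ?rhs = "\<lambda>f. fdet (m + 1) f * fdet (m + 1) (\<lambda>i j. f (if i < m then i else i + 1) (if j < m then j else j + 1)) -
     fdet (m + 1) (\<lambda>i j. f i (if j < m then j else j + 1)) * fdet (m + 1) (\<lambda>i j. f (if i < m then i else i + 1) j)"
  have 1: "((\<lambda>\<epsilon>. ?lhs (g \<epsilon>)) \<longlongrightarrow> ?lhs f) (at 0)"
    and 2: "((\<lambda>\<epsilon>. ?rhs (g \<epsilon>)) \<longlongrightarrow> ?rhs f) (at 0)"
    by (intro tendsto_intros tendsto_fdet lim)+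
  have "eventually (\<lambda>\<epsilon>. ?lhs (g \<epsilon>) = ?rhs (g \<epsilon>)) (at 0)"
    using ev by eventually_elim (rule fdet_sylvester_regular)
  from Lim_transform_eventually[OF 1 this] have "((\<lambda>\<epsilon>. ?rhs (g \<epsilon>)) \<longlongrightarrow> ?lhs f) (at 0)" .
  from tendsto_unique[OF at_neq_bot this 2] show ?thesis .
qed

section \<open>Bessel functions and their Toeplitz determinants\<close>

definition bessel_clifford :: "nat \<Rightarrow> real \<Rightarrow> real" where
  "bessel_clifford n x = (\<Sum>k. x ^ k / (fact k * fact (k + n)))"

lemma summable_bessel_clifford: "summable (\<lambda>k. x ^ k / (fact k * fact (k + n)) :: real)"
proof (rule summable_comparison_test')
  show "summable (\<lambda>k. inverse (fact k) * \<bar>x\<bar> ^ k)" by (rule summable_exp)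
  fix k :: nat
  have "1 \<le> (fact (k + n) :: real)" by (rule fact_ge_1)
  then show "norm (x ^ k / (fact k * fact (k + n))) \<le> inverse (fact k) * \<bar>x\<bar> ^ k"
    using mult_right_mono[of 1 "fact (k + n)" "\<bar>x\<bar> ^ k"]
    by (simp add: power_abs field_simps abs_mult)
qed

lemma bessel_clifford_sums: "(\<lambda>k. x ^ k / (fact k * fact (k + n))) sums bessel_clifford n x"
  unfolding bessel_clifford_def using summable_bessel_clifford by (rule summable_sums)

lemma has_field_derivative_bessel_clifford:
  "(bessel_clifford n has_field_derivative bessel_clifford (Suc n) x) (at x)"
proof -
  define c :: "nat \<Rightarrow> real" where "c k = 1 / (fact k * fact (k + n))" for k
  have eq: "bessel_clifford n = (\<lambda>x. \<Sum>k. c k * x ^ k)"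
    by (simp add: bessel_clifford_def c_def fun_eq_iff)
  have d: "diffs c k * x ^ k = x ^ k / (fact k * fact (k + Suc n))" for k
    by (simp add: diffs_def c_def field_simps del: of_nat_Suc)
  have "((\<lambda>x. \<Sum>k. c k * x ^ k) has_field_derivative (\<Sum>k. diffs c k * x ^ k)) (at x)"
    by (rule termdiffs_strong_converges_everywhere)
       (use summable_bessel_clifford in \<open>simp add: c_def\<close>)
  then show ?thesis unfolding eq d bessel_clifford_def by simp
qed

text \<open>Comparison of coefficients: \<open>1 / (k! (k + n)!)\<close> is
  \<open>(k + (n + 1)) / (k! (k + n + 1)!)\<close>. The summand \<open>k\<close> shifts the series
  and yields the factor \<open>x\<close>.\<close>

lemma bessel_clifford_rec: "bessel_clifford n x = x * bessel_clifford (n + 2) x + real (n + 1) * bessel_clifford (n + 1) x"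
proof -
  have "(\<lambda>k. x * (x ^ k / (fact k * fact (k + (n + 2))))) sums (x * bessel_clifford (n + 2) x)"
    by (intro sums_mult bessel_clifford_sums)
  also have "(\<lambda>k. x * (x ^ k / (fact k * fact (k + (n + 2))))) =
      (\<lambda>k. real (Suc k) * x ^ Suc k / (fact (Suc k) * fact (Suc k + (n + 1))))"
  proof
    fix k
    have "k + (n + 2) = Suc k + (n + 1)" by simp
    then show "x * (x ^ k / (fact k * fact (k + (n + 2)))) =
        real (Suc k) * x ^ Suc k / (fact (Suc k) * fact (Suc k + (n + 1)))"
      by (simp only: fact_Suc[of k] of_nat_mult power_Suc) (simp del: of_nat_Suc fact_Suc)
  qed
  finally have 1: "(\<lambda>k. real k * x ^ k / (fact k * fact (k + (n + 1)))) sums (x * bessel_clifford (n + 2) x)"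
    by (subst (asm) sums_Suc_iff) simp
  have 2: "(\<lambda>k. real (n + 1) * (x ^ k / (fact k * fact (k + (n + 1))))) sums (real (n + 1) * bessel_clifford (n + 1) x)"
    by (intro sums_mult bessel_clifford_sums)
  have "real k * x ^ k / (fact k * fact (k + (n + 1))) + real (n + 1) * (x ^ k / (fact k * fact (k + (n + 1)))) =
     x ^ k / (fact k * fact (k + n))" for k
  proof -
    have "real k * x ^ k / (fact k * fact (k + (n + 1))) + real (n + 1) * (x ^ k / (fact k * fact (k + (n + 1)))) =
      real (k + n + 1) * (x ^ k / (fact k * fact (k + n + 1)))"
      by (simp add: add_divide_distrib distrib_right)
    also have "(fact (k + n + 1) :: real) = real (k + n + 1) * fact (k + n)" by simp
    finally show ?thesis by (simp del: of_nat_Suc of_nat_add)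
  qed
  with sums_add[OF 1 2] have "(\<lambda>k. x ^ k / (fact k * fact (k + n))) sums
      (x * bessel_clifford (n + 2) x + real (n + 1) * bessel_clifford (n + 1) x)" by simp
  then show ?thesis using bessel_clifford_sums sums_unique2 by blast
qed

text \<open>For \<open>x > 0\<close> this is \<open>x powr (m / 2) * bessel_I m (2 * sqrt x)\<close>; in contrast to the Bessel
  functions these are power series in \<open>x\<close>.\<close>

definition bessel_J :: "int \<Rightarrow> real \<Rightarrow> real" where
  "bessel_J m x = (if m \<ge> 0 then x ^ nat m * bessel_clifford (nat m) x else bessel_clifford (nat (- m)) x)"

lemma bessel_J_nonneg: "bessel_J (int n) x = x ^ n * bessel_clifford n x"
  by (simp add: bessel_J_def)

lemma bessel_J_nonpos: "bessel_J (- int n) x = bessel_clifford n x"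
  by (simp add: bessel_J_def)

lemma int_cases_nonpos: obtains n where "m = int (Suc n)" | n where "m = - int n"
  by (metis int_cases2 int_cases of_nat_0 old.nat.exhaust minus_zero)

text \<open>The normalisation is chosen so that differentiation lowers the order for either sign of
  \<open>m\<close>: for \<open>m \<le> 0\<close> this is the rule for
  \<open>bessel_clifford\<close>, for \<open>m > 0\<close> the product rule combined with the
  recurrence.\<close>

lemma has_field_derivative_bessel_J:
  "(bessel_J m has_field_derivative bessel_J (m - 1) x) (at x)"
proof (cases m rule: int_cases_nonpos)
  case (1 n)
  have "((\<lambda>x. x ^ Suc n * bessel_clifford (Suc n) x) has_field_derivative
      real (Suc n) * x ^ n * bessel_clifford (Suc n) x + bessel_clifford (Suc (Suc n)) x * x ^ Suc n) (at x)"
    by (rule DERIV_cong[OF DERIV_mult[OF DERIV_pow has_field_derivative_bessel_clifford]]) simp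
  moreover have "real (Suc n) * x ^ n * bessel_clifford (Suc n) x + bessel_clifford (Suc (Suc n)) x * x ^ Suc n =
      x ^ n * bessel_clifford n x"
    unfolding bessel_clifford_rec[of n x] by (simp add: algebra_simps)
  moreover have "bessel_J m = (\<lambda>x. x ^ Suc n * bessel_clifford (Suc n) x)"
    unfolding 1 fun_eq_iff by (intro allI bessel_J_nonneg)
  moreover have "m - 1 = int n" using 1 by simp
  ultimately show ?thesis by (simp add: bessel_J_nonneg del: of_nat_Suc power_Suc)
next
  case (2 n)
  have "bessel_J m = bessel_clifford n" unfolding 2 fun_eq_iff by (intro allI bessel_J_nonpos)
  moreover have "m - 1 = - int (Suc n)" using 2 by simp
  ultimately show ?thesis using has_field_derivative_bessel_clifford[of n x] by (simp only: bessel_J_nonpos)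
qed

text \<open>The classical relation \<open>I_{m-1}(z) - I_{m+1}(z) = (2 m / z) I_m(z)\<close> at
  \<open>z = 2 sqrt x\<close>.\<close>

lemma bessel_J_rec: "x * bessel_J (m - 1) x - bessel_J (m + 1) x = of_int m * bessel_J m x"
proof -
  consider n where "m = int (Suc n)" | "m = 0" | n where "m = - int (Suc n)"
    by (metis int_cases2 of_nat_0 minus_zero old.nat.exhaust)
  then show ?thesis
  proof cases
    case (1 n)
    then have eq: "m - 1 = int n" "m + 1 = int (n + 2)" "of_int m = real (n + 1)" by auto
    have "bessel_J m x = x ^ (n + 1) * bessel_clifford (n + 1) x"
      using bessel_J_nonneg[of "Suc n" x] 1 by simp
    then show ?thesis
      unfolding eq bessel_J_nonneg bessel_clifford_rec[of n x] by (simp add: algebra_simps)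
  next
    case 2
    then show ?thesis using bessel_J_nonneg[of 1 x] bessel_J_nonpos[of 1 x] by simp
  next
    case (3 n)
    then have eq: "m - 1 = - int (n + 2)" "m + 1 = - int n" "of_int m = - real (n + 1)" by auto
    have "bessel_J m x = bessel_clifford (n + 1) x"
      using bessel_J_nonpos[of "Suc n" x] 3 by simp
    then show ?thesis
      unfolding eq bessel_J_nonpos bessel_clifford_rec[of n x] by (simp add: algebra_simps)
  qed
qed

section \<open>Symmetry in the order and non-vanishing of the determinants\<close>

lemma bessel_J_reflect: "x ^ n * bessel_J (- int n) x = bessel_J (int n) x"
  by (simp only: bessel_J_nonneg bessel_J_nonpos)

lemma bessel_J_reflect': "x ^ i * bessel_J (int j - int i) x = x ^ j * bessel_J (int i - int j) x"
proof (cases "i \<le> j")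
  case True
  then obtain d where "j = i + d" using le_Suc_ex by blast
  then show ?thesis using bessel_J_reflect[of x d] by (simp add: power_add)
next
  case False
  then obtain d where "i = j + d" using le_Suc_ex nat_le_linear by blast
  then show ?thesis using bessel_J_reflect[of x d] by (simp add: power_add)
qed

text \<open>For \<open>j \<le> i\<close> the terms with \<open>l < i\<close> vanish, and
  \<open>l = k + i\<close> gives \<open>x ^ i\<close> times the series of
  \<open>bessel_clifford (i - j)\<close>. The entries thereby become inner products with weights
  \<open>x ^ l\<close>.\<close>

lemma bessel_J_gram_sums:
  assumes "\<phi> = (\<lambda>l i. if l < i then 0 else 1 / fact (l - i) :: real)"
  shows "(\<lambda>l. x ^ l * (\<phi> l i * \<phi> l j)) sums (x ^ j * bessel_J (int i - int j) x)"
proof -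
  have *: "(\<lambda>l. x ^ l * (\<phi> l i * \<phi> l j)) sums (x ^ i * bessel_clifford (i - j) x)" if "j \<le> i" for i j
  proof -
    have "(\<lambda>k. x ^ (k + i) * (\<phi> (k + i) i * \<phi> (k + i) j)) =
          (\<lambda>k. x ^ i * (x ^ k / (fact k * fact (k + (i - j)))))"
      using that by (simp add: fun_eq_iff assms power_add)
    then have "(\<lambda>k. x ^ (k + i) * (\<phi> (k + i) i * \<phi> (k + i) j)) sums (x ^ i * bessel_clifford (i - j) x)"
      using sums_mult[OF bessel_clifford_sums] by simp
    then show ?thesis
      by (subst (asm) sums_zero_iff_shift) (auto simp: assms)
  qed
  show ?thesis
  proof (cases "j \<le> i")
    case True
    have "x ^ j * bessel_J (int i - int j) x = x ^ i * bessel_clifford (i - j) x"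
      using True bessel_J_nonneg[of "i - j" x] by (simp add: of_nat_diff flip: power_add mult.assoc)
    then show ?thesis using *[OF True] by simp
  next
    case False
    then have "int i - int j = - int (j - i)" by simp
    then show ?thesis using *[of i j] False by (simp only: bessel_J_nonpos mult.commute[of "\<phi> _ i"])
  qed
qed

text \<open>Up to a diagonal factor the matrix is the Gram matrix of the linearly independent
  vectors \<open>\<phi> _ i\<close> in a weighted \<open>\<ell>\<^sup>2\<close>-space.\<close>

lemma fdet_bessel_J_nonzero:
  assumes "x > 0"
  shows "fdet n (\<lambda>i j. bessel_J (int i - int j) x) \<noteq> 0"
proof
  define \<phi> where "\<phi> = (\<lambda>l i. if l < i then 0 else 1 / fact (l - i) :: real)"
  define G where "G = (\<lambda>i j. x ^ j * bessel_J (int i - int j) x)"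
  assume "fdet n (\<lambda>i j. bessel_J (int i - int j) x) = 0"
  then have "fdet n G = 0"
    using fdet_scale[of n "\<lambda>_. 1" "\<lambda>j. x ^ j" "\<lambda>i j. bessel_J (int i - int j) x"] by (simp add: G_def)
  then obtain v where v: "v \<in> carrier_vec n" "v \<noteq> 0\<^sub>v n" "mat n n (\<lambda>(i, j). G i j) *\<^sub>v v = 0\<^sub>v n"
    unfolding fdet_def by (subst (asm) det_0_iff_vec_prod_zero_field[of _ n]) auto
  define u where "u i = vec_index v i" for i
  have Gu: "(\<Sum>j<n. G i j * u j) = 0" if "i < n" for i
  proof -
    have "vec_index (mat n n (\<lambda>(i, j). G i j) *\<^sub>v v) i = 0"
      unfolding v(3) using that by simp
    then show ?thesis
      using that v(1) by (simp add: scalar_prod_def atLeast0LessThan u_def)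
  qed
  \<comment> \<open>The quadratic form of \<open>G\<close> at the kernel vector \<open>u\<close> is
    a series of weighted squares; its value \<open>0\<close> kills every term.\<close>
  have "(\<lambda>l. \<Sum>i<n. \<Sum>j<n. u i * u j * (x ^ l * (\<phi> l i * \<phi> l j))) sums (\<Sum>i<n. \<Sum>j<n. u i * u j * G i j)"
    unfolding G_def by (intro sums_sum sums_mult bessel_J_gram_sums[OF \<phi>_def])
  also have "(\<Sum>i<n. \<Sum>j<n. u i * u j * G i j) = (\<Sum>i<n. u i * (\<Sum>j<n. G i j * u j))"
    by (simp add: sum_distrib_left mult_ac)
  also have "\<dots> = 0" using Gu by simp
  also have "(\<lambda>l. \<Sum>i<n. \<Sum>j<n. u i * u j * (x ^ l * (\<phi> l i * \<phi> l j))) = (\<lambda>l. x ^ l * (\<Sum>i<n. u i * \<phi> l i)\<^sup>2)"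
    by (simp add: fun_eq_iff power2_eq_square sum_distrib_left sum_distrib_right mult_ac)
  finally have sums: "(\<lambda>l. x ^ l * (\<Sum>i<n. u i * \<phi> l i)\<^sup>2) sums 0" .
  have zero: "(\<Sum>i<n. u i * \<phi> l i) = 0" for l
  proof -
    have "\<forall>l. x ^ l * (\<Sum>i<n. u i * \<phi> l i)\<^sup>2 = 0"
      using sums assms by (subst suminf_eq_zero_iff[symmetric]) (auto simp: sums_iff)
    then show ?thesis using assms by auto
  qed
  \<comment> \<open>\<open>\<phi>\<close> is unit lower triangular, so the vanishing combinations
    give \<open>u l = 0\<close> one index after another.\<close>
  have "l < n \<longrightarrow> u l = 0" for l
  proof (induction l rule: less_induct)
    case (less l)
    show ?case
    proof
      assume l: "l < n"
      have "(\<Sum>i<n. u i * \<phi> l i) = (\<Sum>i<n. if i = l then u l else 0)"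
        using less by (intro sum.cong) (auto simp: \<phi>_def not_less)
      with l zero[of l] show "u l = 0" by simp
    qed
  qed
  then have "v = 0\<^sub>v n"
    using v(1) by (intro eq_vecI) (auto simp: u_def)
  with v(2) show False by contradiction
qed

text \<open>Raising or lowering all indices of a determinant with consecutive rows (or columns) moves
  only the outermost row (or column).\<close>

lemma fdet'_raise_rows:
  "fdet' (Suc m) (\<lambda>i j. h (k + int i - c j)) (\<lambda>i j. h (k + int i - c j + 1)) =
     fdet (Suc m) (\<lambda>i j. h ((if i = m then k + int m + 1 else k + int i) - c j))"
proof -
  have "fdet (Suc m) (\<lambda>i j. if i = r then h (k + int i - c j + 1) else h (k + int i - c j)) = 0" if "r < m" for r
    by (rule fdet_identical_rows[of r _ "Suc r"]) (use that in \<open>auto simp: algebra_simps\<close>)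
  then have "fdet' (Suc m) (\<lambda>i j. h (k + int i - c j)) (\<lambda>i j. h (k + int i - c j + 1)) =
     fdet (Suc m) (\<lambda>i j. if i = m then h (k + int i - c j + 1) else h (k + int i - c j))"
    unfolding fdet'_def by simp
  also have "\<dots> = fdet (Suc m) (\<lambda>i j. h ((if i = m then k + int m + 1 else k + int i) - c j))"
    by (rule fdet_cong) (auto simp: algebra_simps)
  finally show ?thesis .
qed

lemma fdet'_lower_rows:
  "fdet' (Suc m) (\<lambda>i j. h (k + int i - c j)) (\<lambda>i j. h (k + int i - c j - 1)) =
     fdet (Suc m) (\<lambda>i j. h ((if i = 0 then k - 1 else k + int i) - c j))"
proof -
  have "fdet (Suc m) (\<lambda>i j. if i = Suc r then h (k + int i - c j - 1) else h (k + int i - c j)) = 0" if "r < m" for r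
    by (rule fdet_identical_rows[of r _ "Suc r"]) (use that in \<open>auto simp: algebra_simps\<close>)
  then have "fdet' (Suc m) (\<lambda>i j. h (k + int i - c j)) (\<lambda>i j. h (k + int i - c j - 1)) =
     fdet (Suc m) (\<lambda>i j. if i = 0 then h (k + int i - c j - 1) else h (k + int i - c j))"
    unfolding fdet'_def by (subst sum.lessThan_Suc_shift) simp
  also have "\<dots> = fdet (Suc m) (\<lambda>i j. h ((if i = 0 then k - 1 else k + int i) - c j))"
    by (rule fdet_cong) (auto simp: algebra_simps)
  finally show ?thesis .
qed

text \<open>Columns enter with a minus sign, so raising the argument of \<open>h\<close> lowers the
  column index. After transposition and reflection of \<open>h\<close> this is the lowering of
  rows.\<close>

lemma fdet'_raise_cols:
  "fdet' (Suc m) (\<lambda>i j. h (r i - (k + int j))) (\<lambda>i j. h (r i - (k + int j) + 1)) =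
     fdet (Suc m) (\<lambda>i j. h (r i - (if j = 0 then k - 1 else k + int j)))"
proof -
  have "fdet' (Suc m) (\<lambda>i j. h (r i - (k + int j))) (\<lambda>i j. h (r i - (k + int j) + 1)) =
    fdet' (Suc m) (\<lambda>j i. h (r i - (k + int j))) (\<lambda>j i. h (r i - (k + int j) + 1))"
    by (rule fdet'_transpose)
  also have "\<dots> = fdet' (Suc m) (\<lambda>j i. (\<lambda>z. h (- z)) (k + int j - r i)) (\<lambda>j i. (\<lambda>z. h (- z)) (k + int j - r i - 1))"
    by (rule fdet'_cong) (auto simp: algebra_simps)
  also have "\<dots> = fdet (Suc m) (\<lambda>j i. (\<lambda>z. h (- z)) ((if j = 0 then k - 1 else k + int j) - r i))"
    by (rule fdet'_lower_rows)
  also have "\<dots> = fdet (Suc m) (\<lambda>j i. h (r i - (if j = 0 then k - 1 else k + int j)))"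
    by (rule fdet_cong) auto
  also have "\<dots> = fdet (Suc m) (\<lambda>i j. h (r i - (if j = 0 then k - 1 else k + int j)))"
    by (rule fdet_transpose)
  finally show ?thesis .
qed

lemma fdet'_lower_cols:
  "fdet' (Suc m) (\<lambda>i j. h (r i - (k + int j))) (\<lambda>i j. h (r i - (k + int j) - 1)) =
     fdet (Suc m) (\<lambda>i j. h (r i - (if j = m then k + int m + 1 else k + int j)))"
proof -
  have "fdet' (Suc m) (\<lambda>i j. h (r i - (k + int j))) (\<lambda>i j. h (r i - (k + int j) - 1)) =
    fdet' (Suc m) (\<lambda>j i. h (r i - (k + int j))) (\<lambda>j i. h (r i - (k + int j) - 1))"
    by (rule fdet'_transpose)
  also have "\<dots> = fdet' (Suc m) (\<lambda>j i. (\<lambda>z. h (- z)) (k + int j - r i)) (\<lambda>j i. (\<lambda>z. h (- z)) (k + int j - r i + 1))"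
    by (rule fdet'_cong) (auto simp: algebra_simps)
  also have "\<dots> = fdet (Suc m) (\<lambda>j i. (\<lambda>z. h (- z)) ((if j = m then k + int m + 1 else k + int j) - r i))"
    by (rule fdet'_raise_rows)
  also have "\<dots> = fdet (Suc m) (\<lambda>j i. h (r i - (if j = m then k + int m + 1 else k + int j)))"
    by (rule fdet_cong) auto
  also have "\<dots> = fdet (Suc m) (\<lambda>i j. h (r i - (if j = m then k + int m + 1 else k + int j)))"
    by (rule fdet_transpose)
  finally show ?thesis .
qed

section \<open>Quadratic identities between Toeplitz determinants\<close>

definition toeplitz :: "(int \<Rightarrow> real) \<Rightarrow> int \<Rightarrow> nat \<Rightarrow> real" where
  "toeplitz h k n = fdet n (\<lambda>i j. h (k + int i - int j))"

lemma fdet_rotate_rows: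
  "fdet (Suc m) (\<lambda>i j. f (if i < m then Suc i else 0) j) = (-1) ^ m * fdet (Suc m) f"
proof -
  have "fdet (Suc m) f = (-1) ^ (1 * m) * fdet (Suc m)
      (\<lambda>i j. f (if i < m then i + 1 else if i < 1 + m then i - m else i) j)"
    by (rule fdet_swap_initial_rows) simp
  also have "fdet (Suc m) (\<lambda>i j. f (if i < m then i + 1 else if i < 1 + m then i - m else i) j) =
      fdet (Suc m) (\<lambda>i j. f (if i < m then Suc i else 0) j)"
    by (rule fdet_cong) auto
  finally show ?thesis by (simp flip: mult.assoc power_mult_distrib)
qed

lemma fdet_rotate_cols:
  "fdet (Suc m) (\<lambda>i j. f i (if j < m then Suc j else 0)) = (-1) ^ m * fdet (Suc m) f"
proof -
  have "fdet (Suc m) (\<lambda>i j. f i (if j < m then Suc j else 0)) =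
     fdet (Suc m) (\<lambda>j i. f i (if j < m then Suc j else 0))" by (rule fdet_transpose)
  also have "\<dots> = (-1) ^ m * fdet (Suc m) (\<lambda>j i. f i j)"
    using fdet_rotate_rows[of m "\<lambda>j i. f i j"] .
  also have "fdet (Suc m) (\<lambda>j i. f i j) = fdet (Suc m) f" by (rule fdet_transpose)
  finally show ?thesis .
qed

lemma minus_one_power_cancel: "(-1) ^ m * a * ((-1) ^ m * b) = a * (b :: real)"
  by (simp add: mult.assoc mult.left_commute[of a] flip: power_mult_distrib mult.assoc)

text \<open>Sylvester's identity with the outermost rows and columns as border (Dodgson
  condensation): all minors are contiguous and hence Toeplitz again, with the diagonal index shifted
  by one in the mixed ones.\<close>

lemma toeplitz_dodgson:
  "toeplitz h k (m + 2) * toeplitz h k m = (toeplitz h k (m + 1))\<^sup>2 - toeplitz h (k - 1) (m + 1) * toeplitz h (k + 1) (m + 1)"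
proof -
  \<comment> \<open>The inner indices \<open>1, ..., m\<close> come to the front; positions
    \<open>m\<close> and \<open>m + 1\<close> hold the two outermost ones.\<close>
  define r :: "nat \<Rightarrow> nat" where "r i = (if i < m then Suc i else if i = m then 0 else i)" for i
  define f where "f i j = h (k + int (r i) - int (r j))" for i j
  let ?s = "\<lambda>i. if i < m then i else i + 1"
  have "fdet (m + 2) f = toeplitz h k (m + 2)"
  proof -
    have "toeplitz h k (m + 2) = (-1) ^ m * fdet (m + 2) (\<lambda>i j. h (k + int (r i) - int j))"
      unfolding toeplitz_def by (subst fdet_swap_initial_rows[of 1 m])
        (auto intro!: fdet_cong arg_cong[where f = h] simp: r_def)
    also have "fdet (m + 2) (\<lambda>i j. h (k + int (r i) - int j)) = (-1) ^ m * fdet (m + 2) f"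
      unfolding f_def by (subst fdet_swap_initial_cols[of 1 m])
        (auto intro!: fdet_cong arg_cong[where f = h] simp: r_def)
    finally show ?thesis by (simp flip: mult.assoc power_mult_distrib)
  qed
  moreover have "fdet m f = toeplitz h k m"
    unfolding toeplitz_def by (rule fdet_cong) (auto simp: f_def r_def intro!: arg_cong[where f = h])
  moreover have "fdet (m + 1) f = toeplitz h k (m + 1)"
  proof -
    have "fdet (m + 1) f = fdet (Suc m) (\<lambda>i j. h (k + int (if i < m then Suc i else 0) - int (if j < m then Suc j else 0)))"
      unfolding Suc_eq_plus1[symmetric] by (rule fdet_cong) (auto simp: f_def r_def intro!: arg_cong[where f = h])
    also have "\<dots> = (-1) ^ m * ((-1) ^ m * toeplitz h k (m + 1))"
      unfolding toeplitz_def Suc_eq_plus1[symmetric] fdet_rotate_rows[of m "\<lambda>i j. h (k + int i - int (if j < m then Suc j else 0))"]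
        fdet_rotate_cols[of m "\<lambda>i j. h (k + int i - int j)"] ..
    finally show ?thesis by (simp flip: mult.assoc power_mult_distrib)
  qed
  moreover have "fdet (m + 1) (\<lambda>i j. f (?s i) (?s j)) = toeplitz h k (m + 1)"
    unfolding toeplitz_def by (rule fdet_cong) (auto simp: f_def r_def intro!: arg_cong[where f = h])
  moreover have "fdet (m + 1) (\<lambda>i j. f i (?s j)) = (-1) ^ m * toeplitz h (k - 1) (m + 1)"
  proof -
    have "fdet (m + 1) (\<lambda>i j. f i (?s j)) = fdet (Suc m) (\<lambda>i j. h (k - 1 + int (if i < m then Suc i else 0) - int j))"
      unfolding Suc_eq_plus1[symmetric] by (rule fdet_cong) (auto simp: f_def r_def intro!: arg_cong[where f = h])
    also have "\<dots> = (-1) ^ m * toeplitz h (k - 1) (m + 1)"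
      unfolding toeplitz_def Suc_eq_plus1[symmetric] fdet_rotate_rows[of m "\<lambda>i j. h (k - 1 + int i - int j)"] ..
    finally show ?thesis .
  qed
  moreover have "fdet (m + 1) (\<lambda>i j. f (?s i) j) = (-1) ^ m * toeplitz h (k + 1) (m + 1)"
  proof -
    have "fdet (m + 1) (\<lambda>i j. f (?s i) j) = fdet (Suc m) (\<lambda>i j. h (k + 1 + int i - int (if j < m then Suc j else 0)))"
      unfolding Suc_eq_plus1[symmetric] by (rule fdet_cong) (auto simp: f_def r_def intro!: arg_cong[where f = h])
    also have "\<dots> = (-1) ^ m * toeplitz h (k + 1) (m + 1)"
      unfolding toeplitz_def Suc_eq_plus1[symmetric] fdet_rotate_cols[of m "\<lambda>i j. h (k + 1 + int i - int j)"] ..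
    finally show ?thesis .
  qed
  ultimately show ?thesis
    using fdet_sylvester[of m f] by (simp add: minus_one_power_cancel power2_eq_square)
qed

lemma fdet_rotate2_rows:
  "fdet (m + 2) (\<lambda>i j. f (if i < m then i + 2 else i - m) j) = fdet (m + 2) f"
proof -
  have "fdet (m + 2) f = (-1) ^ (2 * m) * fdet (m + 2)
      (\<lambda>i j. f (if i < m then i + 2 else if i < 2 + m then i - m else i) j)"
    by (rule fdet_swap_initial_rows) simp
  also have "fdet (m + 2) (\<lambda>i j. f (if i < m then i + 2 else if i < 2 + m then i - m else i) j) =
      fdet (m + 2) (\<lambda>i j. f (if i < m then i + 2 else i - m) j)"
    by (rule fdet_cong) auto
  finally show ?thesis by simp
qed

lemma fdet_rotate2_cols:
  "fdet (m + 2) (\<lambda>i j. f i (if j < m then j + 2 else j - m)) = fdet (m + 2) f"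
proof -
  have "fdet (m + 2) f = (-1) ^ (2 * m) * fdet (m + 2)
      (\<lambda>i j. f i (if j < m then j + 2 else if j < 2 + m then j - m else j))"
    by (rule fdet_swap_initial_cols) simp
  also have "fdet (m + 2) (\<lambda>i j. f i (if j < m then j + 2 else if j < 2 + m then j - m else j)) =
      fdet (m + 2) (\<lambda>i j. f i (if j < m then j + 2 else j - m))"
    by (rule fdet_cong) auto
  finally show ?thesis by simp
qed

text \<open>Sylvester's identity for the rows \<open>1, ..., m + 2\<close> and the columns
  \<open>-1, ..., m\<close>, where the border consists of the last two rows and the columns
  \<open>-1\<close> and \<open>0\<close>. The order is row minus column, so the diagonal order is
  \<open>2\<close> for the whole matrix and \<open>0\<close> for the core.\<close>

lemma toeplitz_plucker_raise:
  "toeplitz h 2 (m + 2) * toeplitz h 0 m =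
     fdet (Suc m) (\<lambda>i j. h (1 + int i - (if j = 0 then -1 else int j))) *
     fdet (Suc m) (\<lambda>i j. h ((if i = m then int m + 2 else 1 + int i) - int j)) -
     toeplitz h 1 (m + 1) *
     fdet (Suc m) (\<lambda>i j. h ((if i = m then int m + 2 else 1 + int i) - (if j = 0 then -1 else int j)))"
proof -
  define f where "f i j = h (1 + int i - (if j < m then int j + 1 else if j = m then -1 else 0))" for i j
  let ?s = "\<lambda>i. if i < m then i else i + 1"
  have 1: "fdet (m + 2) f = toeplitz h 2 (m + 2)"
    unfolding toeplitz_def fdet_rotate2_cols[of m "\<lambda>i j. h (2 + int i - int j)", symmetric]
    by (rule fdet_cong) (auto simp: f_def intro!: arg_cong[where f = h])
  have 2: "fdet m f = toeplitz h 0 m"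
    unfolding toeplitz_def by (rule fdet_cong) (auto simp: f_def intro!: arg_cong[where f = h])
  have 3: "fdet (m + 1) f = (-1) ^ m * fdet (Suc m) (\<lambda>i j. h (1 + int i - (if j = 0 then -1 else int j)))"
    unfolding Suc_eq_plus1[symmetric] fdet_rotate_cols[symmetric]
    by (rule fdet_cong) (auto simp: f_def intro!: arg_cong[where f = h])
  have 4: "fdet (m + 1) (\<lambda>i j. f (?s i) (?s j)) =
      (-1) ^ m * fdet (Suc m) (\<lambda>i j. h ((if i = m then int m + 2 else 1 + int i) - int j))"
    unfolding Suc_eq_plus1[symmetric] fdet_rotate_cols[symmetric]
    by (rule fdet_cong) (auto simp: f_def intro!: arg_cong[where f = h])
  have 5: "fdet (m + 1) (\<lambda>i j. f i (?s j)) = (-1) ^ m * toeplitz h 1 (m + 1)"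
    unfolding toeplitz_def Suc_eq_plus1[symmetric] fdet_rotate_cols[symmetric]
    by (rule fdet_cong) (auto simp: f_def intro!: arg_cong[where f = h])
  have 6: "fdet (m + 1) (\<lambda>i j. f (?s i) j) =
     (-1) ^ m * fdet (Suc m) (\<lambda>i j. h ((if i = m then int m + 2 else 1 + int i) - (if j = 0 then -1 else int j)))"
    unfolding Suc_eq_plus1[symmetric] fdet_rotate_cols[symmetric]
    by (rule fdet_cong) (auto simp: f_def intro!: arg_cong[where f = h])
  show ?thesis
    using fdet_sylvester[of m f] unfolding 1 2 3 4 5 6 minus_one_power_cancel .
qed

text \<open>The counterpart with rows and columns \<open>0, ..., m + 1\<close>, bordered by the rows
  \<open>0\<close>, \<open>1\<close> and the last two columns; here the core has diagonal order
  \<open>2\<close>.\<close>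

lemma toeplitz_plucker_lower:
  "toeplitz h 0 (m + 2) * toeplitz h 2 m =
     fdet (Suc m) (\<lambda>i j. h ((if i = 0 then 0 else 1 + int i) - int j)) *
     fdet (Suc m) (\<lambda>i j. h (1 + int i - (if j = m then int m + 1 else int j))) -
     fdet (Suc m) (\<lambda>i j. h ((if i = 0 then 0 else 1 + int i) - (if j = m then int m + 1 else int j))) *
     toeplitz h 1 (m + 1)"
proof -
  define f where "f i j = h ((if i < m then int i + 2 else int (i - m)) - int j)" for i j
  let ?s = "\<lambda>i. if i < m then i else i + 1"
  have 1: "fdet (m + 2) f = toeplitz h 0 (m + 2)"
    unfolding toeplitz_def fdet_rotate2_rows[of m "\<lambda>i j. h (0 + int i - int j)", symmetric]
    by (rule fdet_cong) (auto simp: f_def intro!: arg_cong[where f = h])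
  have 2: "fdet m f = toeplitz h 2 m"
    unfolding toeplitz_def by (rule fdet_cong) (auto simp: f_def intro!: arg_cong[where f = h])
  have 3: "fdet (m + 1) f = (-1) ^ m * fdet (Suc m) (\<lambda>i j. h ((if i = 0 then 0 else 1 + int i) - int j))"
    unfolding Suc_eq_plus1[symmetric] fdet_rotate_rows[symmetric]
    by (rule fdet_cong) (auto simp: f_def intro!: arg_cong[where f = h])
  have 4: "fdet (m + 1) (\<lambda>i j. f (?s i) (?s j)) =
      (-1) ^ m * fdet (Suc m) (\<lambda>i j. h (1 + int i - (if j = m then int m + 1 else int j)))"
    unfolding Suc_eq_plus1[symmetric] fdet_rotate_rows[symmetric]
    by (rule fdet_cong) (auto simp: f_def intro!: arg_cong[where f = h])
  have 5: "fdet (m + 1) (\<lambda>i j. f i (?s j)) =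
      (-1) ^ m * fdet (Suc m) (\<lambda>i j. h ((if i = 0 then 0 else 1 + int i) - (if j = m then int m + 1 else int j)))"
    unfolding Suc_eq_plus1[symmetric] fdet_rotate_rows[symmetric]
    by (rule fdet_cong) (auto simp: f_def intro!: arg_cong[where f = h])
  have 6: "fdet (m + 1) (\<lambda>i j. f (?s i) j) = (-1) ^ m * toeplitz h 1 (m + 1)"
    unfolding toeplitz_def Suc_eq_plus1[symmetric] fdet_rotate_rows[symmetric]
    by (rule fdet_cong) (auto simp: f_def intro!: arg_cong[where f = h])
  show ?thesis
    using fdet_sylvester[of m f] unfolding 1 2 3 4 5 6 minus_one_power_cancel .
qed

text \<open>The border is formed by the last two rows and columns, without reordering. Compared with
  \<open>toeplitz_dodgson\<close> at \<open>k = 1\<close>, this evaluates the product of the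
  determinants with diagonal orders \<open>0\<close> and \<open>2\<close>.\<close>

lemma toeplitz_plucker_mixed:
  "toeplitz h 1 (m + 2) * toeplitz h 1 m =
     toeplitz h 1 (m + 1) *
     fdet (Suc m) (\<lambda>i j. h ((if i = m then int m + 2 else 1 + int i) - (if j = m then int m + 1 else int j))) -
     fdet (Suc m) (\<lambda>i j. h (1 + int i - (if j = m then int m + 1 else int j))) *
     fdet (Suc m) (\<lambda>i j. h ((if i = m then int m + 2 else 1 + int i) - int j))"
proof -
  define f where "f i j = h (1 + int i - int j)" for i j
  let ?s = "\<lambda>i. if i < m then i else i + 1"
  have 1: "fdet (m + 1) (\<lambda>i j. f (?s i) (?s j)) =
      fdet (Suc m) (\<lambda>i j. h ((if i = m then int m + 2 else 1 + int i) - (if j = m then int m + 1 else int j)))"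
    unfolding Suc_eq_plus1[symmetric] by (rule fdet_cong) (auto simp: f_def intro!: arg_cong[where f = h])
  have 2: "fdet (m + 1) (\<lambda>i j. f i (?s j)) = fdet (Suc m) (\<lambda>i j. h (1 + int i - (if j = m then int m + 1 else int j)))"
    unfolding Suc_eq_plus1[symmetric] by (rule fdet_cong) (auto simp: f_def intro!: arg_cong[where f = h])
  have 3: "fdet (m + 1) (\<lambda>i j. f (?s i) j) = fdet (Suc m) (\<lambda>i j. h ((if i = m then int m + 2 else 1 + int i) - int j))"
    unfolding Suc_eq_plus1[symmetric] by (rule fdet_cong) (auto simp: f_def intro!: arg_cong[where f = h])
  show ?thesis
    using fdet_sylvester[of m f] unfolding 1 2 3 unfolding f_def toeplitz_def .
qed

section \<open>The derivative of the Bessel Toeplitz determinants\<close>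

abbreviation toeplitz_J :: "int \<Rightarrow> nat \<Rightarrow> real \<Rightarrow> real" where
  "toeplitz_J k n x \<equiv> toeplitz (\<lambda>m. bessel_J m x) k n"

definition toeplitz_J' :: "int \<Rightarrow> nat \<Rightarrow> real \<Rightarrow> real" where
  "toeplitz_J' k n x = fdet' n (\<lambda>i j. bessel_J (k + int i - int j) x) (\<lambda>i j. bessel_J (k + int i - int j - 1) x)"

lemma has_field_derivative_toeplitz_J:
  "(toeplitz_J k n has_field_derivative toeplitz_J' k n x) (at x)"
  unfolding toeplitz_def toeplitz_J'_def
  by (rule has_field_derivative_fdet) (rule has_field_derivative_bessel_J)

text \<open>By \<open>I_{-m} = I_m\<close> the matrices with diagonal orders \<open>1\<close> and
  \<open>-1\<close> are transposes of each other up to row and column factors, which contribute one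
  \<open>x\<close> per row.\<close>

lemma toeplitz_J_reflect: "x ^ n * toeplitz_J (- 1) n x = toeplitz_J 1 n x" if "x > 0"
proof -
  have "x ^ i * bessel_J (1 + int j - int i) x = x * x ^ j * bessel_J (- 1 + int i - int j) x" for i j
    using bessel_J_reflect'[of x i "Suc j"] by (simp add: algebra_simps)
  then have "bessel_J (1 + int j - int i) x = inverse (x ^ i) * (x * x ^ j) * bessel_J (- 1 + int i - int j) x" for i j
    using that by (simp add: field_simps)
  then have "fdet n (\<lambda>i j. bessel_J (1 + int j - int i) x) =
      fdet n (\<lambda>i j. inverse (x ^ i) * (x * x ^ j) * bessel_J (- 1 + int i - int j) x)" by simp
  also have "\<dots> = (\<Prod>i<n. inverse (x ^ i)) * (\<Prod>j<n. x * x ^ j) * toeplitz_J (- 1) n x"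
    unfolding toeplitz_def by (rule fdet_scale)
  also have "(\<Prod>i<n. inverse (x ^ i)) * (\<Prod>j<n. x * x ^ j) = (\<Prod>i<n. inverse (x ^ i) * (x * x ^ i))"
    by (simp only: prod.distrib)
  also have "\<dots> = (\<Prod>i<n. x)" using that by (intro prod.cong) auto
  also have "\<dots> = x ^ n" by simp
  also have "fdet n (\<lambda>i j. bessel_J (1 + int j - int i) x) = toeplitz_J 1 n x"
    unfolding toeplitz_def by (rule fdet_transpose)
  finally show ?thesis ..
qed

text \<open>The recurrence in every entry: its weight is the order \<open>r i - c j\<close>, so the
  constant of \<open>fdet'_weights\<close> is the sum of the orders on the diagonal.\<close>

lemma fdet'_bessel_J_weights:
  assumes "\<And>i j. i < n \<Longrightarrow> j < n \<Longrightarrow> A i j = bessel_J (r i - c j) x"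
    and "\<And>i j. i < n \<Longrightarrow> j < n \<Longrightarrow> L i j = bessel_J (r i - c j - 1) x"
    and "\<And>i j. i < n \<Longrightarrow> j < n \<Longrightarrow> U i j = bessel_J (r i - c j + 1) x"
  shows "x * fdet' n A L - fdet' n A U = of_int ((\<Sum>i<n. r i) - (\<Sum>j<n. c j)) * fdet n A"
proof -
  have "x * fdet' n A L - fdet' n A U = fdet' n A (\<lambda>i j. x * L i j + (- 1) * U i j)"
    unfolding fdet'_linear by simp
  also have "\<dots> = ((\<Sum>i<n. of_int (r i)) - (\<Sum>j<n. of_int (c j))) * fdet n A"
  proof (rule fdet'_weights)
    fix i j assume "i < n" "j < n"
    then show "x * L i j + - 1 * U i j = (real_of_int (r i) - real_of_int (c j)) * A i j"
      using bessel_J_rec[of x "r i - c j"] by (simp add: assms)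
  qed
  finally show ?thesis by simp
qed


text \<open>Differentiating Dodgson's identity at diagonal order \<open>0\<close> relates
  \<open>d0\<close>, \<open>d1\<close>, \<open>d2\<close>. The hypotheses replace \<open>d0\<close>
  and \<open>d1\<close>, and reflection removes the determinant of diagonal order \<open>-1\<close>.
  What is left is a polynomial relation between \<open>B\<close> and its shifted forms, which the
  Sylvester identities and the weight relations settle.\<close>

lemma toeplitz_J_step:
  assumes "x > 0"
    and IH0: "x ^ m * (toeplitz_J 0 m x - toeplitz_J' 0 m x) = toeplitz_J 2 m x"
    and IH1: "x ^ (m + 1) * (toeplitz_J 0 (m + 1) x - toeplitz_J' 0 (m + 1) x) = toeplitz_J 2 (m + 1) x"
  shows "x ^ (m + 2) * (toeplitz_J 0 (m + 2) x - toeplitz_J' 0 (m + 2) x) = toeplitz_J 2 (m + 2) x"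
proof -
  let ?h = "\<lambda>m. bessel_J m x"
  define B where "B = toeplitz_J 1 (m + 1) x"
  define UB where "UB = fdet (Suc m) (\<lambda>i j. ?h ((if i = m then int m + 2 else 1 + int i) - int j))"
  define VB where "VB = fdet (Suc m) (\<lambda>i j. ?h (1 + int i - (if j = m then int m + 1 else int j)))"
  define UUB where "UUB = fdet (Suc m) (\<lambda>i j. ?h ((if i = m then int m + 2 else 1 + int i) - (if j = 0 then -1 else int j)))"
  define VVB where "VVB = fdet (Suc m) (\<lambda>i j. ?h ((if i = 0 then 0 else 1 + int i) - (if j = m then int m + 1 else int j)))"
  define C where "C = fdet (Suc m) (\<lambda>i j. ?h ((if i = m then int m + 2 else 1 + int i) - (if j = m then int m + 1 else int j)))"
  have "1 + int m + 1 = int m + 2" by simp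
  note idx = this add_0_left diff_0 diff_self
  \<comment> \<open>Raising all orders can be read as moving the last row or the outer column, so
    both minors have the value \<open>UB\<close>; the same holds for lowering and
    \<open>VB\<close>.\<close>
  have UBr: "fdet' (Suc m) (\<lambda>i j. ?h (1 + int i - int j)) (\<lambda>i j. ?h (1 + int i - int j + 1)) = UB"
    unfolding UB_def using fdet'_raise_rows[of m ?h 1 int] unfolding idx .
  have UBc: "fdet' (Suc m) (\<lambda>i j. ?h (1 + int i - int j)) (\<lambda>i j. ?h (1 + int i - int j + 1)) =
      fdet (Suc m) (\<lambda>i j. ?h (1 + int i - (if j = 0 then -1 else int j)))"
    using fdet'_raise_cols[of m ?h "\<lambda>i. 1 + int i" 0] unfolding idx .
  have VBr: "fdet' (Suc m) (\<lambda>i j. ?h (1 + int i - int j)) (\<lambda>i j. ?h (1 + int i - int j - 1)) =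
      fdet (Suc m) (\<lambda>i j. ?h ((if i = 0 then 0 else 1 + int i) - int j))"
    using fdet'_lower_rows[of m ?h 1 int] unfolding idx .
  have VBc: "fdet' (Suc m) (\<lambda>i j. ?h (1 + int i - int j)) (\<lambda>i j. ?h (1 + int i - int j - 1)) = VB"
    unfolding VB_def using fdet'_lower_cols[of m ?h "\<lambda>i. 1 + int i" 0] unfolding idx .
  have E2: "toeplitz_J 2 (m + 2) x * toeplitz_J 0 m x = UB * UB - B * UUB"
    using toeplitz_plucker_raise[of ?h m] unfolding UBc[symmetric] UBr UUB_def[symmetric] B_def UB_def[symmetric] .
  have D2: "toeplitz_J 0 (m + 2) x * toeplitz_J 2 m x = VB * VB - VVB * B"
    using toeplitz_plucker_lower[of ?h m] unfolding VBr[symmetric] VBc VVB_def[symmetric] B_def VB_def[symmetric] .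
  have B2: "toeplitz_J 1 (m + 2) x * toeplitz_J 1 m x = B * C - VB * UB"
    using toeplitz_plucker_mixed[of ?h m] unfolding C_def B_def VB_def UB_def .
  have D20: "toeplitz_J 0 (m + 2) y * toeplitz_J 0 m y = (toeplitz_J 0 (m + 1) y)\<^sup>2 - toeplitz_J (- 1) (m + 1) y * toeplitz_J 1 (m + 1) y" for y
    using toeplitz_dodgson[of "\<lambda>m. bessel_J m y" 0 m] by simp
  have B20: "toeplitz_J 1 (m + 2) x * toeplitz_J 1 m x = B\<^sup>2 - toeplitz_J 0 (m + 1) x * toeplitz_J 2 (m + 1) x"
    using toeplitz_dodgson[of ?h 1 m] by (simp add: B_def)
  \<comment> \<open>The sum of the orders on the diagonal of \<open>B\<close>. Raising the last row
    adds one, whence \<open>n + 1\<close> in \<open>w2\<close>; moving the last column takes one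
    away, whence \<open>n - 1\<close> in \<open>w3\<close>.\<close>
  define n :: real where "n = real m + 1"
  have sums: "(\<Sum>i<Suc m. 1 + int i) - (\<Sum>j<Suc m. int j) = int m + 1"
    by (simp add: sum.distrib)
  have w1: "x * VB - UB = n * B"
    using fdet'_bessel_J_weights[of "Suc m" "\<lambda>i j. ?h (1 + int i - int j)" "\<lambda>i. 1 + int i" int x
        "\<lambda>i j. ?h (1 + int i - int j - 1)" "\<lambda>i j. ?h (1 + int i - int j + 1)"]
    unfolding sums VBc UBr by (simp add: n_def B_def toeplitz_def)
  have w2: "x * C - UUB = (n + 1) * UB"
  proof -
    let ?r = "\<lambda>i. if i = m then int m + 2 else 1 + int i"
    have 1: "fdet' (Suc m) (\<lambda>i j. ?h (?r i - int j)) (\<lambda>i j. ?h (?r i - int j - 1)) = C"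
      unfolding C_def using fdet'_lower_cols[of m ?h ?r 0] unfolding idx .
    have 2: "fdet' (Suc m) (\<lambda>i j. ?h (?r i - int j)) (\<lambda>i j. ?h (?r i - int j + 1)) = UUB"
      unfolding UUB_def using fdet'_raise_cols[of m ?h ?r 0] unfolding idx .
    have 3: "(\<Sum>i<Suc m. ?r i) - (\<Sum>j<Suc m. int j) = int m + 2"
      by (simp add: sum.distrib)
    show ?thesis
      using fdet'_bessel_J_weights[of "Suc m" "\<lambda>i j. ?h (?r i - int j)" ?r int x
        "\<lambda>i j. ?h (?r i - int j - 1)" "\<lambda>i j. ?h (?r i - int j + 1)"]
      unfolding 1 2 3 UB_def[symmetric] by (simp add: n_def)
  qed
  have w3: "x * VVB - C = (n - 1) * VB"
  proof -
    let ?c = "\<lambda>j. if j = m then int m + 1 else int j"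
    have 1: "fdet' (Suc m) (\<lambda>i j. ?h (1 + int i - ?c j)) (\<lambda>i j. ?h (1 + int i - ?c j - 1)) = VVB"
      unfolding VVB_def using fdet'_lower_rows[of m ?h 1 ?c] unfolding idx .
    have 2: "fdet' (Suc m) (\<lambda>i j. ?h (1 + int i - ?c j)) (\<lambda>i j. ?h (1 + int i - ?c j + 1)) = C"
      unfolding C_def using fdet'_raise_rows[of m ?h 1 ?c] unfolding idx .
    have 3: "(\<Sum>i<Suc m. 1 + int i) - (\<Sum>j<Suc m. ?c j) = int m"
      by (simp add: sum.distrib)
    show ?thesis
      using fdet'_bessel_J_weights[of "Suc m" "\<lambda>i j. ?h (1 + int i - ?c j)" "\<lambda>i. 1 + int i" ?c x
        "\<lambda>i j. ?h (1 + int i - ?c j - 1)" "\<lambda>i j. ?h (1 + int i - ?c j + 1)"]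
      unfolding 1 2 3 VB_def[symmetric] by (simp add: n_def)
  qed
  define Bm where "Bm = toeplitz_J (- 1) (m + 1) x"
  define w where "w = toeplitz_J' (- 1) (m + 1) x"
  have VB: "toeplitz_J' 1 (m + 1) x = VB"
    unfolding toeplitz_J'_def Suc_eq_plus1[symmetric] by (rule VBc)
  have y: "x * x ^ m * Bm = B"
    using toeplitz_J_reflect[OF assms(1), of "m + 1"] by (simp add: Bm_def B_def)
  \<comment> \<open>Obtained by differentiating the reflection formula, which holds in a
    neighbourhood of the positive point \<open>x\<close>.\<close>
  have w: "x * (x * x ^ m * w) = x * VB - n * B"
  proof -
    have "((\<lambda>x. x ^ (m + 1) * toeplitz_J (- 1) (m + 1) x) has_field_derivative
        (n * x ^ m * Bm + w * x ^ (m + 1))) (at x)"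
      unfolding Bm_def w_def
      by (rule DERIV_cong[OF DERIV_mult[OF DERIV_pow has_field_derivative_toeplitz_J]]) (simp add: n_def)
    then have "(toeplitz_J 1 (m + 1) has_field_derivative (n * x ^ m * Bm + w * x ^ (m + 1))) (at x)"
    proof (rule DERIV_cong_ev[THEN iffD1, rotated -1])
      have "eventually (\<lambda>x::real. x \<in> {0<..}) (nhds x)"
        using assms by (intro eventually_nhds_in_open) auto
      then show "\<forall>\<^sub>F x in nhds x. x ^ (m + 1) * toeplitz_J (- 1) (m + 1) x = toeplitz_J 1 (m + 1) x"
        by eventually_elim (rule toeplitz_J_reflect, simp)
    qed simp_all
    from DERIV_unique[OF this has_field_derivative_toeplitz_J] have "VB = n * x ^ m * Bm + w * x ^ (m + 1)"
      unfolding VB by simp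
    then have "x * VB = n * (x * x ^ m * Bm) + x * (x * x ^ m * w)" by (simp add: algebra_simps)
    then show ?thesis unfolding y by simp
  qed
  define d0 d1 d2 where "d0 = toeplitz_J' 0 m x" and "d1 = toeplitz_J' 0 (m + 1) x" and "d2 = toeplitz_J' 0 (m + 2) x"
  define D0 D1 D2 where "D0 = toeplitz_J 0 m x" and "D1 = toeplitz_J 0 (m + 1) x" and "D2 = toeplitz_J 0 (m + 2) x"
  define F0 F1 F2 where "F0 = toeplitz_J 2 m x" and "F1 = toeplitz_J 2 (m + 1) x" and "F2 = toeplitz_J 2 (m + 2) x"
  have deriv: "d2 * D0 + D2 * d0 = 2 * D1 * d1 - (w * B + Bm * VB)"
  proof -
    have "((\<lambda>y. toeplitz_J 0 (m + 2) y * toeplitz_J 0 m y) has_field_derivative d2 * D0 + d0 * D2) (at x)"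
      unfolding d0_def d2_def D0_def D2_def by (intro DERIV_mult has_field_derivative_toeplitz_J)
    moreover have "((\<lambda>y. toeplitz_J 0 (m + 1) y * toeplitz_J 0 (m + 1) y - toeplitz_J (- 1) (m + 1) y * toeplitz_J 1 (m + 1) y)
        has_field_derivative (d1 * D1 + d1 * D1) - (w * B + toeplitz_J' 1 (m + 1) x * Bm)) (at x)"
      unfolding d1_def D1_def w_def Bm_def B_def by (intro DERIV_diff DERIV_mult has_field_derivative_toeplitz_J)
    ultimately have "d2 * D0 + d0 * D2 = (d1 * D1 + d1 * D1) - (w * B + toeplitz_J' 1 (m + 1) x * Bm)"
      unfolding D20 power2_eq_square by (rule DERIV_unique)
    then show ?thesis unfolding VB by (simp add: algebra_simps)
  qed
  define X where "X = x ^ m"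
  have e0: "X * (D0 - d0) = F0" and e1: "x * X * (D1 - d1) = F1"
    using IH0 IH1 unfolding D0_def d0_def F0_def D1_def d1_def F1_def X_def by simp_all
  have dd: "D2 * D0 = D1\<^sup>2 - Bm * B" using D20[of x] unfolding D2_def D0_def D1_def Bm_def B_def .
  \<comment> \<open>The factor \<open>x\<^sup>2 * X\<close> is the power of \<open>x\<close>
    required at size \<open>m + 2\<close>; it also supplies the powers that the hypotheses and the
    reflection consume.\<close>
  have "D0 * (x\<^sup>2 * X * (D2 - d2)) = x\<^sup>2 * X * (D2 * D0) - x\<^sup>2 * X * (d2 * D0 + D2 * d0) + x\<^sup>2 * X * (D2 * d0)"
    by (simp add: algebra_simps)
  also have "x\<^sup>2 * X * (D2 * d0) = x\<^sup>2 * X * (D2 * D0) - x\<^sup>2 * (D2 * F0)"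
    unfolding e0[symmetric] by (simp add: algebra_simps)
  also have "x\<^sup>2 * X * (D2 * D0) - x\<^sup>2 * X * (d2 * D0 + D2 * d0) + (x\<^sup>2 * X * (D2 * D0) - x\<^sup>2 * (D2 * F0)) =
      2 * x * D1 * (x * X * (D1 - d1)) - 2 * x * (x * X * Bm) * B + x * (x * X * w) * B + x * (x * X * Bm) * VB - x\<^sup>2 * (D2 * F0)"
    unfolding deriv dd by (simp add: algebra_simps power2_eq_square)
  also have "\<dots> = 2 * x * (D1 * F1) - 2 * x * B\<^sup>2 + (x * VB - n * B) * B + x * B * VB - x\<^sup>2 * (D2 * F0)"
    unfolding e1 y[folded X_def] w[folded X_def] by (simp add: power2_eq_square)
  also have "D1 * F1 = B\<^sup>2 - (B * C - VB * UB)"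
    using B20 B2 unfolding D1_def F1_def by simp
  also have "D2 * F0 = VB * VB - VVB * B" using D2 unfolding D2_def F0_def .
  also have "2 * x * (B\<^sup>2 - (B * C - VB * UB)) - 2 * x * B\<^sup>2 + (x * VB - n * B) * B + x * B * VB - x\<^sup>2 * (VB * VB - VVB * B) =
      UB * UB - B * UUB"
  proof -
    \<comment> \<open>The weight relations express \<open>x * VB\<close>, \<open>x * C\<close> and
      \<open>x * (x * VVB)\<close> by \<open>B\<close>, \<open>UB\<close> and \<open>UUB\<close>,
      after which both sides agree as polynomials.\<close>
    have p: "x * VB = UB + n * B" and q: "x * C = UUB + (n + 1) * UB" using w1 w2 by simp_all
    have "x * VVB = C + (n - 1) * VB" using w3 by simp
    then have "x * (x * VVB) = x * (C + (n - 1) * VB)" by (simp only:)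
    then have r: "x * (x * VVB) = x * C + (n - 1) * (x * VB)" by (simp only: distrib_left mult.left_commute)
    have "2 * x * (B\<^sup>2 - (B * C - VB * UB)) - 2 * x * B\<^sup>2 + (x * VB - n * B) * B + x * B * VB - x\<^sup>2 * (VB * VB - VVB * B) =
      - 2 * B * (x * C) + 2 * (x * VB) * UB + (x * VB - n * B) * B + B * (x * VB) - (x * VB)\<^sup>2 + x * (x * VVB) * B"
      by (simp add: algebra_simps power2_eq_square)
    also have "\<dots> = UB * UB - B * UUB"
      unfolding r unfolding p q by (simp add: algebra_simps power2_eq_square)
    finally show ?thesis .
  qed
  also have "\<dots> = F2 * D0" unfolding D0_def F2_def by (rule E2[symmetric])
  also have "\<dots> = D0 * F2" by (rule mult.commute)
  finally have "D0 * (x\<^sup>2 * X * (D2 - d2)) = D0 * F2" .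
  moreover have "D0 \<noteq> 0"
    using fdet_bessel_J_nonzero[OF assms(1), of m] by (simp add: D0_def toeplitz_def)
  ultimately show ?thesis
    unfolding D2_def d2_def F2_def X_def by (simp add: power2_eq_square mult_ac)
qed

text \<open>Divided by \<open>x ^ n\<close>, this is the formula for the derivative of
  \<open>exp (- x) * toeplitz_J 0 n x\<close>. The step relies on two preceding sizes, hence the two
  base cases.\<close>

lemma toeplitz_J_derivative:
  assumes "x > 0"
  shows "x ^ n * (toeplitz_J 0 n x - toeplitz_J' 0 n x) = toeplitz_J 2 n x"
proof (induction n rule: induct_nat_012)
  case 0
  show ?case by (simp add: toeplitz_def toeplitz_J'_def fdet'_def)
next
  case 1
  have "toeplitz_J 0 1 x = bessel_J 0 x" "toeplitz_J 2 1 x = bessel_J 2 x"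
    by (simp_all add: toeplitz_def fdet_1)
  moreover have "toeplitz_J' 0 1 x = bessel_J (-1) x"
    by (simp add: toeplitz_J'_def fdet'_def fdet_1)
  ultimately show ?case
    using bessel_J_rec[of x 1] bessel_J_rec[of x 0] by (simp add: algebra_simps)
next
  case (ge2 n)
  then show ?case using toeplitz_J_step[OF assms, of n] by (simp add: numeral_2_eq_2)
qed

section \<open>Expansions in powers of \<open>1 / N\<close>\<close>

text \<open>The pair \<open>(a, b)\<close> is multiplied like a dual number with
  \<open>1 / N\<close> as infinitesimal. This is why \<open>fdet'\<close> reappears in
  \<open>expands_fdet\<close>.\<close>

definition expands :: "(nat \<Rightarrow> real) \<Rightarrow> real \<Rightarrow> real \<Rightarrow> bool" where
  "expands f a b \<longleftrightarrow> (\<lambda>N. f N - a - b / real N) \<in> O(\<lambda>N. 1 / real N ^ 2)"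

lemma expands_bound:
  assumes "eventually (\<lambda>N. \<bar>f N - a - b / real N\<bar> \<le> C / real N ^ 2) sequentially"
  shows "expands f a b"
  unfolding expands_def
proof (rule bigoI[where c = C])
  show "\<forall>\<^sub>F N in sequentially. norm (f N - a - b / real N) \<le> C * norm (1 / real N ^ 2)"
    using assms by eventually_elim simp
qed

lemma expands_const: "expands (\<lambda>N. c) c 0"
  by (simp add: expands_def)

lemma expands_inverse: "expands (\<lambda>N. c / real N) 0 c"
  by (simp add: expands_def)

lemma expands_add:
  assumes "expands f a b" "expands g c d"
  shows "expands (\<lambda>N. f N + g N) (a + c) (b + d)"
proof -
  have "(\<lambda>N. (f N - a - b / real N) + (g N - c - d / real N)) \<in> O(\<lambda>N. 1 / real N ^ 2)"
    using assms unfolding expands_def by (rule sum_in_bigo)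
  then show ?thesis by (simp add: expands_def algebra_simps add_divide_distrib)
qed

lemma expands_bounded:
  assumes "expands f a b"
  shows "f \<in> O(\<lambda>_. 1)"
proof -
  have "(\<lambda>N. 1 / real N ^ 2) \<in> O(\<lambda>_. 1)" by real_asymp
  with assms have "(\<lambda>N. f N - a - b / real N) \<in> O(\<lambda>_. 1)"
    unfolding expands_def by (rule landau_o.big.trans)
  moreover have "(\<lambda>N. a + b / real N) \<in> O(\<lambda>_. 1)" by real_asymp
  ultimately have "(\<lambda>N. (f N - a - b / real N) + (a + b / real N)) \<in> O(\<lambda>_. 1)"
    by (rule sum_in_bigo)
  then show ?thesis by simp
qed

lemma expands_mult:
  assumes "expands f a b" "expands g c d"
  shows "expands (\<lambda>N. f N * g N) (a * c) (a * d + b * c)"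
proof -
  have 1: "(\<lambda>N. (f N - a - b / real N) * g N) \<in> O(\<lambda>N. 1 / real N ^ 2)"
    using landau_o.big.mult[OF assms(1)[unfolded expands_def] expands_bounded[OF assms(2)]] by simp
  have "(\<lambda>N. a + b / real N) \<in> O(\<lambda>_. 1)" by real_asymp
  from landau_o.big.mult[OF this assms(2)[unfolded expands_def]]
  have 2: "(\<lambda>N. (a + b / real N) * (g N - c - d / real N)) \<in> O(\<lambda>N. 1 / real N ^ 2)" by simp
  have 3: "(\<lambda>N. b * d * (1 / real N ^ 2)) \<in> O(\<lambda>N. 1 / real N ^ 2)"
    by (rule bigoI[where c = "\<bar>b * d\<bar>"]) (simp add: abs_mult)
  have "(\<lambda>N. (f N - a - b / real N) * g N + (a + b / real N) * (g N - c - d / real N) + b * d * (1 / real N ^ 2))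
      = (\<lambda>N. f N * g N - a * c - (a * d + b * c) / real N)"
    by (simp add: fun_eq_iff algebra_simps add_divide_distrib power2_eq_square)
  with sum_in_bigo(1)[OF sum_in_bigo(1)[OF 1 2] 3] show ?thesis
    by (simp add: expands_def)
qed

lemma expands_sum:
  assumes "\<And>p. p \<in> S \<Longrightarrow> expands (\<lambda>N. f N p) (a p) (b p)"
  shows "expands (\<lambda>N. \<Sum>p\<in>S. f N p) (\<Sum>p\<in>S. a p) (\<Sum>p\<in>S. b p)"
  using assms
proof (induction S rule: infinite_finite_induct)
  case (insert p S)
  then show ?case using expands_add[of "\<lambda>N. f N p" "a p" "b p"] by simp
qed (simp_all add: expands_const)

lemma expands_prod:
  assumes "finite S" "\<And>i. i \<in> S \<Longrightarrow> expands (\<lambda>N. f N i) (a i) (b i)"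
  shows "expands (\<lambda>N. \<Prod>i\<in>S. f N i) (\<Prod>i\<in>S. a i) (\<Sum>r\<in>S. b r * (\<Prod>i\<in>S - {r}. a i))"
  using assms
proof (induction S rule: finite_induct)
  case (insert p S)
  have "(\<Sum>r\<in>S. b r * (\<Prod>i\<in>insert p S - {r}. a i)) = (\<Sum>r\<in>S. a p * (b r * (\<Prod>i\<in>S - {r}. a i)))"
  proof (intro sum.cong refl)
    fix r assume "r \<in> S"
    then have "insert p S - {r} = insert p (S - {r})" using insert by auto
    then show "b r * (\<Prod>i\<in>insert p S - {r}. a i) = a p * (b r * (\<Prod>i\<in>S - {r}. a i))"
      using insert by simp
  qed
  moreover have "insert p S - {p} = S" using insert by auto
  ultimately have "(\<Sum>r\<in>insert p S. b r * (\<Prod>i\<in>insert p S - {r}. a i)) =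
      a p * (\<Sum>r\<in>S. b r * (\<Prod>i\<in>S - {r}. a i)) + b p * (\<Prod>i\<in>S. a i)"
    using insert by (simp add: sum_distrib_left)
  moreover have "expands (\<lambda>N. f N p * (\<Prod>i\<in>S. f N i)) (a p * (\<Prod>i\<in>S. a i))
      (a p * (\<Sum>r\<in>S. b r * (\<Prod>i\<in>S - {r}. a i)) + b p * (\<Prod>i\<in>S. a i))"
    by (rule expands_mult) (use insert in auto)
  ultimately show ?case
    using insert by (simp add: add.commute)
qed (simp add: expands_const)

lemma expands_fdet:
  assumes "\<And>i j. i < n \<Longrightarrow> j < n \<Longrightarrow> expands (\<lambda>N. f N i j) (A i j) (B i j)"
  shows "expands (\<lambda>N. fdet n (f N)) (fdet n A) (fdet' n A B)"
  unfolding fdet_perm fdet'_perm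
proof (rule expands_sum)
  fix p assume "p \<in> {p. p permutes {..<n}}"
  then have p: "p permutes {..<n}" by blast
  have "expands (\<lambda>N. \<Prod>i<n. f N i (p i)) (\<Prod>i<n. A i (p i)) (\<Sum>r<n. B r (p r) * (\<Prod>i\<in>{..<n}-{r}. A i (p i)))"
  proof (rule expands_prod)
    fix i assume "i \<in> {..<n}"
    moreover from this have "p i < n" using permutes_in_image[OF p, of i] by simp
    ultimately show "expands (\<lambda>N. f N i (p i)) (A i (p i)) (B i (p i))" using assms by simp
  qed simp
  from expands_mult[OF expands_const this, of "of_int (sign p)"]
  show "expands (\<lambda>N. of_int (sign p) * (\<Prod>i<n. f N i (p i))) (of_int (sign p) * (\<Prod>i<n. A i (p i)))
      (of_int (sign p) * (\<Sum>r<n. B r (p r) * (\<Prod>i\<in>{..<n}-{r}. A i (p i))))" by simp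
qed

section \<open>Expansion of the prefactor and of the matrix entries\<close>

lemma expands_exp:
  assumes "x > 0"
  shows "expands (\<lambda>N. (1 - x / real N ^ 2) powr (real N * (c + real N))) (exp (- x)) (- (x * c) * exp (- x))"
  unfolding expands_def by real_asymp

text \<open>This is \<open>fact k * (N choose k) * pochhammer (N + \<beta>) k / N ^ (2 k)\<close>, a
  coefficient of a terminating hypergeometric series in the scaling \<open>1 / N\<^sup>2\<close>.
  The factor \<open>l = N\<close> makes it vanish for \<open>k > N\<close>; for fixed
  \<open>k\<close> it tends to \<open>1\<close>.\<close>

definition scaled_coeff :: "real \<Rightarrow> nat \<Rightarrow> nat \<Rightarrow> real" where
  "scaled_coeff \<beta> k N = (\<Prod>l<k. (1 - real l / real N) * (1 + (\<beta> + real l) / real N))"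

text \<open>At order \<open>1 / N\<close> the terms in \<open>l\<close> cancel, so every factor has
  the same correction \<open>\<beta> / N\<close> and the product of \<open>k\<close> factors has
  \<open>k \<beta> / N\<close>.\<close>

lemma scaled_coeff_factor:
  assumes "N \<ge> 1"
  shows "(1 - real l / real N) * (1 + (\<beta> + real l) / real N) =
     1 + \<beta> / real N - real l * (\<beta> + real l) / real N ^ 2"
  using assms by (simp add: field_simps power2_eq_square)

text \<open>For \<open>k \<le> N\<close> every factor lies between \<open>0\<close> and
  \<open>1 + \<beta>\<close>; for \<open>k > N\<close> one of them is zero.\<close>

lemma scaled_coeff_bounds:
  assumes "\<beta> \<ge> 0" "N \<ge> 1"
  shows "0 \<le> scaled_coeff \<beta> k N" "scaled_coeff \<beta> k N \<le> (1 + \<beta>) ^ k"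
proof -
  have "0 \<le> scaled_coeff \<beta> k N \<and> scaled_coeff \<beta> k N \<le> (1 + \<beta>) ^ k"
  proof (cases "k \<le> N")
    case True
    have *: "0 \<le> (1 - real l / real N) * (1 + (\<beta> + real l) / real N) \<and>
        (1 - real l / real N) * (1 + (\<beta> + real l) / real N) \<le> 1 + \<beta>" if "l < k" for l
    proof
      show "0 \<le> (1 - real l / real N) * (1 + (\<beta> + real l) / real N)"
        using that True assms by (intro mult_nonneg_nonneg) auto
      have "\<beta> / real N \<le> \<beta>" using assms by (simp add: field_simps mult_le_cancel_left1)
      moreover have "0 \<le> real l * (\<beta> + real l) / real N ^ 2" using assms by simp
      ultimately show "(1 - real l / real N) * (1 + (\<beta> + real l) / real N) \<le> 1 + \<beta>"
        unfolding scaled_coeff_factor[OF assms(2)] by linarith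
    qed
    have "scaled_coeff \<beta> k N \<le> (\<Prod>l<k. 1 + \<beta>)"
      unfolding scaled_coeff_def using * by (intro prod_mono) auto
    moreover have "0 \<le> scaled_coeff \<beta> k N"
      unfolding scaled_coeff_def using * by (intro prod_nonneg) auto
    ultimately show ?thesis by simp
  next
    case False
    then have "scaled_coeff \<beta> k N = 0"
      unfolding scaled_coeff_def using assms by (intro prod_zero) (auto intro!: bexI[of _ N])
    then show ?thesis using assms by simp
  qed
  then show "0 \<le> scaled_coeff \<beta> k N" "scaled_coeff \<beta> k N \<le> (1 + \<beta>) ^ k" by auto
qed

text \<open>The bound will be summed against the terms of a Bessel series, so growth like a power
  with exponent \<open>k\<close> is affordable. The induction propagates the error
  \<open>e\<close>.\<close>

lemma scaled_coeff_expansion: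
  assumes "\<beta> \<ge> 0" "N \<ge> 1"
  shows "\<bar>scaled_coeff \<beta> k N - 1 - real k * (\<beta> / real N)\<bar> \<le> (4 * (1 + \<beta>)\<^sup>2) ^ k / real N ^ 2"
proof (induction k)
  case 0
  show ?case by (simp add: scaled_coeff_def)
next
  case (Suc k)
  \<comment> \<open>In \<open>R ^ k\<close> the part \<open>4 ^ k\<close> absorbs the polynomial
    growth in \<open>k\<close> by \<open>k < 2 ^ k\<close>, and a power of
    \<open>1 + \<beta>\<close> absorbs the bound on \<open>scaled_coeff\<close>. One further factor
    \<open>R\<close> dominates \<open>\<beta>\<^sup>2 + 2 \<beta> + 2\<close>, the growth in one
    step.\<close>
  define R where "R = 4 * (1 + \<beta>)\<^sup>2"
  define e where "e k = scaled_coeff \<beta> k N - 1 - real k * (\<beta> / real N)" for k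
  define M where "M = real N"
  have M: "M \<ge> 1" using assms by (simp add: M_def)
  then have M0: "M \<noteq> 0" by simp
  let ?A = "scaled_coeff \<beta> k N"
  have rec: "scaled_coeff \<beta> (Suc k) N = ?A * (1 + \<beta> / M - real k * (\<beta> + real k) / M\<^sup>2)"
    unfolding scaled_coeff_def M_def using scaled_coeff_factor[OF assms(2), of k \<beta>] by simp
  have eSuc: "e (Suc k) = e k * (1 + \<beta> / M) + real k * \<beta>\<^sup>2 / M\<^sup>2 - ?A * (real k * (\<beta> + real k)) / M\<^sup>2"
    unfolding e_def rec M_def[symmetric] using M0 by (simp add: field_simps power2_eq_square)
  have "\<bar>a + b - c\<bar> \<le> \<bar>a\<bar> + \<bar>b\<bar> + \<bar>c\<bar>" for a b c :: real by linarith
  from this[of "e k * (1 + \<beta> / M)" "real k * \<beta>\<^sup>2 / M\<^sup>2" "?A * (real k * (\<beta> + real k)) / M\<^sup>2", folded eSuc]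
  have "\<bar>e (Suc k)\<bar> \<le> \<bar>e k * (1 + \<beta> / M)\<bar> + \<bar>real k * \<beta>\<^sup>2 / M\<^sup>2\<bar> + \<bar>?A * (real k * (\<beta> + real k)) / M\<^sup>2\<bar>" .
  also have "\<dots> = \<bar>e k\<bar> * (1 + \<beta> / M) + real k * \<beta>\<^sup>2 / M\<^sup>2 + ?A * (real k * (\<beta> + real k)) / M\<^sup>2"
    using assms M scaled_coeff_bounds(1)[OF assms, of k] by (simp add: abs_mult)
  also have "\<dots> \<le> R ^ k / M\<^sup>2 * (1 + \<beta>) + real k * \<beta>\<^sup>2 / M\<^sup>2 + (1 + \<beta>) ^ k * (real k * (\<beta> + real k)) / M\<^sup>2"
  proof (intro add_mono mult_mono divide_right_mono mult_right_mono order_refl)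
    show "\<bar>e k\<bar> \<le> R ^ k / M\<^sup>2" using Suc by (simp add: e_def R_def M_def)
    show "\<beta> / M \<le> \<beta>" using M mult_right_mono[OF M assms(1)] by (simp add: field_simps)
    show "?A \<le> (1 + \<beta>) ^ k" by (rule scaled_coeff_bounds(2)[OF assms])
  qed (use assms M in \<open>auto simp: R_def\<close>)
  also have "\<dots> = (R ^ k * (1 + \<beta>) + real k * \<beta>\<^sup>2 + (1 + \<beta>) ^ k * (real k * (\<beta> + real k))) / M\<^sup>2"
    by (simp add: add_divide_distrib)
  also have "\<dots> \<le> R ^ Suc k / M\<^sup>2"
  proof (rule divide_right_mono)
    have k1: "real k \<le> 4 ^ k" and k2: "real k * real k \<le> 4 ^ k"
    proof -
      have "k < 2 ^ k" by (rule less_exp)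
      then have k: "real k \<le> 2 ^ k"
        using of_nat_mono[of k "2 ^ k", where 'a = real] by simp
      then show "real k \<le> 4 ^ k"
        by (rule order_trans) (simp add: power_mono)
      have "real k * real k \<le> 2 ^ k * 2 ^ k" using k by (intro mult_mono) auto
      then show "real k * real k \<le> 4 ^ k" by (simp flip: power_mult_distrib)
    qed
    define P where "P = (1 + \<beta>) ^ k"
    have P: "P \<ge> 1" unfolding P_def using assms by simp
    have PR: "4 ^ k * P \<le> R ^ k"
    proof -
      have "4 ^ k * P = (4 * (1 + \<beta>)) ^ k" by (simp only: P_def power_mult_distrib)
      also have "\<dots> \<le> R ^ k"
      proof (rule power_mono)
        have "1 * (1 + \<beta>) \<le> (1 + \<beta>) * (1 + \<beta>)" using assms by (intro mult_right_mono) auto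
        then show "4 * (1 + \<beta>) \<le> R" unfolding R_def power2_eq_square by linarith
      qed (use assms in simp)
      finally show ?thesis .
    qed
    have "real k * \<beta>\<^sup>2 \<le> (4 ^ k * P) * \<beta>\<^sup>2"
      using k1 P by (intro mult_right_mono order_trans[OF k1]) auto
    moreover have "P * (real k * (\<beta> + real k)) \<le> (4 ^ k * P) * (\<beta> + 1)"
    proof -
      have "real k * (\<beta> + real k) \<le> 4 ^ k * \<beta> + 4 ^ k"
        using k1 k2 assms mult_right_mono[OF k1, of \<beta>] by (simp add: distrib_left)
      then have "P * (real k * (\<beta> + real k)) \<le> P * (4 ^ k * \<beta> + 4 ^ k)"
        using P by (intro mult_left_mono) auto
      then show ?thesis by (simp add: algebra_simps)
    qed
    ultimately have "real k * \<beta>\<^sup>2 + P * (real k * (\<beta> + real k)) \<le> (4 ^ k * P) * (\<beta>\<^sup>2 + \<beta> + 1)"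
      by (simp add: algebra_simps)
    also have "\<dots> \<le> R ^ k * (\<beta>\<^sup>2 + \<beta> + 1)"
      using PR assms by (intro mult_right_mono) auto
    finally have "R ^ k * (1 + \<beta>) + real k * \<beta>\<^sup>2 + P * (real k * (\<beta> + real k)) \<le> R ^ k * (\<beta>\<^sup>2 + 2 * \<beta> + 2)"
      by (simp add: algebra_simps)
    also have "\<dots> \<le> R ^ k * R"
      unfolding R_def using assms by (intro mult_left_mono) (auto simp: power2_eq_square algebra_simps)
    finally show "R ^ k * (1 + \<beta>) + real k * \<beta>\<^sup>2 + (1 + \<beta>) ^ k * (real k * (\<beta> + real k)) \<le> R ^ Suc k"
      by (simp add: P_def mult.commute)
  qed simp
  finally show ?case by (simp add: e_def R_def M_def)
qed

text \<open>One formula for the series of \<open>bessel_J (i - j)\<close> for either sign of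
  \<open>i - j\<close>. The default value \<open>0\<close> is that of the reciprocal factorial of a
  negative integer.\<close>

definition bessel_J_term :: "nat \<Rightarrow> nat \<Rightarrow> nat \<Rightarrow> real \<Rightarrow> real" where
  "bessel_J_term i j k x = (if k + i < j then 0 else x ^ (k + i - j) / (fact k * fact (k + i - j)))"

lemma bessel_J_term_sums: "(\<lambda>k. bessel_J_term i j k x) sums bessel_J (int i - int j) x"
proof (cases "j \<le> i")
  case True
  then obtain d where i: "i = j + d" using le_Suc_ex by blast
  have "(\<lambda>k. x ^ d * (x ^ k / (fact k * fact (k + d)))) sums (x ^ d * bessel_clifford d x)"
    by (intro sums_mult bessel_clifford_sums)
  moreover have "(\<lambda>k. bessel_J_term i j k x) = (\<lambda>k. x ^ d * (x ^ k / (fact k * fact (k + d))))"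
    by (auto simp: fun_eq_iff bessel_J_term_def i power_add)
  moreover have "bessel_J (int i - int j) x = x ^ d * bessel_clifford d x"
    using bessel_J_nonneg[of d x] by (simp add: i)
  ultimately show ?thesis by simp
next
  case False
  then obtain d where j: "j = i + d" using le_Suc_ex nat_le_linear by blast
  have "(\<lambda>k. bessel_J_term i j (k + d) x) = (\<lambda>k. x ^ k / (fact k * fact (k + d)))"
    by (auto simp: fun_eq_iff bessel_J_term_def j)
  then have "(\<lambda>k. bessel_J_term i j (k + d) x) sums bessel_clifford d x"
    using bessel_clifford_sums by simp
  then have "(\<lambda>k. bessel_J_term i j k x) sums bessel_clifford d x"
    by (subst (asm) sums_zero_iff_shift) (auto simp: bessel_J_term_def j)
  moreover have "bessel_J (int i - int j) x = bessel_clifford d x"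
    using bessel_J_nonpos[of d x] by (simp add: j)
  ultimately show ?thesis by simp
qed

text \<open>Cancelling \<open>k\<close> against \<open>fact k\<close> and shifting the summation
  index raises \<open>i\<close> by one. The raised order in the correction term originates
  here.\<close>

lemma bessel_J_term_weighted_sums: "(\<lambda>k. real k * bessel_J_term i j k x) sums bessel_J (int i - int j + 1) x"
proof -
  have "real (Suc k) * bessel_J_term i j (Suc k) x = bessel_J_term (Suc i) j k x" for k
    by (simp add: bessel_J_term_def del: of_nat_Suc)
  then have "(\<lambda>k. real (Suc k) * bessel_J_term i j (Suc k) x) sums bessel_J (int (Suc i) - int j) x"
    using bessel_J_term_sums by (simp del: of_nat_Suc)
  then have "(\<lambda>k. real k * bessel_J_term i j k x) sums bessel_J (int (Suc i) - int j) x"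
    by (subst (asm) sums_Suc_iff) simp
  moreover have "int (Suc i) - int j = int i - int j + 1" by simp
  ultimately show ?thesis by (simp only:)
qed

text \<open>A geometric factor \<open>R ^ k\<close> amounts to a change of argument, so the
  accumulated error is again a convergent Bessel series.\<close>

lemma bessel_J_term_scale: "R ^ i * (R ^ k * bessel_J_term i j k x) = R ^ j * bessel_J_term i j k (R * x)"
proof (cases "k + i < j")
  case False
  then obtain d where "k + i = j + d" using le_Suc_ex not_less by blast
  moreover from this have "R ^ i * R ^ k = R ^ j * R ^ d" by (simp flip: power_add add: add.commute)
  ultimately show ?thesis by (simp add: bessel_J_term_def power_mult_distrib flip: mult.assoc)
qed (simp add: bessel_J_term_def)

lemma bessel_J_term_mono: "0 \<le> x \<Longrightarrow> x \<le> y \<Longrightarrow> bessel_J_term i j k x \<le> bessel_J_term i j k y"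
  by (auto simp: bessel_J_term_def intro!: divide_right_mono power_mono)

lemma bessel_J_term_nonneg: "0 \<le> x \<Longrightarrow> 0 \<le> bessel_J_term i j k x"
  by (auto simp: bessel_J_term_def)

text \<open>The entry at finite \<open>N\<close>, up to row and column factors: the series of
  \<open>bessel_J\<close> with its terms weighted by \<open>scaled_coeff\<close>, which terminates
  at \<open>N\<close>.\<close>

definition jacobi_series :: "real \<Rightarrow> nat \<Rightarrow> nat \<Rightarrow> nat \<Rightarrow> real \<Rightarrow> real" where
  "jacobi_series \<beta> N i j x = (\<Sum>k\<le>N. scaled_coeff \<beta> k N * bessel_J_term i j k x)"

lemma jacobi_series_sums:
  assumes "N \<ge> 1"
  shows "(\<lambda>k. scaled_coeff \<beta> k N * bessel_J_term i j k x) sums jacobi_series \<beta> N i j x"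
  unfolding jacobi_series_def
proof (rule sums_finite)
  fix k assume "k \<notin> {..N}"
  then have "scaled_coeff \<beta> k N = 0"
    unfolding scaled_coeff_def using assms by (intro prod_zero) (auto intro!: bexI[of _ N])
  then show "scaled_coeff \<beta> k N * bessel_J_term i j k x = 0" by simp
qed simp

text \<open>A termwise estimate. The point \<open>y\<close> makes the bound independent of
  \<open>x\<close>, which will vary with \<open>N\<close>.\<close>

lemma jacobi_series_expansion:
  assumes "\<beta> \<ge> 0" "N \<ge> 1" "0 \<le> x" "x \<le> y"
  defines "R \<equiv> 4 * (1 + \<beta>)\<^sup>2"
  shows "\<bar>jacobi_series \<beta> N i j x - bessel_J (int i - int j) x - \<beta> / real N * bessel_J (int i - int j + 1) x\<bar> \<le>
     R ^ j / R ^ i * bessel_J (int i - int j) (R * y) / real N ^ 2"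
proof -
  have R: "R > 0" using assms by (simp add: R_def)
  have scale: "R ^ k * bessel_J_term i j k x = R ^ j / R ^ i * bessel_J_term i j k (R * x)" for k x
    using bessel_J_term_scale[of R i k j x] R by (simp add: field_simps)
  have 1: "(\<lambda>k. scaled_coeff \<beta> k N * bessel_J_term i j k x - bessel_J_term i j k x - \<beta> / real N * (real k * bessel_J_term i j k x)) sums
     (jacobi_series \<beta> N i j x - bessel_J (int i - int j) x - \<beta> / real N * bessel_J (int i - int j + 1) x)"
    by (intro sums_diff sums_mult jacobi_series_sums bessel_J_term_sums bessel_J_term_weighted_sums assms)
  have 2: "(\<lambda>k. (R ^ j / R ^ i / real N ^ 2) * bessel_J_term i j k (R * y)) sums
     ((R ^ j / R ^ i / real N ^ 2) * bessel_J (int i - int j) (R * y))"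
    by (intro sums_mult bessel_J_term_sums)
  have le: "norm (scaled_coeff \<beta> k N * bessel_J_term i j k x - bessel_J_term i j k x - \<beta> / real N * (real k * bessel_J_term i j k x)) \<le>
      (R ^ j / R ^ i / real N ^ 2) * bessel_J_term i j k (R * y)" for k
  proof -
    have "scaled_coeff \<beta> k N * bessel_J_term i j k x - bessel_J_term i j k x - \<beta> / real N * (real k * bessel_J_term i j k x) =
       (scaled_coeff \<beta> k N - 1 - real k * (\<beta> / real N)) * bessel_J_term i j k x"
      by (simp add: algebra_simps)
    then have "norm (scaled_coeff \<beta> k N * bessel_J_term i j k x - bessel_J_term i j k x - \<beta> / real N * (real k * bessel_J_term i j k x)) =
       \<bar>scaled_coeff \<beta> k N - 1 - real k * (\<beta> / real N)\<bar> * bessel_J_term i j k x"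
      using bessel_J_term_nonneg[OF assms(3)] by (simp add: abs_mult)
    also have "\<dots> \<le> R ^ k / real N ^ 2 * bessel_J_term i j k y"
      unfolding R_def using assms bessel_J_term_nonneg[OF assms(3)]
      by (intro mult_mono scaled_coeff_expansion bessel_J_term_mono) auto
    also have "\<dots> = (R ^ j / R ^ i / real N ^ 2) * bessel_J_term i j k (R * y)"
      using scale[of k y] by (simp add: field_simps)
    finally show ?thesis .
  qed
  have "\<bar>jacobi_series \<beta> N i j x - bessel_J (int i - int j) x - \<beta> / real N * bessel_J (int i - int j + 1) x\<bar> \<le>
     (R ^ j / R ^ i / real N ^ 2) * bessel_J (int i - int j) (R * y)"
    using 1 2 norm_suminf_le[OF le, of "\<lambda>k. k"] by (simp add: sums_iff norm_suminf_le[OF le])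
  then show ?thesis by (simp add: field_simps)
qed

text \<open>The argument is \<open>N\<^sup>2 \<xi> / (1 - \<xi>)\<close> at
  \<open>\<xi> = x / N\<^sup>2\<close> and differs from \<open>x\<close> by
  \<open>O(1 / N\<^sup>2)\<close>; Caratheodory's form of differentiability transfers this to
  \<open>bessel_J\<close>.\<close>

lemma bessel_J_perturb:
  "(\<lambda>N. bessel_J m (x / (1 - x / real N ^ 2)) - bessel_J m x) \<in> O(\<lambda>N. 1 / real N ^ 2)"
proof -
  define X where "X N = x / (1 - x / real N ^ 2)" for N
  have lim: "X \<longlonglongrightarrow> x" unfolding X_def by real_asymp
  have X: "(\<lambda>N. X N - x) \<in> O(\<lambda>N. 1 / real N ^ 2)" unfolding X_def by real_asymp
  obtain g where g: "\<And>z. bessel_J m z - bessel_J m x = g z * (z - x)" "isCont g x"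
    using has_field_derivative_bessel_J[of m x] unfolding CARAT_DERIV by blast
  have "(\<lambda>N. g (X N)) \<longlonglongrightarrow> g x" using g(2) lim by (rule isCont_tendsto_compose)
  then have "(\<lambda>N. g (X N)) \<in> O(\<lambda>_. 1)" by (intro bigoI_tendsto[where c = "g x"]) simp_all
  from landau_o.big.mult[OF this X] show ?thesis
    by (simp add: g(1) X_def)
qed

lemma expands_jacobi_series:
  assumes "\<beta> \<ge> 0" "x > 0"
  shows "expands (\<lambda>N. jacobi_series \<beta> N i j (x / (1 - x / real N ^ 2)))
     (bessel_J (int i - int j) x) (\<beta> * bessel_J (int i - int j + 1) x)"
proof -
  define X where "X N = x / (1 - x / real N ^ 2)" for N
  have J: "expands (\<lambda>N. bessel_J m (X N)) (bessel_J m x) 0" for m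
    using bessel_J_perturb by (simp add: expands_def X_def)
  have "expands (\<lambda>N. bessel_J (int i - int j) (X N) + \<beta> / real N * bessel_J (int i - int j + 1) (X N))
     (bessel_J (int i - int j) x + 0 * bessel_J (int i - int j + 1) x)
     (0 + (0 * 0 + \<beta> * bessel_J (int i - int j + 1) x))"
    by (intro expands_add expands_mult expands_inverse J)
  moreover have "expands (\<lambda>N. jacobi_series \<beta> N i j (X N) -
      (bessel_J (int i - int j) (X N) + \<beta> / real N * bessel_J (int i - int j + 1) (X N))) 0 0"
  proof (rule expands_bound)
    define R where "R = 4 * (1 + \<beta>)\<^sup>2"
    have "eventually (\<lambda>N. 0 \<le> X N \<and> X N \<le> 2 * x) sequentially"
      unfolding X_def using assms(2) by (intro eventually_conj; real_asymp)
    then show "\<forall>\<^sub>F N in sequentially. \<bar>jacobi_series \<beta> N i j (X N) -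
        (bessel_J (int i - int j) (X N) + \<beta> / real N * bessel_J (int i - int j + 1) (X N)) - 0 - 0 / real N\<bar>
       \<le> R ^ j / R ^ i * bessel_J (int i - int j) (R * (2 * x)) / real N ^ 2"
      using eventually_ge_at_top[of 1]
    proof eventually_elim
      case (elim N)
      then show ?case
        using jacobi_series_expansion[OF assms(1), of N "X N" "2 * x" i j] by (simp add: R_def algebra_simps)
    qed
  qed
  ultimately have "expands (\<lambda>N. (bessel_J (int i - int j) (X N) + \<beta> / real N * bessel_J (int i - int j + 1) (X N)) +
     (jacobi_series \<beta> N i j (X N) - (bessel_J (int i - int j) (X N) + \<beta> / real N * bessel_J (int i - int j + 1) (X N))))
     (bessel_J (int i - int j) x + 0 * bessel_J (int i - int j + 1) x + 0)
     (0 + (0 * 0 + \<beta> * bessel_J (int i - int j + 1) x) + 0)"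
    by (rule expands_add)
  then show ?thesis by (simp add: X_def)
qed

text \<open>For large \<open>N\<close> the expanded quantity will turn out to be the probability
  that the smallest eigenvalue exceeds \<open>x / N\<^sup>2\<close>.\<close>

lemma survival_expands:
  assumes "x > 0" "\<alpha> > -1"
  shows "expands (\<lambda>N. (1 - x / real N ^ 2) powr (real N * (real n + \<alpha> + real N)) *
            fdet n (\<lambda>i j. jacobi_series (real i + \<alpha> + 1) N i j (x / (1 - x / real N ^ 2))))
          (exp (- x) * toeplitz_J 0 n x)
          (- (x * (real n + \<alpha>) * exp (- x) * (inverse (x ^ n) * toeplitz_J 2 n x)))"
proof -
  let ?A = "\<lambda>i j. bessel_J (int i - int j) x"
  let ?U = "\<lambda>i j. bessel_J (int i - int j + 1) x"
  let ?B = "\<lambda>i j. (real i + \<alpha> + 1) * ?U i j"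
  have entries: "expands (\<lambda>N. fdet n (\<lambda>i j. jacobi_series (real i + \<alpha> + 1) N i j (x / (1 - x / real N ^ 2))))
     (fdet n ?A) (fdet' n ?A ?B)"
    by (intro expands_fdet expands_jacobi_series) (use assms in auto)
  have B: "fdet' n ?A ?B = (real n + \<alpha>) * (x * toeplitz_J' 0 n x)"
  proof -
    \<comment> \<open>Row and column indices have equal sums, so the weight relation leaves no
      remainder: raising equals \<open>x\<close> times the derivative.\<close>
    have "x * toeplitz_J' 0 n x - fdet' n ?A ?U = of_int ((\<Sum>i<n. int i) - (\<Sum>j<n. int j)) * fdet n ?A"
      unfolding toeplitz_J'_def add_0_left by (rule fdet'_bessel_J_weights) auto
    then have U: "fdet' n ?A ?U = x * toeplitz_J' 0 n x" by simp
    have "fdet' n ?A ?B = (real n + \<alpha>) * fdet' n ?A ?U"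
    proof (cases n)
      case 0
      then show ?thesis by (simp add: fdet'_def)
    next
      case (Suc m)
      have 1: "fdet n (\<lambda>i j. if i = r then c * ?U i j else ?A i j) =
          c * fdet n (\<lambda>i j. if i = r then ?U i j else ?A i j)" if "r < n" for c r
      proof -
        have "fdet n (\<lambda>i j. if i = r then c * ?U i j else ?A i j) =
            fdet n (\<lambda>i j. (if i = r then c else 1) * 1 * (if i = r then ?U i j else ?A i j))"
          by (rule fdet_cong) simp
        also have "\<dots> = (\<Prod>i<n. if i = r then c else 1) * (\<Prod>j<n. 1) *
            fdet n (\<lambda>i j. if i = r then ?U i j else ?A i j)"
          by (rule fdet_scale)
        also have "(\<Prod>i<n. if i = r then c else 1) = c" using that by simp
        finally show ?thesis by simp
      qed
      \<comment> \<open>A raised row \<open>r < m\<close> coincides with row \<open>r + 1\<close>.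
        Only \<open>r = m\<close> remains, with weight
        \<open>m + \<alpha> + 1 = n + \<alpha>\<close>.\<close>
      have 2: "fdet n (\<lambda>i j. if i = r then ?U i j else ?A i j) = 0" if "r < m" for r
        by (rule fdet_identical_rows[of r _ "Suc r"]) (use that Suc in \<open>auto simp: algebra_simps\<close>)
      have "fdet' n ?A ?B = (\<Sum>r<n. (real r + \<alpha> + 1) * fdet n (\<lambda>i j. if i = r then ?U i j else ?A i j))"
        unfolding fdet'_def
      proof (intro sum.cong refl)
        fix r assume "r \<in> {..<n}"
        then have "r < n" by simp
        have "fdet n (\<lambda>i j. if i = r then ?B i j else ?A i j) =
            fdet n (\<lambda>i j. if i = r then (real r + \<alpha> + 1) * ?U i j else ?A i j)"
          by (rule fdet_cong) simp
        also note 1[OF \<open>r < n\<close>]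
        finally show "fdet n (\<lambda>i j. if i = r then ?B i j else ?A i j) =
            (real r + \<alpha> + 1) * fdet n (\<lambda>i j. if i = r then ?U i j else ?A i j)" .
      qed
      also have "\<dots> = (\<Sum>r<n. (real n + \<alpha>) * fdet n (\<lambda>i j. if i = r then ?U i j else ?A i j))"
        unfolding Suc by (intro sum.cong refl) (use 2 Suc in \<open>auto simp: less_Suc_eq algebra_simps\<close>)
      finally show ?thesis by (simp add: fdet'_def sum_distrib_left)
    qed
    then show ?thesis by (simp only: U)
  qed
  have E: "toeplitz_J 0 n x - toeplitz_J' 0 n x = inverse (x ^ n) * toeplitz_J 2 n x"
    using toeplitz_J_derivative[OF assms(1), of n] assms(1) by (simp add: field_simps)
  have A: "fdet n ?A = toeplitz_J 0 n x" by (simp add: toeplitz_def)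
  have "expands (\<lambda>N. (1 - x / real N ^ 2) powr (real N * (real n + \<alpha> + real N)) *
            fdet n (\<lambda>i j. jacobi_series (real i + \<alpha> + 1) N i j (x / (1 - x / real N ^ 2))))
     (exp (- x) * toeplitz_J 0 n x)
     (exp (- x) * ((real n + \<alpha>) * (x * toeplitz_J' 0 n x)) + - (x * (real n + \<alpha>)) * exp (- x) * toeplitz_J 0 n x)"
    using expands_mult[OF expands_exp[OF assms(1)] entries] unfolding B A .
  moreover have "exp (- x) * ((real n + \<alpha>) * (x * toeplitz_J' 0 n x)) + - (x * (real n + \<alpha>)) * exp (- x) * toeplitz_J 0 n x =
      - (x * (real n + \<alpha>) * exp (- x) * (toeplitz_J 0 n x - toeplitz_J' 0 n x))"
    by (simp add: algebra_simps)
  ultimately show ?thesis unfolding E by simp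
qed

section \<open>Return to the Bessel functions\<close>

lemma bessel_I_eq:
  assumes "x > 0"
  shows "bessel_I (of_int m) (2 * sqrt x) = sqrt x powr (- of_int m) * bessel_J m x"
proof -
  \<comment> \<open>Writing \<open>m\<close> as \<open>i - j\<close> gives access to
    \<open>bessel_J_term\<close> for either sign of \<open>m\<close>.\<close>
  define i j where "i = nat m" and "j = nat (- m)"
  have m: "m = int i - int j" by (simp add: i_def j_def)
  have "(2 * sqrt x / 2) powr (of_int m + 2 * real k) / fact k * rGamma (of_int m + real k + 1) =
      sqrt x powr (- of_int m) * bessel_J_term i j k x" for k
  proof (cases "k + i < j")
    case True
    \<comment> \<open>The reciprocal Gamma function is taken at a nonpositive integer, which matches
      the default value of \<open>bessel_J_term\<close>.\<close>
    then have "of_int m + real k + 1 = of_int (m + int k + 1)" "m + int k + 1 \<le> 0" by (auto simp: m)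
    then have "of_int m + real k + 1 \<in> \<int>\<^sub>\<le>\<^sub>0" by (metis of_int_in_nonpos_Ints_iff)
    then show ?thesis using True by (simp add: bessel_J_term_def rGamma_eq_zero_iff)
  next
    case False
    then obtain r where r: "k + i = j + r" using le_Suc_ex not_less by blast
    then have mk: "of_int m + real k = real r" by (simp add: m)
    have "rGamma (of_int m + real k + 1) = 1 / fact r"
      unfolding mk using Gamma_fact[of r, where 'a = real] by (simp add: rGamma_inverse_Gamma field_simps add.commute)
    moreover have "sqrt x powr (of_int m + 2 * real k) = sqrt x powr (- of_int m) * x ^ r"
    proof -
      have "of_int m + 2 * real k = - of_int m + 2 * real r" using mk by simp
      then have "sqrt x powr (of_int m + 2 * real k) = sqrt x powr (- of_int m) * sqrt x powr (2 * real r)"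
        by (simp only: powr_add)
      also have "sqrt x powr (2 * real r) = x ^ r"
        using assms by (simp add: powr_powr[symmetric] powr_realpow)
      finally show ?thesis .
    qed
    ultimately show ?thesis using False r by (simp add: bessel_J_term_def)
  qed
  then have "bessel_I (of_int m) (2 * sqrt x) = (\<Sum>k. sqrt x powr (- of_int m) * bessel_J_term i j k x)"
    unfolding bessel_I_def by simp
  also have "\<dots> = sqrt x powr (- of_int m) * bessel_J m x"
    using sums_mult[OF bessel_J_term_sums[of i j x], of "sqrt x powr (- of_int m)"] by (simp add: sums_iff m)
  finally show ?thesis .
qed

text \<open>The powers of \<open>sqrt x\<close> relating \<open>I_m\<close> to
  \<open>bessel_J m\<close> split into row and column factors; orders growing with
  \<open>j - i\<close> instead of \<open>i - j\<close> mean a transposition.\<close>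

lemma det_bessel_I:
  assumes "x > 0"
  shows "det\<^sub>1 n (\<lambda>i j. bessel_I (real k + real j - real i) (2 * sqrt x)) =
     sqrt x powr (- real (k * n)) * toeplitz_J (int k) n x"
proof -
  let ?s = "sqrt x"
  have eq: "bessel_I (real k + real (j + 1) - real (i + 1)) (2 * ?s) =
     (?s powr (real i - real k)) * ?s powr (- real j) * bessel_J (int k + int j - int i) x" for i j
    using bessel_I_eq[OF assms, of "int k + int j - int i"]
    by (simp add: algebra_simps flip: powr_add)
  have "det\<^sub>1 n (\<lambda>i j. bessel_I (real k + real j - real i) (2 * ?s)) =
     fdet n (\<lambda>i j. bessel_I (real k + real (j + 1) - real (i + 1)) (2 * ?s))"
    unfolding det\<^sub>1_def fdet_def ..
  also have "\<dots> = (\<Prod>i<n. ?s powr (real i - real k)) * (\<Prod>j<n. ?s powr (- real j)) *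
      fdet n (\<lambda>i j. bessel_J (int k + int j - int i) x)"
    unfolding eq by (rule fdet_scale)
  also have "(\<Prod>i<n. ?s powr (real i - real k)) * (\<Prod>j<n. ?s powr (- real j)) = (\<Prod>i<n. ?s powr (- real k))"
    unfolding prod.distrib[symmetric] by (simp flip: powr_add)
  also have "\<dots> = ?s powr (- real (k * n))"
    using assms by (simp add: powr_power mult.commute)
  also have "fdet n (\<lambda>i j. bessel_J (int k + int j - int i) x) = toeplitz_J (int k) n x"
    unfolding toeplitz_def by (rule fdet_transpose)
  finally show ?thesis .
qed

section \<open>Andreief's identity and Christoffel's theorem\<close>

text \<open>After expansion of both determinants the integral of each product factorises over the
  coordinates. For fixed \<open>p\<close> the sum over \<open>q\<close> is a determinant with
  permuted rows, so all \<open>N!\<close> choices of \<open>p\<close> contribute equally.\<close>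

lemma andreief:
  fixes f g :: "nat \<Rightarrow> real \<Rightarrow> real" and w :: "real \<Rightarrow> real"
  assumes int: "\<And>k l. k < N \<Longrightarrow> l < N \<Longrightarrow> integrable lborel (\<lambda>x. w x * (f k x * g l x))"
  defines "M \<equiv> PiM {..<N} (\<lambda>_. lborel)"
  defines "F \<equiv> (\<lambda>x. (\<Prod>i<N. w (x i)) * (fdet N (\<lambda>i k. f k (x i)) * fdet N (\<lambda>i l. g l (x i))))"
  shows "integrable M F"
    and "integral\<^sup>L M F = fact N * fdet N (\<lambda>k l. LINT x|lborel. w x * (f k x * g l x))"
proof -
  interpret product_sigma_finite "\<lambda>_::nat. lborel :: real measure" by standard
  define A where "A k l = (LINT x|lborel. w x * (f k x * g l x))" for k l
  define P where "P = {p. p permutes {..<N}}"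
  have lt: "p i < N" if "p \<in> P" "i < N" for p i
    using permutes_in_image[of p "{..<N}" i] that by (simp add: P_def)
  have F: "F x = (\<Sum>p\<in>P. \<Sum>q\<in>P. of_int (sign p) * of_int (sign q) *
      (\<Prod>i<N. w (x i) * (f (p i) (x i) * g (q i) (x i))))" for x
    unfolding F_def fdet_perm P_def[symmetric] sum_product
    by (simp add: sum_distrib_left prod.distrib mult_ac)
  have int': "integrable M (\<lambda>x. \<Prod>i<N. w (x i) * (f (p i) (x i) * g (q i) (x i)))"
    if "p \<in> P" "q \<in> P" for p q
    unfolding M_def by (rule product_integrable_prod[where f = "\<lambda>i x. w x * (f (p i) x * g (q i) x)"])
      (simp, rule int[OF lt[OF that(1)] lt[OF that(2)]], simp_all)
  have val: "(LINT x|M. (\<Prod>i<N. w (x i) * (f (p i) (x i) * g (q i) (x i)))) = (\<Prod>i<N. A (p i) (q i))"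
    if "p \<in> P" "q \<in> P" for p q
    unfolding M_def A_def by (rule product_integral_prod[where f = "\<lambda>i x. w x * (f (p i) x * g (q i) x)"])
      (simp, rule int[OF lt[OF that(1)] lt[OF that(2)]], simp_all)
  show "integrable M F"
    unfolding F[abs_def] by (intro Bochner_Integration.integrable_sum integrable_mult_right int')
  have "integral\<^sup>L M F = (\<Sum>p\<in>P. \<Sum>q\<in>P. of_int (sign p) * of_int (sign q) * (\<Prod>i<N. A (p i) (q i)))"
    unfolding F[abs_def]
    by (subst Bochner_Integration.integral_sum; (intro Bochner_Integration.integrable_sum integrable_mult_right int')?)
       (auto intro!: sum.cong simp: val int' Bochner_Integration.integral_sum)
  also have "\<dots> = (\<Sum>p\<in>P. of_int (sign p) * fdet N (\<lambda>i j. A (p i) j))"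
    unfolding fdet_perm P_def[symmetric] by (simp add: sum_distrib_left mult.assoc)
  also have "\<dots> = (\<Sum>p\<in>P. fdet N A)"
  proof (intro sum.cong refl)
    fix p assume "p \<in> P"
    then have "fdet N (\<lambda>i j. A (p i) j) = of_int (sign p) * fdet N A"
      by (intro fdet_permute_rows) (simp add: P_def)
    then show "of_int (sign p) * fdet N (\<lambda>i j. A (p i) j) = fdet N A"
      by (simp flip: mult.assoc of_int_mult add: sign_idempotent)
  qed
  also have "\<dots> = fact N * fdet N A"
    using card_permutations[of "{..<N}" N] by (simp add: P_def)
  finally show "integral\<^sup>L M F = fact N * fdet N (\<lambda>k l. LINT x|lborel. w x * (f k x * g l x))"
    by (simp add: A_def[abs_def])
qed

section \<open>Vandermonde determinants and Christoffel's theorem\<close>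

lemma poly_eq_sum_lessThan:
  fixes p :: "real poly"
  assumes "degree p < N"
  shows "poly p x = (\<Sum>l<N. x ^ l * coeff p l)"
proof -
  have "poly p x = (\<Sum>l\<le>degree p. x ^ l * coeff p l)"
    by (subst Polynomial.poly_altdef) (simp only: mult.commute)
  also have "\<dots> = (\<Sum>l<N. x ^ l * coeff p l)"
    by (rule sum.mono_neutral_left) (use assms in \<open>auto intro: le_degree\<close>)
  finally show ?thesis .
qed

lemma fdet_monic_polys:
  assumes "\<And>k. k < N \<Longrightarrow> degree (q k) = k" "\<And>k. k < N \<Longrightarrow> lead_coeff (q k) = 1"
  shows "fdet N (\<lambda>i k. poly (q k) (x i)) = fdet N (\<lambda>i k. x i ^ k)"
proof -
  have "fdet N (\<lambda>i k. poly (q k) (x i)) = fdet N (\<lambda>i k. \<Sum>l<N. x i ^ l * coeff (q k) l)"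
    by (intro fdet_cong poly_eq_sum_lessThan) (simp add: assms)
  also have "\<dots> = fdet N (\<lambda>i k. x i ^ k) * fdet N (\<lambda>l k. coeff (q k) l)"
    by (rule fdet_mult)
  also have "fdet N (\<lambda>l k. coeff (q k) l) = (\<Prod>k<N. coeff (q k) k)"
    by (rule fdet_upper_triangular) (use assms in \<open>auto intro!: coeff_eq_0\<close>)
  also have "\<dots> = 1"
    using assms by (intro prod.neutral) fastforce
  finally show ?thesis by simp
qed

text \<open>The last column may be replaced by the monic polynomial with roots
  \<open>x 0, ..., x (N - 1)\<close>, which vanishes in all rows but the last.\<close>

lemma fdet_vandermonde: "fdet N (\<lambda>i k. x i ^ k) = (\<Prod>j<N. \<Prod>i<j. x j - x i)"
proof (induction N)
  case (Suc N)
  define q where "q k = (if k < N then monom 1 k else (\<Prod>i<N. [:- x i, 1:]))" for k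
  have deg: "degree (\<Prod>i<N. [:- x i, 1:]) = N"
    by (subst degree_prod_eq_sum_degree) auto
  have "lead_coeff (\<Prod>i<N. [:- x i, 1:]) = 1"
    by (subst lead_coeff_prod) auto
  then have "fdet (Suc N) (\<lambda>i k. x i ^ k) = fdet (N + 1) (\<lambda>i k. poly (q k) (x i))"
    unfolding Suc_eq_plus1
    by (subst fdet_monic_polys) (auto simp: q_def degree_monom_eq deg less_Suc_eq)
  also have "\<dots> = fdet N (\<lambda>i k. poly (q k) (x i)) * fdet 1 (\<lambda>i k. poly (q (N + k)) (x (N + i)))"
    by (rule fdet_block) (auto simp: q_def poly_prod intro!: prod_zero)
  also have "fdet N (\<lambda>i k. poly (q k) (x i)) = fdet N (\<lambda>i k. x i ^ k)"
    by (rule fdet_cong) (simp add: q_def poly_monom)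
  also have "fdet 1 (\<lambda>i k. poly (q (N + k)) (x (N + i))) = (\<Prod>i<N. x N - x i)"
    by (simp add: fdet_1 q_def poly_prod)
  finally show ?case using Suc by simp
qed simp

lemma pcompose_shift_eq_sum:
  fixes p :: "real poly"
  assumes "degree p < m"
  shows "p = (\<Sum>l<m. Polynomial.smult (coeff (pcompose p [:t, 1:]) l) ([:- t, 1:] ^ l))"
proof -
  define q where "q = pcompose p [:t, 1:]"
  have "degree q = degree p" by (simp add: q_def)
  have "poly p y = poly (\<Sum>l<m. Polynomial.smult (coeff q l) ([:- t, 1:] ^ l)) y" for y
  proof -
    have "poly p y = poly q (y - t)" by (simp add: q_def poly_pcompose)
    also have "\<dots> = (\<Sum>l<m. (y - t) ^ l * coeff q l)"
      by (rule poly_eq_sum_lessThan) (simp add: assms \<open>degree q = degree p\<close>)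
    also have "\<dots> = poly (\<Sum>l<m. Polynomial.smult (coeff q l) ([:- t, 1:] ^ l)) y"
      by (simp add: poly_sum mult.commute)
    finally show ?thesis .
  qed
  then show ?thesis unfolding q_def by (simp add: poly_eq_poly_eq_iff[symmetric] fun_eq_iff)
qed

lemma fdet_delta: "fdet n (\<lambda>i j. if i = j then h j else 0) = (\<Prod>j<n. h j)"
  by (subst fdet_upper_triangular) auto

text \<open>Confluent form of Christoffel's theorem. With \<open>T\<close> the matrix of Taylor coefficients at \<open>t\<close>
  of the \<open>q\<^sub>k\<close>, unit triangular by monicity, and \<open>B\<close> the matrix of the \<open>n\<close> lowest Taylor
  functionals followed by the \<open>N\<close> functionals \<open>L (q\<^sub>l * _)\<close>, each in the basis
  \<open>(X - t)\<^sup>k\<close>, both \<open>B\<close> and \<open>B T\<close> are block triangular.\<close>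

lemma fdet_christoffel:
  fixes L :: "real poly \<Rightarrow> real" and q :: "nat \<Rightarrow> real poly"
  assumes add: "\<And>p r. L (p + r) = L p + L r" and smult: "\<And>c p. L (Polynomial.smult c p) = c * L p"
    and deg: "\<And>k. k < N + n \<Longrightarrow> degree (q k) = k"
    and monic: "\<And>k. k < N + n \<Longrightarrow> lead_coeff (q k) = 1"
    and orth: "\<And>l k. l < N \<Longrightarrow> k < N + n \<Longrightarrow> l \<noteq> k \<Longrightarrow> L (q l * q k) = 0"
  shows "fdet N (\<lambda>k l. L ([:- t, 1:] ^ (n + k) * q l)) =
     (-1) ^ (N * n) * (\<Prod>l<N. L (q l * q l)) * fdet n (\<lambda>i j. coeff (pcompose (q (N + i)) [:t, 1:]) j)"
proof -
  define T where "T l k = coeff (pcompose (q k) [:t, 1:]) l" for l k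
  define B where "B i l = (if i < n then (if i = l then 1 else 0) else L (q (i - n) * [:- t, 1:] ^ l))" for i l
  have L0: "L 0 = 0" using smult[of 0 0] by simp
  have Lsum: "L (\<Sum>l\<in>S. p l) = (\<Sum>l\<in>S. L (p l))" for S :: "nat set" and p
    by (induction S rule: infinite_finite_induct) (simp_all add: L0 add)
  have detT: "fdet (n + N) T = 1"
  proof -
    have degT: "degree (pcompose (q k) [:t, 1:]) = k" if "k < n + N" for k
      using that deg by (simp add: add.commute)
    have "T k k = 1" if "k < n + N" for k
    proof -
      have "T k k = lead_coeff (pcompose (q k) [:t, 1:])" using degT[OF that] by (simp add: T_def)
      also have "\<dots> = 1" using that monic by (subst lead_coeff_comp) (auto simp: add.commute)
      finally show ?thesis .
    qed
    moreover have "fdet (n + N) T = (\<Prod>k<n + N. T k k)"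
      by (rule fdet_upper_triangular) (use degT in \<open>auto simp: T_def intro!: coeff_eq_0\<close>)
    ultimately show ?thesis by simp
  qed
  have detB: "fdet (n + N) B = fdet N (\<lambda>k l. L ([:- t, 1:] ^ (n + k) * q l))"
  proof -
    have "fdet (n + N) B = fdet n B * fdet N (\<lambda>i j. B (n + i) (n + j))"
      by (rule fdet_block) (auto simp: B_def)
    also have "fdet n B = fdet n (\<lambda>i j. if i = j then 1 else 0)"
      by (rule fdet_cong) (simp add: B_def)
    also have "\<dots> = 1" by (subst fdet_delta) simp
    also have "fdet N (\<lambda>i j. B (n + i) (n + j)) = fdet N (\<lambda>l k. L ([:- t, 1:] ^ (n + k) * q l))"
      by (rule fdet_cong) (simp add: B_def mult.commute)
    also have "\<dots> = fdet N (\<lambda>k l. L ([:- t, 1:] ^ (n + k) * q l))" by (rule fdet_transpose)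
    finally show ?thesis by simp
  qed
  have BT: "(\<Sum>l<n + N. B i l * T l k) = (if i < n then T i k else L (q (i - n) * q k))"
    if "i < n + N" "k < n + N" for i k
  proof (cases "i < n")
    case True
    then have "(\<Sum>l<n + N. B i l * T l k) = (\<Sum>l<n + N. if l = i then T l k else 0)"
      by (intro sum.cong) (auto simp: B_def)
    then show ?thesis using True by simp
  next
    case False
    have "q k = (\<Sum>l<n + N. Polynomial.smult (T l k) ([:- t, 1:] ^ l))"
      unfolding T_def by (rule pcompose_shift_eq_sum) (use that deg in \<open>simp add: add.commute\<close>)
    then have "q (i - n) * q k = (\<Sum>l<n + N. Polynomial.smult (T l k) (q (i - n) * [:- t, 1:] ^ l))"
      by (simp only: sum_distrib_left mult_smult_right)
    then have "L (q (i - n) * q k) = L (\<Sum>l<n + N. Polynomial.smult (T l k) (q (i - n) * [:- t, 1:] ^ l))"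
      by (simp only:)
    also have "\<dots> = (\<Sum>l<n + N. B i l * T l k)"
      using False by (simp add: Lsum smult B_def mult.commute)
    finally show ?thesis using False by simp
  qed
  define G where "G i j = (if i < n then T i (if j < n then j + N else j - n)
      else L (q (i - n) * q (if j < n then j + N else j - n)))" for i j
  have "fdet (n + N) B = fdet (n + N) (\<lambda>i k. \<Sum>l<n + N. B i l * T l k)"
    unfolding fdet_mult detT by simp
  also have "\<dots> = fdet (n + N) (\<lambda>i k. if i < n then T i k else L (q (i - n) * q k))"
    by (rule fdet_cong) (rule BT)
  \<comment> \<open>The columns of \<open>q N, ..., q (N + n - 1)\<close> move to the front. Under
    them the rows \<open>i \<ge> n\<close> vanish by orthogonality, and the other block of these
    rows is diagonal.\<close>
  also have "\<dots> = (-1) ^ (n * N) * fdet (n + N) G"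
    unfolding G_def by (subst fdet_swap_cols) simp
  also have "fdet (n + N) G = fdet (n + N) (\<lambda>j i. G i j)"
    by (rule fdet_transpose[symmetric])
  also have "\<dots> = fdet n (\<lambda>j i. G i j) * fdet N (\<lambda>j i. G (n + i) (n + j))"
    by (rule fdet_block) (auto simp: G_def intro!: orth)
  also have "fdet n (\<lambda>j i. G i j) = fdet n (\<lambda>i j. coeff (pcompose (q (N + i)) [:t, 1:]) j)"
    by (rule fdet_cong) (simp add: G_def T_def add.commute)
  also have "fdet N (\<lambda>j i. G (n + i) (n + j)) = fdet N (\<lambda>j i. if j = i then L (q i * q i) else 0)"
    by (rule fdet_cong) (auto simp: G_def intro!: orth)
  also have "\<dots> = (\<Prod>l<N. L (q l * q l))" by (rule fdet_delta)
  finally show ?thesis unfolding detB by (simp add: mult_ac)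
qed

section \<open>Jacobi polynomials\<close>

lemma alternating_binomial_sum_Suc:
  fixes f :: "nat \<Rightarrow> real"
  shows "(\<Sum>k\<le>Suc m. (-1) ^ k * real (Suc m choose k) * f k) =
     (\<Sum>k\<le>m. (-1) ^ k * real (m choose k) * (f k - f (Suc k)))"
proof -
  let ?S = "\<Sum>k\<le>m. (-1) ^ k * real (m choose k) * f (Suc k)"
  let ?U = "\<Sum>k\<le>m. (-1) ^ Suc k * real (m choose Suc k) * f (Suc k)"
  have "(\<Sum>k\<le>Suc m. (-1) ^ k * real (Suc m choose k) * f k) =
     f 0 + (\<Sum>k\<le>m. (-1) ^ Suc k * real (Suc m choose Suc k) * f (Suc k))"
    by (subst sum.atMost_Suc_shift) simp
  also have "(\<Sum>k\<le>m. (-1) ^ Suc k * real (Suc m choose Suc k) * f (Suc k)) = - ?S + ?U"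
    unfolding sum_negf[symmetric] sum.distrib[symmetric]
    by (intro sum.cong refl) (simp add: algebra_simps)
  also have "f 0 + (- ?S + ?U) = (f 0 + ?U) - ?S" by simp
  also have "f 0 + ?U = (\<Sum>k\<le>Suc m. (-1) ^ k * real (m choose k) * f k)"
    by (subst sum.atMost_Suc_shift) simp
  also have "\<dots> = (\<Sum>k\<le>m. (-1) ^ k * real (m choose k) * f k)" by simp
  finally show ?thesis by (simp only: sum_subtractf[symmetric] right_diff_distrib)
qed

text \<open>An \<open>m\<close>th finite difference annihilates polynomials of degree below
  \<open>m\<close>; one difference of a rising factorial lowers \<open>r\<close> by one and shifts
  \<open>c\<close>.\<close>

lemma alternating_binomial_sum_pochhammer:
  assumes "r < m"
  shows "(\<Sum>k\<le>m. (-1) ^ k * real (m choose k) * pochhammer (c + real k) r) = 0"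
  using assms
proof (induction m arbitrary: r c)
  case (Suc m)
  show ?case
  proof (cases r)
    case 0
    then show ?thesis unfolding alternating_binomial_sum_Suc by simp
  next
    case (Suc s)
    have "pochhammer (c + real k) r - pochhammer (c + real (Suc k)) r =
        - real r * pochhammer ((c + 1) + real k) s" for k
    proof -
      have 1: "pochhammer (c + real k) r = (c + real k) * pochhammer ((c + 1) + real k) s"
        unfolding Suc pochhammer_rec by (simp add: add_ac)
      have 2: "pochhammer (c + real (Suc k)) r = pochhammer ((c + 1) + real k) s * (c + 1 + real k + real s)"
        unfolding Suc by (simp add: pochhammer_Suc add_ac)
      show ?thesis unfolding 1 2 by (simp add: Suc algebra_simps)
    qed
    then have "(\<Sum>k\<le>Suc m. (-1) ^ k * real (Suc m choose k) * pochhammer (c + real k) r) =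
       (\<Sum>k\<le>m. - real r * ((-1) ^ k * real (m choose k) * pochhammer ((c + 1) + real k) s))"
      unfolding alternating_binomial_sum_Suc by (simp add: mult_ac)
    also have "\<dots> = - real r * (\<Sum>k\<le>m. (-1) ^ k * real (m choose k) * pochhammer ((c + 1) + real k) s)"
      by (simp only: sum_distrib_left)
    also have "\<dots> = 0" using Suc.IH[of s "c + 1"] Suc.prems Suc by simp
    finally show ?thesis .
  qed
qed simp

section \<open>The Jacobi functional and its orthogonal polynomials\<close>

definition jacobi_w :: "real \<Rightarrow> real \<Rightarrow> real \<Rightarrow> real" where
  "jacobi_w a b x = indicator {0..1} x * (x powr a * (1 - x) powr b)"

definition jacobi_L :: "real \<Rightarrow> real \<Rightarrow> real poly \<Rightarrow> real" where
  "jacobi_L a b p = (LINT x|lborel. jacobi_w a b x * poly p x)"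

lemma borel_measurable_jacobi_w [measurable]: "jacobi_w a b \<in> borel_measurable borel"
  unfolding jacobi_w_def[abs_def] by measurable

lemma jacobi_w_nonneg: "0 \<le> jacobi_w a b x"
  by (simp add: jacobi_w_def)

lemma has_bochner_integral_jacobi_w:
  assumes "a > -1" "b > -1"
  shows "has_bochner_integral lborel (jacobi_w a b) (Beta (a + 1) (b + 1))"
proof -
  have "((\<lambda>t. t powr a * (1 - t) powr b) has_integral Beta (a + 1) (b + 1)) {0..1}"
    using has_integral_Beta_real[of "a + 1" "b + 1"] assms by simp
  moreover have eq: "(\<lambda>t. indicator {0..1} t * (t powr a * (1 - t) powr b)) =
      (\<lambda>t. if t \<in> {0..1} then t powr a * (1 - t) powr b else 0)"
    by (auto simp: indicator_def)
  ultimately have "((\<lambda>t. indicator {0..1} t * (t powr a * (1 - t) powr b)) has_integral Beta (a + 1) (b + 1)) UNIV"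
    unfolding eq by (subst has_integral_restrict_UNIV)
  \<comment> \<open>The Beta integral is given as a gauge integral; nonnegativity turns it into a
    Lebesgue integral.\<close>
  then have "(\<integral>\<^sup>+x. ennreal (jacobi_w a b x) \<partial>lborel) = ennreal (Beta (a + 1) (b + 1))"
    unfolding jacobi_w_def by (intro nn_integral_has_integral_lborel) auto
  moreover have "0 < Beta (a + 1) (b + 1)"
    unfolding Beta_def using assms by (intro divide_pos_pos mult_pos_pos Gamma_real_pos) auto
  ultimately show ?thesis
    by (intro has_bochner_integral_nn_integral) (auto simp: jacobi_w_nonneg)
qed

text \<open>This holds at every point: at \<open>0\<close> and \<open>1\<close> both sides vanish,
  because \<open>0 powr c = 0\<close> for every exponent \<open>c\<close>.\<close>

lemma jacobi_w_mult:
  "jacobi_w a b x * (x ^ k * (1 - x) ^ l) = jacobi_w (a + real k) (b + real l) x"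
proof (cases "x \<in> {0..1}")
  case True
  have *: "y powr c * y ^ n = y powr (c + real n)" if "y \<ge> 0" for y c :: real and n
    using that by (cases "y = 0") (auto simp: powr_add powr_realpow zero_power)
  have "x powr a * (1 - x) powr b * (x ^ k * (1 - x) ^ l) =
     (x powr a * x ^ k) * ((1 - x) powr b * (1 - x) ^ l)" by simp
  also have "\<dots> = x powr (a + real k) * (1 - x) powr (b + real l)"
    using True by (simp only: * atLeastAtMost_iff) (simp add: *)
  finally show ?thesis using True by (simp add: jacobi_w_def)
qed (simp add: jacobi_w_def)

lemma integrable_jacobi_w_poly:
  assumes "a > -1" "b > -1"
  shows "integrable lborel (\<lambda>x. jacobi_w a b x * poly p x)"
proof -
  have "integrable lborel (\<lambda>x. jacobi_w a b x * x ^ k)" for k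
    using has_bochner_integral_jacobi_w[of "a + real k" b] jacobi_w_mult[of a b _ k 0] assms
    by (auto simp: has_bochner_integral_iff)
  then have "integrable lborel (\<lambda>x. \<Sum>k\<le>degree p. coeff p k * (jacobi_w a b x * x ^ k))"
    by (intro Bochner_Integration.integrable_sum integrable_mult_right)
  then show ?thesis
    by (simp add: poly_altdef sum_distrib_left mult_ac)
qed

lemma jacobi_L_add:
  assumes "a > -1" "b > -1"
  shows "jacobi_L a b (p + q) = jacobi_L a b p + jacobi_L a b q"
  unfolding jacobi_L_def poly_add distrib_left
  by (intro Bochner_Integration.integral_add integrable_jacobi_w_poly assms)

lemma jacobi_L_smult: "jacobi_L a b (Polynomial.smult c p) = c * jacobi_L a b p"
  unfolding jacobi_L_def poly_smult by (simp add: mult.left_commute)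

lemma jacobi_L_sum:
  assumes "a > -1" "b > -1" "finite S"
  shows "jacobi_L a b (\<Sum>k\<in>S. p k) = (\<Sum>k\<in>S. jacobi_L a b (p k))"
  using assms(3)
  by (induction S rule: finite_induct) (simp_all add: jacobi_L_add assms, simp add: jacobi_L_def)

lemma jacobi_L_monomial:
  assumes "a > -1" "b > -1"
  shows "jacobi_L a b (monom 1 k * [:1, -1:] ^ l) = Beta (a + real k + 1) (b + real l + 1)"
proof -
  have "jacobi_L a b (monom 1 k * [:1, -1:] ^ l) = (LINT x|lborel. jacobi_w (a + real k) (b + real l) x)"
    unfolding jacobi_L_def jacobi_w_mult[symmetric] by (simp add: poly_monom)
  also have "\<dots> = Beta (a + real k + 1) (b + real l + 1)"
    using has_bochner_integral_jacobi_w[of "a + real k" "b + real l"] assms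
    by (simp add: has_bochner_integral_iff)
  finally show ?thesis .
qed

text \<open>A vanishing integral would force \<open>p\<close> to vanish almost everywhere on
  \<open>(0, 1)\<close>, but \<open>p\<close> has finitely many roots.\<close>

lemma jacobi_L_square_pos:
  assumes "a > -1" "b > -1" "p \<noteq> 0"
  shows "jacobi_L a b (p * p) > 0"
proof -
  have nonneg: "0 \<le> jacobi_w a b x * poly (p * p) x" for x
    by (simp add: jacobi_w_def)
  have "jacobi_L a b (p * p) \<noteq> 0"
  proof
    assume "jacobi_L a b (p * p) = 0"
    then have "AE x in lborel. jacobi_w a b x * poly (p * p) x = 0"
      unfolding jacobi_L_def
        integral_nonneg_eq_0_iff_AE[OF integrable_jacobi_w_poly[OF assms(1,2)] AE_I2[OF nonneg]] .
    moreover have "AE x in lborel. x \<notin> {x. poly p x = 0}"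
      using poly_roots_finite[OF assms(3)] by (intro AE_not_in finite_imp_null_set_lborel)
    ultimately have "AE x in lborel. x \<notin> {0<..<1::real}"
    proof eventually_elim
      case (elim x)
      then show ?case by (auto simp: jacobi_w_def)
    qed
    then have "{0<..<1::real} \<in> null_sets lborel"
      by (subst (asm) AE_iff_null_sets[symmetric]) auto
    then show False by (simp add: null_sets_def)
  qed
  moreover have "jacobi_L a b (p * p) \<ge> 0"
    unfolding jacobi_L_def by (intro integral_nonneg_AE AE_I2 nonneg)
  ultimately show ?thesis by simp
qed

text \<open>The hypergeometric polynomial \<open>2F1(- m, m + a + b + 1; a + 1; x)\<close> times its
  normalising constant, with the Pochhammer symbols cancelled so that the leading coefficient is
  visibly \<open>1\<close>.\<close>

definition jac :: "nat \<Rightarrow> real \<Rightarrow> real \<Rightarrow> real poly" where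
  "jac m a b = (\<Sum>k\<le>m. monom ((-1) ^ (m - k) * real (m choose k) *
     pochhammer (a + real k + 1) (m - k) / pochhammer (real m + a + b + 1 + real k) (m - k)) k)"

lemma coeff_jac: "coeff (jac m a b) k = (-1) ^ (m - k) * real (m choose k) *
     pochhammer (a + real k + 1) (m - k) / pochhammer (real m + a + b + 1 + real k) (m - k)"
  by (cases "k \<le> m") (simp_all add: jac_def coeff_sum coeff_monom if_distrib binomial_eq_0 cong: if_cong)

lemma degree_jac: "degree (jac m a b) = m"
  by (rule antisym[OF degree_le le_degree]) (auto simp: coeff_jac binomial_eq_0)

lemma lead_coeff_jac: "lead_coeff (jac m a b) = 1"
  by (simp add: degree_jac coeff_jac)

lemma jac_nonzero: "jac m a b \<noteq> 0"
  using lead_coeff_jac[of m a b] by force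

text \<open>Against \<open>(1 - x) ^ l\<close> each monomial gives a Beta value. The Gamma factors
  cancel down to a constant times a rising factorial in \<open>k\<close> of degree
  \<open>m - 1 - l < m\<close>, which the alternating binomial sum annihilates.\<close>

lemma jacobi_L_jac_power:
  assumes "a > -1" "b > -1" "l < m"
  shows "jacobi_L a b (jac m a b * [:1, -1:] ^ l) = 0"
proof -
  have PG: "pochhammer z r = Gamma u / Gamma z" if "z > 0" "z + real r = u" for z u :: real and r
  proof -
    have "z \<notin> \<int>\<^sub>\<le>\<^sub>0" using that(1) by (auto elim!: nonpos_Ints_cases)
    from pochhammer_Gamma[OF this, of r] that(2) show ?thesis by simp
  qed
  define C where "C = (-1) ^ m * (Gamma (a + real m + 1) / Gamma (2 * real m + a + b + 1) * Gamma (b + real l + 1))"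
  have m1: "real l + 1 \<le> real m" using assms by linarith
  have trm: "coeff (jac m a b) k * Beta (a + real k + 1) (b + real l + 1) =
      C * ((-1) ^ k * real (m choose k) * pochhammer (a + b + real l + 2 + real k) (m - 1 - l))" if "k \<le> m" for k
  proof -
    have 1: "pochhammer (a + real k + 1) (m - k) = Gamma (a + real m + 1) / Gamma (a + real k + 1)"
      by (rule PG) (use that assms in \<open>simp_all add: of_nat_diff\<close>)
    have 2: "pochhammer (real m + a + b + 1 + real k) (m - k) = Gamma (2 * real m + a + b + 1) / Gamma (real m + a + b + 1 + real k)"
      by (rule PG) (use that assms m1 in \<open>simp_all add: of_nat_diff\<close>)
    have 3: "pochhammer (a + b + real l + 2 + real k) (m - 1 - l) =
        Gamma (real m + a + b + 1 + real k) / Gamma (a + b + real l + 2 + real k)"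
      by (rule PG) (use that assms m1 in \<open>simp_all add: of_nat_diff\<close>)
    have sgn: "(-1) ^ (m - k) = (-1) ^ m * ((-1) ^ k :: real)"
      using that by (simp add: power_diff minus_one_power_iff)
    have B: "Beta (a + real k + 1) (b + real l + 1) = Gamma (a + real k + 1) * Gamma (b + real l + 1) / Gamma (a + b + real l + 2 + real k)"
      by (simp add: Beta_def algebra_simps)
    have nz: "Gamma (a + real k + 1) \<noteq> 0" "Gamma (real m + a + b + 1 + real k) \<noteq> 0"
      using assms m1 by (auto intro!: Gamma_real_pos less_imp_neq[THEN not_sym])
    show ?thesis
      unfolding coeff_jac 1 2 3 sgn B C_def using nz by (simp add: field_simps)
  qed
  have eq: "jac m a b = (\<Sum>k\<le>m. Polynomial.smult (coeff (jac m a b) k) (monom 1 k))"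
    unfolding smult_monom coeff_jac by (simp add: jac_def)
  have "jac m a b * [:1, -1:] ^ l = (\<Sum>k\<le>m. Polynomial.smult (coeff (jac m a b) k) (monom 1 k * [:1, -1:] ^ l))"
    by (subst eq) (simp only: sum_distrib_right mult_smult_left)
  then have "jacobi_L a b (jac m a b * [:1, -1:] ^ l) =
     jacobi_L a b (\<Sum>k\<le>m. Polynomial.smult (coeff (jac m a b) k) (monom 1 k * [:1, -1:] ^ l))"
    by (simp only:)
  also have "\<dots> = (\<Sum>k\<le>m. coeff (jac m a b) k * Beta (a + real k + 1) (b + real l + 1))"
    by (subst jacobi_L_sum) (simp_all add: assms jacobi_L_smult jacobi_L_monomial)
  also have "\<dots> = C * (\<Sum>k\<le>m. (-1) ^ k * real (m choose k) * pochhammer (a + b + real l + 2 + real k) (m - 1 - l))"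
    unfolding sum_distrib_left by (intro sum.cong refl trm) simp
  also have "\<dots> = 0"
    using alternating_binomial_sum_pochhammer[of "m - 1 - l" m "a + b + real l + 2"] assms by simp
  finally show ?thesis .
qed

lemma jacobi_L_jac_orth:
  assumes "a > -1" "b > -1" "degree q < m"
  shows "jacobi_L a b (jac m a b * q) = 0"
proof -
  have pw: "([:- 1, 1:] :: real poly) ^ l = Polynomial.smult ((- 1) ^ l) ([:1, - 1:] ^ l)" for l :: nat
  proof -
    have "[:- 1, 1:] = Polynomial.smult (- 1 :: real) [:1, - 1:]" by simp
    then show ?thesis by (simp only: Polynomial.smult_power)
  qed
  define c where "c l = coeff (pcompose q [:1, 1:]) l * (- 1) ^ l" for l
  have "q = (\<Sum>l<m. Polynomial.smult (coeff (pcompose q [:1, 1:]) l) ([:- 1, 1:] ^ l))"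
    by (rule pcompose_shift_eq_sum) fact
  also have "\<dots> = (\<Sum>l<m. Polynomial.smult (c l) ([:1, - 1:] ^ l))"
    by (simp add: pw c_def)
  finally have eq: "q = (\<Sum>l<m. Polynomial.smult (c l) ([:1, - 1:] ^ l))" .
  have "jac m a b * q = (\<Sum>l<m. Polynomial.smult (c l) (jac m a b * [:1, - 1:] ^ l))"
    by (subst eq) (simp only: sum_distrib_left mult_smult_right)
  then have "jacobi_L a b (jac m a b * q) = jacobi_L a b (\<Sum>l<m. Polynomial.smult (c l) (jac m a b * [:1, - 1:] ^ l))"
    by (simp only:)
  also have "\<dots> = 0"
    by (subst jacobi_L_sum) (simp_all add: assms jacobi_L_smult jacobi_L_jac_power)
  finally show ?thesis .
qed

lemma is_monic_jacobi_iff: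
  "is_monic_jacobi m a b p \<longleftrightarrow>
     degree p = m \<and> lead_coeff p = 1 \<and> (\<forall>q. degree q < m \<longrightarrow> jacobi_L a b (p * q) = 0)"
  unfolding is_monic_jacobi_def jacobi_L_def set_lebesgue_integral_def jacobi_w_def
  by (simp add: mult_ac)

lemma monic_jacobi_eq_jac:
  assumes "a > -1" "b > -1"
  shows "monic_jacobi m a b = jac m a b"
  unfolding monic_jacobi_def
proof (rule the_equality)
  show "is_monic_jacobi m a b (jac m a b)"
    unfolding is_monic_jacobi_iff
    using assms by (auto simp: degree_jac lead_coeff_jac[unfolded degree_jac] jacobi_L_jac_orth)
next
  fix p assume p: "is_monic_jacobi m a b p"
  \<comment> \<open>The difference of two candidates has degree below \<open>m\<close>, hence is
    orthogonal to both and so to itself.\<close>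
  define d where "d = p - jac m a b"
  show "p = jac m a b"
  proof (rule ccontr)
    assume "p \<noteq> jac m a b"
    then have d0: "d \<noteq> 0" by (simp add: d_def)
    have "degree d < m"
    proof -
      have "degree d \<le> m" unfolding d_def using p
        by (intro degree_diff_le) (auto simp: is_monic_jacobi_iff degree_jac)
      moreover have "coeff d m = 0"
        using p lead_coeff_jac[of m a b] by (auto simp: d_def is_monic_jacobi_iff degree_jac)
      ultimately show ?thesis
        using d0 by (metis leading_coeff_0_iff order_le_imp_less_or_eq)
    qed
    then have "jacobi_L a b (p * d) = 0" "jacobi_L a b (jac m a b * d) = 0"
      using p assms by (auto simp: is_monic_jacobi_iff jacobi_L_jac_orth)
    moreover have "p * d = jac m a b * d + d * d" by (simp add: d_def algebra_simps)
    ultimately have "jacobi_L a b (d * d) = 0"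
      using jacobi_L_add[OF assms, of "jac m a b * d" "d * d"] by simp
    with jacobi_L_square_pos[OF assms d0] show False by simp
  qed
qed

section \<open>Taylor coefficients of the Jacobi polynomials\<close>

lemma coeff_pcompose_shift:
  fixes p :: "real poly"
  assumes "degree p \<le> M"
  shows "coeff (pcompose p [:t, 1:]) j = (\<Sum>k\<le>M. coeff p k * (real (k choose j) * t ^ (k - j)))"
proof -
  have c: "coeff ([:t, 1:] ^ k) j = real (k choose j) * t ^ (k - j)" for k
  proof (cases "j \<le> k")
    case True
    then show ?thesis by (simp add: coeff_linear_poly_power)
  next
    case False
    then show ?thesis by (simp add: binomial_eq_0 coeff_eq_0 degree_linear_power)
  qed
  have pw: "pcompose ([:0, 1:] ^ k) [:t, 1:] = [:t, 1:] ^ k" for k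
    by (induction k) (simp_all add: pcompose_mult pcompose_1 pcompose_pCons)
  have "p = (\<Sum>k<Suc M. Polynomial.smult (coeff (pcompose p [:0, 1:]) k) ([:- 0, 1:] ^ k))"
    by (rule pcompose_shift_eq_sum) (use assms in simp)
  then have p: "p = (\<Sum>k\<le>M. Polynomial.smult (coeff p k) ([:0, 1:] ^ k))"
    by (simp add: lessThan_Suc_atMost)
  have "pcompose p [:t, 1:] = (\<Sum>k\<le>M. Polynomial.smult (coeff p k) ([:t, 1:] ^ k))"
    by (subst p) (simp only: pcompose_sum pcompose_smult pw)
  then show ?thesis by (simp add: coeff_sum c)
qed

text \<open>Derivatives of Jacobi polynomials are Jacobi polynomials of lower degree with both
  exponents raised. This is the origin of the exponents that vary with the column.\<close>

lemma coeff_pcompose_jac: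
  assumes "j \<le> m"
  shows "coeff (pcompose (jac m 0 b) [:t, 1:]) j = real (m choose j) * poly (jac (m - j) (real j) (b + real j)) t"
proof -
  have "coeff (pcompose (jac m 0 b) [:t, 1:]) j = (\<Sum>k\<le>m. coeff (jac m 0 b) k * (real (k choose j) * t ^ (k - j)))"
    by (rule coeff_pcompose_shift) (simp add: degree_jac)
  also have "\<dots> = (\<Sum>k=j..m. coeff (jac m 0 b) k * (real (k choose j) * t ^ (k - j)))"
    by (rule sum.mono_neutral_right) (auto simp: binomial_eq_0)
  also have "\<dots> = (\<Sum>k\<le>m - j. coeff (jac m 0 b) (k + j) * (real ((k + j) choose j) * t ^ k))"
    using assms
    by (intro sum.reindex_bij_witness[of _ "\<lambda>k. k + j" "\<lambda>k. k - j"]) auto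
  also have "\<dots> = (\<Sum>k\<le>m - j. real (m choose j) * (coeff (jac (m - j) (real j) (b + real j)) k * t ^ k))"
  proof (intro sum.cong refl)
    fix k assume k: "k \<in> {..m - j}"
    have "(m choose (k + j)) * ((k + j) choose j) = (m choose j) * ((m - j) choose (k + j - j))"
      by (rule choose_mult) (use k assms in auto)
    then have "(m choose (k + j)) * ((k + j) choose j) = (m choose j) * ((m - j) choose k)" by simp
    from arg_cong[OF this, of real]
    have ch: "real (m choose (k + j)) * real ((k + j) choose j) = real (m choose j) * real ((m - j) choose k)"
      by (simp only: of_nat_mult)
    have e: "m - (k + j) = m - j - k" by simp
    have a1: "0 + real (k + j) + 1 = real j + real k + 1" by simp
    have a2: "real m + 0 + b + 1 + real (k + j) = real (m - j) + real j + (b + real j) + 1 + real k"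
      using assms by (simp add: of_nat_diff)
    have "coeff (jac m 0 b) (k + j) * (real ((k + j) choose j) * t ^ k) =
      (real (m choose (k + j)) * real ((k + j) choose j)) * ((-1) ^ (m - j - k) * pochhammer (real j + real k + 1) (m - j - k) /
       pochhammer (real (m - j) + real j + (b + real j) + 1 + real k) (m - j - k)) * t ^ k"
      unfolding coeff_jac e a1 a2 by simp
    then show "coeff (jac m 0 b) (k + j) * (real ((k + j) choose j) * t ^ k) =
      real (m choose j) * (coeff (jac (m - j) (real j) (b + real j)) k * t ^ k)"
      unfolding ch coeff_jac by simp
  qed
  also have "\<dots> = real (m choose j) * poly (jac (m - j) (real j) (b + real j)) t"
    by (simp add: poly_altdef degree_jac sum_distrib_left)
  finally show ?thesis .
qed

text \<open>Row factor, column factor and the entry of the theorem. Beyond the degree the Taylor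
  coefficient vanishes, in agreement with the convention for negative degrees.\<close>

lemma coeff_pcompose_jac_entry:
  assumes "b > -1"
  shows "coeff (pcompose (jac (N + i) 0 b) [:t, 1:]) j =
     fact (N + i) * inverse (fact j) * jacobi_entry (int N + int i - int j) (real j) (b + real j) t"
proof (cases "j \<le> N + i")
  case True
  then have n: "nat (int N + int i - int j) = N + i - j" "\<not> int N + int i - int j < 0" by auto
  show ?thesis
    unfolding coeff_pcompose_jac[OF True] jacobi_entry_def n
    using assms True by (simp add: n monic_jacobi_eq_jac binomial_fact field_simps)
next
  case False
  then have "coeff (pcompose (jac (N + i) 0 b) [:t, 1:]) j = 0"
    by (intro coeff_eq_0) (simp add: degree_jac)
  then show ?thesis using False by (simp add: jacobi_entry_def)
qed

section \<open>The Hankel determinant evaluated in two bases\<close>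

lemma jacobi_L_monom_mult: "jacobi_L a b (monom 1 k * p) = jacobi_L (a + real k) b p"
  unfolding jacobi_L_def using jacobi_w_mult[of a b _ k 0]
  by (simp add: poly_monom flip: mult.assoc)

lemma jac_orth:
  assumes "b > -1" "l \<noteq> k"
  shows "jacobi_L 0 b (jac l 0 b * jac k 0 b) = 0"
proof (cases "l < k")
  case True
  then show ?thesis using jacobi_L_jac_orth[of 0 b "jac l 0 b" k] assms by (simp add: degree_jac mult.commute)
next
  case False
  then show ?thesis using jacobi_L_jac_orth[of 0 b "jac k 0 b" l] assms by (simp add: degree_jac)
qed

text \<open>The Hankel determinant of the weight \<open>(y - t) ^ n * (1 - y) powr b\<close>, with
  powers of \<open>y - t\<close> in the rows and monic orthogonal polynomials in the columns instead
  of monomials. These changes of basis are unit triangular and preserve the value.\<close>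

definition jac_hankel :: "nat \<Rightarrow> nat \<Rightarrow> real \<Rightarrow> real \<Rightarrow> real" where
  "jac_hankel N n b t = fdet N (\<lambda>k l. jacobi_L 0 b ([:- t, 1:] ^ (n + k) * jac l 0 b))"

definition jac_norm :: "nat \<Rightarrow> real \<Rightarrow> real" where
  "jac_norm N b = (\<Prod>l<N. jacobi_L 0 b (jac l 0 b * jac l 0 b))"

lemma jac_norm_pos: "b > -1 \<Longrightarrow> jac_norm N b > 0"
  unfolding jac_norm_def by (intro prod_pos) (auto intro!: jacobi_L_square_pos jac_nonzero)

lemma jac_hankel_eq_jac:
  assumes "b > -1"
  shows "jac_hankel N n b t = (-1) ^ (N * n) * jac_norm N b *
     fdet n (\<lambda>i j. coeff (pcompose (jac (N + i) 0 b) [:t, 1:]) j)"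
  unfolding jac_hankel_def jac_norm_def
  by (rule fdet_christoffel)
     (use assms in \<open>auto simp: jacobi_L_add jacobi_L_smult degree_jac lead_coeff_jac[unfolded degree_jac] jac_orth\<close>)

text \<open>The polynomials \<open>X\<^sup>i p\<^sub>N\<close> with \<open>p\<^sub>N\<close> orthogonal for \<open>x\<^sup>i (1 - x)\<^sup>b\<close> have degree \<open>N + i\<close> and are
  orthogonal for \<open>(1 - x)\<^sup>b\<close> to all polynomials of degree below \<open>N\<close>, so they may replace the last
  \<open>n\<close> orthogonal polynomials. Unlike these, they yield a determinant that stays non-degenerate in
  the scaling limit.\<close>

lemma jac_hankel_eq_monom_jac:
  assumes "b > -1"
  shows "jac_hankel N n b t = (-1) ^ (N * n) * jac_norm N b *
     fdet n (\<lambda>i j. coeff (pcompose (monom 1 i * jac N (real i) b) [:t, 1:]) j)"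
proof -
  define q where "q k = (if k < N then jac k 0 b else monom 1 (k - N) * jac N (real (k - N)) b)" for k
  have nz: "monom 1 i * jac N (real i) b \<noteq> 0" for i by (simp add: jac_nonzero)
  have deg: "degree (q k) = k" for k
    by (auto simp: q_def degree_jac degree_mult_eq jac_nonzero degree_monom_eq)
  have monic: "lead_coeff (q k) = 1" for k
    by (auto simp: q_def lead_coeff_mult lead_coeff_jac degree_monom_eq)
  have orth: "jacobi_L 0 b (q l * q k) = 0" if "l < N" "l \<noteq> k" for l k
  proof (cases "k < N")
    case True
    then show ?thesis using that assms by (simp add: q_def jac_orth)
  next
    case False
    have "jacobi_L 0 b (q l * q k) = jacobi_L 0 b (monom 1 (k - N) * (jac N (real (k - N)) b * jac l 0 b))"
      using that False by (simp add: q_def mult_ac)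
    also have "\<dots> = 0"
      unfolding jacobi_L_monom_mult using that assms jacobi_L_jac_orth[of "real (k - N)" b "jac l 0 b" N]
      by (simp add: degree_jac)
    finally show ?thesis .
  qed
  have "fdet N (\<lambda>k l. jacobi_L 0 b ([:- t, 1:] ^ (n + k) * q l)) =
     (-1) ^ (N * n) * (\<Prod>l<N. jacobi_L 0 b (q l * q l)) * fdet n (\<lambda>i j. coeff (pcompose (q (N + i)) [:t, 1:]) j)"
    by (rule fdet_christoffel) (use assms in \<open>auto simp: jacobi_L_add jacobi_L_smult deg monic[unfolded deg] orth\<close>)
  moreover have "fdet N (\<lambda>k l. jacobi_L 0 b ([:- t, 1:] ^ (n + k) * q l)) = jac_hankel N n b t"
    unfolding jac_hankel_def by (rule fdet_cong) (simp add: q_def)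
  moreover have "(\<Prod>l<N. jacobi_L 0 b (q l * q l)) = jac_norm N b"
    unfolding jac_norm_def by (rule prod.cong) (simp_all add: q_def)
  moreover have "fdet n (\<lambda>i j. coeff (pcompose (q (N + i)) [:t, 1:]) j) =
     fdet n (\<lambda>i j. coeff (pcompose (monom 1 i * jac N (real i) b) [:t, 1:]) j)"
    by (rule fdet_cong) (simp add: q_def)
  ultimately show ?thesis by simp
qed

text \<open>The value at \<open>0\<close> of \<open>jac N i b\<close>.\<close>

definition jac0 :: "nat \<Rightarrow> real \<Rightarrow> nat \<Rightarrow> real" where
  "jac0 N b i = (-1) ^ N * (fact (N + i) / fact i) / pochhammer (real N + b + real (i + 1)) N"

lemma pochhammer_Suc_fact: "pochhammer (real i + 1) k = fact (i + k) / fact i"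
proof -
  have "pochhammer (1 :: real) (i + k) = pochhammer 1 i * pochhammer (1 + of_nat i) k"
    by (rule pochhammer_product')
  then show ?thesis by (simp add: pochhammer_fact[symmetric] field_simps)
qed

text \<open>Relative to the constant term the coefficient has its hypergeometric form, which
  isolates the dependence on \<open>k\<close>.\<close>

lemma coeff_jac_nat:
  assumes "b > -1" "k \<le> N"
  shows "coeff (jac N (real i) b) k = jac0 N b i * ((-1) ^ k * (real (N choose k) *
     pochhammer (real N + (real i + b + 1)) k) * (fact i / fact (i + k)))"
proof -
  let ?z = "real N + b + real (i + 1)"
  have "?z > 0" using assms by simp
  then have pos: "pochhammer ?z l > 0" for l by (rule pochhammer_pos)
  have 1: "pochhammer ?z N = pochhammer ?z k * pochhammer (?z + real k) (N - k)"
    using pochhammer_product[OF assms(2), of ?z] by simp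
  have 2: "pochhammer (real i + 1) N = pochhammer (real i + 1) k * pochhammer (real i + 1 + real k) (N - k)"
    using pochhammer_product[OF assms(2), of "real i + 1"] by simp
  have sgn: "(-1) ^ (N - k) = (-1) ^ N * ((-1) ^ k :: real)"
    using assms(2) by (simp add: power_diff minus_one_power_iff)
  have a1: "real i + real k + 1 = real i + 1 + real k" by simp
  have a2: "real N + real i + b + 1 + real k = ?z + real k" by simp
  have a3: "real N + (real i + b + 1) = ?z" by simp
  have A: "pochhammer (real i + 1 + real k) (N - k) = fact (N + i) / fact (i + k)"
    using 2 unfolding pochhammer_Suc_fact by (simp add: field_simps)
  have B: "pochhammer (?z + real k) (N - k) = pochhammer ?z N / pochhammer ?z k"
    using 1 pos[of k] by simp
  show ?thesis
    unfolding coeff_jac sgn a1 a2 a3 A B jac0_def by (simp add: field_simps)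
qed

lemma scaled_coeff_eq:
  assumes "N \<ge> 1"
  shows "scaled_coeff \<beta> k N * (real N ^ 2) ^ k = fact k * real (N choose k) * pochhammer (real N + \<beta>) k"
proof -
  have "fact k * real (N choose k) = (\<Prod>l<k. real N - real l)"
    unfolding binomial_gbinomial gbinomial_prod_rev by (simp add: atLeast0LessThan)
  moreover have "pochhammer (real N + \<beta>) k = (\<Prod>l<k. real N + \<beta> + real l)"
    by (simp add: pochhammer_prod atLeast0LessThan)
  moreover have "scaled_coeff \<beta> k N * (real N ^ 2) ^ k =
      (\<Prod>l<k. ((1 - real l / real N) * (1 + (\<beta> + real l) / real N)) * real N ^ 2)"
    unfolding scaled_coeff_def prod.distrib by simp
  moreover have "((1 - real l / real N) * (1 + (\<beta> + real l) / real N)) * real N ^ 2 =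
      (real N - real l) * (real N + \<beta> + real l)" for l
    using assms by (simp add: field_simps power2_eq_square)
  ultimately show ?thesis by (simp add: prod.distrib)
qed

text \<open>The sign \<open>(-1) ^ k\<close> of the coefficient and
  \<open>(-1) ^ (k + i - j)\<close> from the argument \<open>- s\<close> combine to
  \<open>(-1) ^ (i + j)\<close>, and the powers of \<open>N\<^sup>2\<close> balance likewise. So
  whatever is independent of \<open>k\<close> is a row factor times a column factor.\<close>

lemma coeff_pcompose_monom_jac:
  assumes "b > -1" "N \<ge> 1"
  shows "coeff (pcompose (monom 1 i * jac N (real i) b) [:- s, 1:]) j =
     (jac0 N b i * ((-1) ^ i * fact i / (real N ^ 2) ^ i)) * ((-1) ^ j * (real N ^ 2) ^ j / fact j) *
       jacobi_series (real i + b + 1) N i j (real N ^ 2 * s)"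
proof -
  define M where "M = real N ^ 2"
  have M: "M \<noteq> 0" using assms by (simp add: M_def)
  let ?\<beta> = "real i + b + 1"
  have deg: "degree (monom 1 i * jac N (real i) b) = N + i"
    by (simp add: degree_mult_eq jac_nonzero degree_monom_eq degree_jac)
  have "coeff (pcompose (monom 1 i * jac N (real i) b) [:- s, 1:]) j =
      (\<Sum>k\<le>N + i. coeff (monom 1 i * jac N (real i) b) k * (real (k choose j) * (- s) ^ (k - j)))"
    by (rule coeff_pcompose_shift) (simp add: deg)
  also have "\<dots> = (\<Sum>k=i..N + i. coeff (monom 1 i * jac N (real i) b) k * (real (k choose j) * (- s) ^ (k - j)))"
    by (rule sum.mono_neutral_right) (auto simp: coeff_monom_mult)
  also have "\<dots> = (\<Sum>k\<le>N. coeff (jac N (real i) b) k * (real ((k + i) choose j) * (- s) ^ (k + i - j)))"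
    by (intro sum.reindex_bij_witness[of _ "\<lambda>k. k + i" "\<lambda>k. k - i"]) (auto simp: coeff_monom_mult)
  also have "\<dots> = (\<Sum>k\<le>N. (jac0 N b i * ((-1) ^ i * fact i / M ^ i)) * ((-1) ^ j * M ^ j / fact j) *
      (scaled_coeff ?\<beta> k N * bessel_J_term i j k (M * s)))"
  proof (intro sum.cong refl)
    fix k assume "k \<in> {..N}"
    then have k: "k \<le> N" by simp
    show "coeff (jac N (real i) b) k * (real ((k + i) choose j) * (- s) ^ (k + i - j)) =
      (jac0 N b i * ((-1) ^ i * fact i / M ^ i)) * ((-1) ^ j * M ^ j / fact j) * (scaled_coeff ?\<beta> k N * bessel_J_term i j k (M * s))"
    proof (cases "k + i < j")
      case False
      then obtain r where r: "k + i = j + r" using le_Suc_ex not_less by blast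
      have ch: "real ((k + i) choose j) = fact (i + k) / (fact j * fact r)"
        using r by (simp add: binomial_fact add.commute[of i k])
      have R: "real (N choose k) * pochhammer (real N + ?\<beta>) k = scaled_coeff ?\<beta> k N * M ^ k / fact k"
        using scaled_coeff_eq[OF assms(2), of ?\<beta> k] by (simp add: M_def field_simps)
      have sg: "(-1) ^ k * (-1) ^ r = (-1) ^ i * (-1) ^ j * (1 :: real)"
      proof -
        have "(-1 :: real) ^ (k + i) = (-1) ^ (j + r)" using r by simp
        then show ?thesis by (simp add: power_add minus_one_power_iff split: if_splits)
      qed
      have MM: "M ^ k = M ^ j * M ^ r / M ^ i"
      proof -
        have "M ^ k * M ^ i = M ^ j * M ^ r" using r by (simp flip: power_add)
        then show ?thesis using M by (simp add: field_simps)
      qed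
      have "coeff (jac N (real i) b) k * (real ((k + i) choose j) * (- s) ^ (k + i - j)) =
         jac0 N b i * ((-1) ^ k * (scaled_coeff ?\<beta> k N * M ^ k / fact k) * (fact i / fact (i + k))) *
         (fact (i + k) / (fact j * fact r) * ((-1) ^ r * s ^ r))"
        unfolding coeff_jac_nat[OF assms(1) k] R ch using r by (simp add: power_minus[of s])
      also have "\<dots> = jac0 N b i * (((-1) ^ k * (-1) ^ r) * (scaled_coeff ?\<beta> k N * M ^ k / fact k) * fact i) * (1 / (fact j * fact r) * s ^ r)"
        by (simp add: field_simps)
      also have "\<dots> = (jac0 N b i * ((-1) ^ i * fact i / M ^ i)) * ((-1) ^ j * M ^ j / fact j) * (scaled_coeff ?\<beta> k N * bessel_J_term i j k (M * s))"
        unfolding sg MM bessel_J_term_def using r False by (simp add: power_mult_distrib field_simps)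
      finally show ?thesis .
    qed (simp add: bessel_J_term_def binomial_eq_0)
  qed
  also have "\<dots> = (jac0 N b i * ((-1) ^ i * fact i / M ^ i)) * ((-1) ^ j * M ^ j / fact j) * jacobi_series ?\<beta> N i j (M * s)"
    unfolding jacobi_series_def by (simp only: sum_distrib_left)
  finally show ?thesis by (simp only: M_def)
qed

lemma jac0_nonzero: "b > -1 \<Longrightarrow> jac0 N b i \<noteq> 0"
  using pochhammer_pos[of "real N + b + real (i + 1)" N] by (simp add: jac0_def)

lemma fdet_monom_jac_0:
  assumes "b > -1"
  shows "fdet n (\<lambda>i j. coeff (pcompose (monom 1 i * jac N (real i) b) [:0, 1:]) j) = (\<Prod>i<n. jac0 N b i)"
proof -
  have "fdet n (\<lambda>i j. coeff (pcompose (monom 1 i * jac N (real i) b) [:0, 1:]) j) =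
    (\<Prod>i<n. coeff (monom 1 i * jac N (real i) b) i)"
    by (subst fdet_upper_triangular) (simp_all add: coeff_monom_mult)
  also have "\<dots> = (\<Prod>i<n. jac0 N b i)"
    using coeff_jac_nat[OF assms, of 0 N] by (intro prod.cong) (simp_all add: coeff_monom_mult)
  finally show ?thesis .
qed

text \<open>The row and column factors other than \<open>jac0\<close> have product \<open>1\<close>,
  and the product of the \<open>jac0\<close> is the determinant at \<open>t = 0\<close>; all
  normalisations cancel in the ratio.\<close>

lemma jac_hankel_ratio_jacobi_series:
  assumes "b > -1" "N \<ge> 1"
  shows "jac_hankel N n b (- s) / jac_hankel N n b 0 =
     fdet n (\<lambda>i j. jacobi_series (real i + b + 1) N i j (real N ^ 2 * s))"
proof -
  define M where "M = real N ^ 2"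
  have M: "M \<noteq> 0" using assms by (simp add: M_def)
  have "(\<Prod>i<n. (-1) ^ i * fact i / M ^ i) * (\<Prod>j<n. (-1) ^ j * M ^ j / fact j) =
     (\<Prod>i<n. ((-1) ^ i * fact i / M ^ i) * ((-1) ^ i * M ^ i / fact i))"
    by (simp only: prod.distrib)
  also have "\<dots> = 1"
    using M by (intro prod.neutral) (auto simp: minus_one_power_iff)
  finally have one: "(\<Prod>i<n. (-1) ^ i * fact i / M ^ i) * (\<Prod>j<n. (-1) ^ j * M ^ j / fact j) = 1" .
  have "fdet n (\<lambda>i j. coeff (pcompose (monom 1 i * jac N (real i) b) [:- s, 1:]) j) =
     (\<Prod>i<n. jac0 N b i * ((-1) ^ i * fact i / M ^ i)) * (\<Prod>j<n. (-1) ^ j * M ^ j / fact j) *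
     fdet n (\<lambda>i j. jacobi_series (real i + b + 1) N i j (M * s))"
    unfolding M_def coeff_pcompose_monom_jac[OF assms] by (rule fdet_scale)
  also have "\<dots> = (\<Prod>i<n. jac0 N b i) * fdet n (\<lambda>i j. jacobi_series (real i + b + 1) N i j (M * s))"
    unfolding prod.distrib[of "jac0 N b"] using one by (simp add: mult.assoc)
  finally have "jac_hankel N n b (- s) = (-1) ^ (N * n) * jac_norm N b *
     ((\<Prod>i<n. jac0 N b i) * fdet n (\<lambda>i j. jacobi_series (real i + b + 1) N i j (M * s)))"
    unfolding jac_hankel_eq_monom_jac[OF assms(1)] by (simp only:)
  moreover have "jac_hankel N n b 0 = (-1) ^ (N * n) * jac_norm N b * (\<Prod>i<n. jac0 N b i)"
    unfolding jac_hankel_eq_monom_jac[OF assms(1)] fdet_monom_jac_0[OF assms(1)] ..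
  ultimately show ?thesis
    using jac_norm_pos[OF assms(1), of N] jac0_nonzero[OF assms(1), of N] by (simp add: M_def)
qed

lemma jac_hankel_nonzero:
  assumes "b > -1"
  shows "jac_hankel N n b 0 \<noteq> 0"
  unfolding jac_hankel_eq_monom_jac[OF assms] fdet_monom_jac_0[OF assms]
  using jac_norm_pos[OF assms, of N] jac0_nonzero[OF assms, of N] by simp

text \<open>The numerator is evaluated with the orthogonal polynomials, the denominator with the
  other basis, whose matrix is triangular at \<open>t = 0\<close>.\<close>

lemma jac_hankel_ratio_det:
  assumes "b > -1"
  shows "jac_hankel N n b t / jac_hankel N n b 0 =
     (-1) ^ (N * n) * (\<Prod>i=1..n. pochhammer (real N + b + real i) N) *
     det\<^sub>1 n (\<lambda>i j. jacobi_entry (int N + int i - int j) (real j - 1) (b + real j - 1) t)"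
proof -
  define E where "E = (\<lambda>i j. jacobi_entry (int N + int i - int j) (real j) (b + real j) t)"
  have E: "det\<^sub>1 n (\<lambda>i j. jacobi_entry (int N + int i - int j) (real j - 1) (b + real j - 1) t) = fdet n E"
    unfolding det\<^sub>1_def fdet_def E_def by (simp add: add.commute add_diff_eq)
  have poch: "pochhammer (real N + b + real (i + 1)) N \<noteq> 0" for i
    using pochhammer_pos[of "real N + b + real (i + 1)" N] assms by simp
  have "fdet n (\<lambda>i j. coeff (pcompose (jac (N + i) 0 b) [:t, 1:]) j) =
     (\<Prod>i<n. fact (N + i)) * (\<Prod>j<n. inverse (fact j)) * fdet n E"
    unfolding coeff_pcompose_jac_entry[OF assms] E_def by (rule fdet_scale)
  \<comment> \<open>The definition of \<open>jac0\<close> solved for the factorials; it produces the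
    Pochhammer symbols and the sign of the final formula.\<close>
  also have "(\<Prod>i<n. fact (N + i)) * (\<Prod>j<n. inverse (fact j)) =
      (\<Prod>i<n. jac0 N b i * ((-1) ^ N * pochhammer (real N + b + real (i + 1)) N) :: real)"
    unfolding prod.distrib[symmetric]
    by (intro prod.cong refl) (use poch in \<open>auto simp: jac0_def minus_one_power_iff field_simps\<close>)
  also have "\<dots> = (\<Prod>i<n. jac0 N b i) * ((-1) ^ (N * n) * (\<Prod>i<n. pochhammer (real N + b + real (i + 1)) N))"
    by (simp add: prod.distrib power_mult)
  also have "(\<Prod>i<n. pochhammer (real N + b + real (i + 1)) N) = (\<Prod>i=1..n. pochhammer (real N + b + real i) N)"
    by (rule prod.reindex_bij_witness[of _ "\<lambda>i. i - 1" "\<lambda>i. i + 1"]) auto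
  finally have "jac_hankel N n b t = (-1) ^ (N * n) * jac_norm N b * ((\<Prod>i<n. jac0 N b i) *
      ((-1) ^ (N * n) * (\<Prod>i=1..n. pochhammer (real N + b + real i) N)) * fdet n E)"
    unfolding jac_hankel_eq_jac[OF assms] by (simp only:)
  moreover have "jac_hankel N n b 0 = (-1) ^ (N * n) * jac_norm N b * (\<Prod>i<n. jac0 N b i)"
    unfolding jac_hankel_eq_monom_jac[OF assms] fdet_monom_jac_0[OF assms] ..
  ultimately show ?thesis
    unfolding E
    using jac_norm_pos[OF assms, of N] jac0_nonzero[OF assms, of N] by simp
qed

section \<open>The distribution of the smallest eigenvalue\<close>

text \<open>The squared Vandermonde product is written with monomials in one factor and monic
  polynomials \<open>q\<close> in the other, which prepares Andreief's identity. The freedom in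
  \<open>q\<close> is used to follow the change of variables.\<close>

lemma gap_integral:
  fixes w :: "real \<Rightarrow> real" and q :: "nat \<Rightarrow> real poly"
  assumes int: "\<And>p. integrable lborel (\<lambda>x. w x * poly p x)"
    and q: "\<And>k. k < N \<Longrightarrow> degree (q k) = k" "\<And>k. k < N \<Longrightarrow> lead_coeff (q k) = 1"
  defines "F \<equiv> (\<lambda>x. (\<Prod>i<N. w (x i)) * (\<Prod>j<N. \<Prod>i<j. \<bar>x j - x i\<bar> ^ 2))"
  shows "integrable (PiM {..<N} (\<lambda>_. lborel)) F"
    and "integral\<^sup>L (PiM {..<N} (\<lambda>_. lborel)) F =
           fact N * fdet N (\<lambda>k l. LINT x|lborel. w x * (x ^ k * poly (q l) x))"
proof -
  have F: "F = (\<lambda>x. (\<Prod>i<N. w (x i)) * (fdet N (\<lambda>i k. x i ^ k) * fdet N (\<lambda>i l. poly (q l) (x i))))"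
  proof
    fix x
    have q': "fdet N (\<lambda>i l. poly (q l) (x i)) = fdet N (\<lambda>i k. x i ^ k)"
      by (rule fdet_monic_polys) (use q in auto)
    have "fdet N (\<lambda>i k. x i ^ k) * fdet N (\<lambda>i l. poly (q l) (x i)) = (\<Prod>j<N. \<Prod>i<j. \<bar>x j - x i\<bar> ^ 2)"
      unfolding q' fdet_vandermonde
      by (simp add: prod.distrib[symmetric] power2_eq_square)
    then show "F x = (\<Prod>i<N. w (x i)) * (fdet N (\<lambda>i k. x i ^ k) * fdet N (\<lambda>i l. poly (q l) (x i)))"
      by (simp add: F_def)
  qed
  have int': "integrable lborel (\<lambda>x. w x * (x ^ k * poly (q l) x))" for k l
    using int[of "monom 1 k * q l"] by (simp add: poly_monom)
  show "integrable (PiM {..<N} (\<lambda>_. lborel)) F"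
    unfolding F by (rule andreief(1)[where f = "\<lambda>k x. x ^ k" and g = "\<lambda>l. poly (q l)"]) (rule int')
  show "integral\<^sup>L (PiM {..<N} (\<lambda>_. lborel)) F =
           fact N * fdet N (\<lambda>k l. LINT x|lborel. w x * (x ^ k * poly (q l) x))"
    unfolding F by (rule andreief(2)[where f = "\<lambda>k x. x ^ k" and g = "\<lambda>l. poly (q l)"]) (rule int')
qed

lemma gap_integral_full:
  fixes b :: real and n N :: nat
  assumes "b > -1"
  defines "F \<equiv> (\<lambda>x. (\<Prod>i<N. jacobi_w (real n) b (x i)) * (\<Prod>j<N. \<Prod>i<j. \<bar>x j - x i\<bar> ^ 2))"
  shows "integrable (PiM {..<N} (\<lambda>_. lborel)) F"
    and "integral\<^sup>L (PiM {..<N} (\<lambda>_. lborel)) F = fact N * jac_hankel N n b 0"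
proof -
  have int: "integrable lborel (\<lambda>x. jacobi_w (real n) b x * poly p x)" for p
    by (rule integrable_jacobi_w_poly) (use assms in auto)
  note gi = gap_integral[of "jacobi_w (real n) b" N "\<lambda>l. jac l 0 b", OF int]
  show "integrable (PiM {..<N} (\<lambda>_. lborel)) F"
    unfolding F_def by (rule gi(1)) (simp_all add: degree_jac lead_coeff_jac[unfolded degree_jac])
  have entry: "(LINT x|lborel. jacobi_w (real n) b x * (x ^ k * poly (jac l 0 b) x)) =
      jacobi_L 0 b ([:- 0, 1:] ^ (n + k) * jac l 0 b)" for k l
  proof -
    have "jacobi_L 0 b ([:- 0, 1:] ^ (n + k) * jac l 0 b) =
        jacobi_L 0 b (monom 1 n * (monom 1 k * jac l 0 b))"
      by (simp add: power_add monom_altdef mult.assoc)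
    also have "\<dots> = jacobi_L (real n) b (monom 1 k * jac l 0 b)"
      by (simp add: jacobi_L_monom_mult)
    finally show ?thesis by (simp add: jacobi_L_def poly_monom)
  qed
  have "integral\<^sup>L (PiM {..<N} (\<lambda>_. lborel)) F =
      fact N * fdet N (\<lambda>k l. LINT x|lborel. jacobi_w (real n) b x * (x ^ k * poly (jac l 0 b) x))"
    unfolding F_def by (rule gi(2)) (simp_all add: degree_jac lead_coeff_jac[unfolded degree_jac])
  also have "\<dots> = fact N * jac_hankel N n b 0"
    unfolding entry jac_hankel_def by simp
  finally show "integral\<^sup>L (PiM {..<N} (\<lambda>_. lborel)) F = fact N * jac_hankel N n b 0" .
qed

definition tail_w :: "nat \<Rightarrow> real \<Rightarrow> real \<Rightarrow> real \<Rightarrow> real" where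
  "tail_w n b \<xi> x = indicator {\<xi><..} x * jacobi_w (real n) b x"

text \<open>With \<open>t = - \<xi> / (1 - \<xi>)\<close> the substitution reads
  \<open>x = (1 - \<xi>) (y - t)\<close>, so that \<open>x ^ n\<close> becomes a shifted power and
  \<open>1 - x\<close> keeps its form.\<close>

lemma tail_w_affine:
  assumes "0 < \<xi>" "\<xi> < 1"
  shows "tail_w n b \<xi> (\<xi> + (1 - \<xi>) * y) =
     (1 - \<xi>) powr (real n + b) * (jacobi_w 0 b y * (y + \<xi> / (1 - \<xi>)) ^ n)"
proof (cases "0 < y \<and> y \<le> 1")
  case True
  define c where "c = 1 - \<xi>"
  have c: "c > 0" using assms by (simp add: c_def)
  have x: "\<xi> + c * y = c * (y + \<xi> / c)" and x1: "1 - (\<xi> + c * y) = c * (1 - y)"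
    using c by (simp_all add: field_simps c_def)
  have "c * y > 0" using True c by simp
  moreover have "c * y \<le> c" using True c mult_left_mono[of y 1 c] by simp
  ultimately have "\<xi> < \<xi> + c * y" "0 \<le> \<xi> + c * y" "\<xi> + c * y \<le> 1"
    using assms c_def by linarith+
  then have "tail_w n b \<xi> (\<xi> + c * y) = (\<xi> + c * y) powr real n * (1 - (\<xi> + c * y)) powr b"
    by (simp add: tail_w_def jacobi_w_def)
  also have "\<dots> = (c * (y + \<xi> / c)) ^ n * (c * (1 - y)) powr b"
    unfolding x1 unfolding x
    using True assms c by (subst powr_realpow) (auto intro!: mult_pos_pos add_pos_pos)
  also have "\<dots> = (c ^ n * c powr b) * ((1 - y) powr b * (y + \<xi> / c) ^ n)"
    using True c by (simp add: power_mult_distrib powr_mult)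
  also have "c ^ n * c powr b = c powr (real n + b)"
    using c by (simp add: powr_add powr_realpow)
  also have "(1 - y) powr b = jacobi_w 0 b y"
    using True by (simp add: jacobi_w_def)
  finally show ?thesis unfolding c_def .
next
  case False
  consider "y \<le> 0" | "y > 1" using False by linarith
  then have "\<xi> + (1 - \<xi>) * y \<le> \<xi> \<or> \<xi> + (1 - \<xi>) * y > 1"
  proof cases
    case 1
    then show ?thesis using assms by (simp add: mult_nonneg_nonpos)
  next
    case 2
    define z where "z = (1 - \<xi>) * y"
    have "(1 - \<xi>) * 1 < z" unfolding z_def using 2 assms by (intro mult_strict_left_mono) auto
    then have "1 - \<xi> < z" by (simp only: mult_1_right)
    then have "1 < \<xi> + z" by (simp add: algebra_simps)
    then show ?thesis unfolding z_def ..
  qed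
  then have "tail_w n b \<xi> (\<xi> + (1 - \<xi>) * y) = 0"
    by (auto simp: tail_w_def jacobi_w_def)
  \<comment> \<open>At \<open>y = 0\<close> the weight vanishes by \<open>0 powr 0 = 0\<close>, in
    agreement with the open lower end of \<open>tail_w\<close>.\<close>
  moreover have "jacobi_w 0 b y = 0"
    using False by (cases "y = 0") (auto simp: jacobi_w_def)
  ultimately show ?thesis by simp
qed

lemma integrable_tail_w:
  assumes "b > -1"
  shows "integrable lborel (\<lambda>x. tail_w n b \<xi> x * poly p x)"
proof -
  have "integrable lborel (\<lambda>x. indicator {\<xi><..} x *\<^sub>R (jacobi_w (real n) b x * poly p x))"
    by (intro integrable_mult_indicator integrable_jacobi_w_poly) (use assms in auto)
  then show ?thesis by (simp add: tail_w_def mult.assoc)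
qed

text \<open>Entry \<open>(k, l)\<close> scales by \<open>1 - \<xi>\<close> to the power
  \<open>1 + n + b + k + l\<close>: one from the substitution, \<open>n + b\<close> from the weight,
  \<open>k\<close> and \<open>l\<close> from the polynomials. In the determinant this adds up to
  \<open>N (1 + n + b) + N (N - 1)\<close>.\<close>

lemma gap_integral_tail:
  fixes b \<xi> :: real and n N :: nat
  assumes "b > -1" "0 < \<xi>" "\<xi> < 1"
  defines "F \<equiv> (\<lambda>x. (\<Prod>i<N. tail_w n b \<xi> (x i)) * (\<Prod>j<N. \<Prod>i<j. \<bar>x j - x i\<bar> ^ 2))"
  shows "integrable (PiM {..<N} (\<lambda>_. lborel)) F"
    and "integral\<^sup>L (PiM {..<N} (\<lambda>_. lborel)) F =
      (1 - \<xi>) powr (real N * (real n + b + real N)) * (fact N * jac_hankel N n b (- \<xi> / (1 - \<xi>)))"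
proof -
  define c where "c = 1 - \<xi>"
  have c: "c > 0" using assms by (simp add: c_def)
  define s where "s = \<xi> / c"
  \<comment> \<open>The orthogonal polynomials transported by \<open>y = x / c - s\<close> and
    rescaled to be monic.\<close>
  define q where "q l = Polynomial.smult (c ^ l) (pcompose (jac l 0 b) [:- s, 1 / c:])" for l
  have deg: "degree (q l) = l" for l
    using c by (simp add: q_def degree_jac)
  have monic: "lead_coeff (q l) = 1" for l
  proof -
    have "lead_coeff (pcompose (jac l 0 b) [:- s, 1 / c:]) = (1 / c) ^ l"
      using c by (subst lead_coeff_comp) (simp_all add: lead_coeff_jac[unfolded degree_jac] degree_jac)
    then show ?thesis using c by (simp add: q_def power_divide)
  qed
  have q: "poly (q l) (\<xi> + c * y) = c ^ l * poly (jac l 0 b) y" for l y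
  proof -
    have "- s + (\<xi> + c * y) * (1 / c) = y" using c by (simp add: s_def field_simps)
    then show ?thesis by (simp add: q_def poly_pcompose)
  qed
  note gi = gap_integral[of "tail_w n b \<xi>" N q, OF integrable_tail_w[OF assms(1)] deg]
  show "integrable (PiM {..<N} (\<lambda>_. lborel)) F"
    unfolding F_def by (rule gi(1)) (rule monic)
  have entry: "(LINT x|lborel. tail_w n b \<xi> x * (x ^ k * poly (q l) x)) =
      (c powr (1 + real n + b) * c ^ k) * c ^ l * jacobi_L 0 b ([:- (- s), 1:] ^ (n + k) * jac l 0 b)" for k l
  proof -
    have x: "\<xi> + c * y = c * (y + s)" for y using c by (simp add: s_def field_simps)
    have "(LINT x|lborel. tail_w n b \<xi> x * (x ^ k * poly (q l) x)) =
       c * (LINT y|lborel. tail_w n b \<xi> (\<xi> + c * y) * ((\<xi> + c * y) ^ k * poly (q l) (\<xi> + c * y)))"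
      using c lborel_integral_real_affine[of c "\<lambda>x. tail_w n b \<xi> x * (x ^ k * poly (q l) x)" \<xi>] by simp
    also have "(\<lambda>y. tail_w n b \<xi> (\<xi> + c * y) * ((\<xi> + c * y) ^ k * poly (q l) (\<xi> + c * y))) =
       (\<lambda>y. (c powr (real n + b) * c ^ k * c ^ l) * (jacobi_w 0 b y * poly ([:- (- s), 1:] ^ (n + k) * jac l 0 b) y))"
    proof
      fix y
      have g: "tail_w n b \<xi> (\<xi> + c * y) = c powr (real n + b) * (jacobi_w 0 b y * (y + s) ^ n)"
        using tail_w_affine[OF assms(2,3), of n b y] by (simp add: c_def s_def)
      have p: "(\<xi> + c * y) ^ k = c ^ k * (y + s) ^ k" unfolding x by (rule power_mult_distrib)
      have r: "poly ([:- (- s), 1:] ^ (n + k) * jac l 0 b) y = (y + s) ^ n * (y + s) ^ k * poly (jac l 0 b) y"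
        by (simp add: power_add add.commute)
      show "tail_w n b \<xi> (\<xi> + c * y) * ((\<xi> + c * y) ^ k * poly (q l) (\<xi> + c * y)) =
        (c powr (real n + b) * c ^ k * c ^ l) * (jacobi_w 0 b y * poly ([:- (- s), 1:] ^ (n + k) * jac l 0 b) y)"
        unfolding g p q r by (simp only: mult_ac)
    qed
    also have "c * (LINT y|lborel. (c powr (real n + b) * c ^ k * c ^ l) * (jacobi_w 0 b y * poly ([:- (- s), 1:] ^ (n + k) * jac l 0 b) y)) =
       (c * c powr (real n + b)) * c ^ k * c ^ l * jacobi_L 0 b ([:- (- s), 1:] ^ (n + k) * jac l 0 b)"
      unfolding jacobi_L_def by (subst integral_mult_right_zero) (simp only: mult_ac)
    also have "c * c powr (real n + b) = c powr (1 + real n + b)"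
      using c by (simp add: powr_add add.assoc)
    finally show ?thesis .
  qed
  have "integral\<^sup>L (PiM {..<N} (\<lambda>_. lborel)) F =
      fact N * fdet N (\<lambda>k l. LINT x|lborel. tail_w n b \<xi> x * (x ^ k * poly (q l) x))"
    unfolding F_def by (rule gi(2)) (rule monic)
  also have "fdet N (\<lambda>k l. LINT x|lborel. tail_w n b \<xi> x * (x ^ k * poly (q l) x)) =
      fdet N (\<lambda>k l. (c powr (1 + real n + b) * c ^ k) * c ^ l * jacobi_L 0 b ([:- (- s), 1:] ^ (n + k) * jac l 0 b))"
    by (simp only: entry)
  also have "fdet N (\<lambda>k l. (c powr (1 + real n + b) * c ^ k) * c ^ l * jacobi_L 0 b ([:- (- s), 1:] ^ (n + k) * jac l 0 b)) =
     (\<Prod>k<N. c powr (1 + real n + b) * c ^ k) * (\<Prod>l<N. c ^ l) * jac_hankel N n b (- s)"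
    unfolding jac_hankel_def by (rule fdet_scale)
  also have "(\<Prod>k<N. c powr (1 + real n + b) * c ^ k) * (\<Prod>l<N. c ^ l) = c powr (real N * (real n + b + real N))"
  proof (induction N)
    case (Suc N)
    define d where "d = c powr (1 + real n + b)"
    have e: "real (Suc N) * (real n + b + real (Suc N)) =
        real N * (real n + b + real N) + (1 + real n + b) + (real N + real N)"
      by (simp add: algebra_simps)
    have "c powr (real (Suc N) * (real n + b + real (Suc N))) =
        c powr (real N * (real n + b + real N)) * d * (c ^ N * c ^ N)"
      unfolding e d_def powr_add[of c "real N * (real n + b + real N) + (1 + real n + b)"]
        powr_add[of c "real N * (real n + b + real N)"] powr_add[of c "real N" "real N"]
      using c by (simp only: powr_realpow)
    then show ?case
      using Suc unfolding d_def[symmetric] prod.lessThan_Suc by (simp only: mult_ac)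
  qed (use c in simp)
  finally show "integral\<^sup>L (PiM {..<N} (\<lambda>_. lborel)) F =
      (1 - \<xi>) powr (real N * (real n + b + real N)) * (fact N * jac_hankel N n b (- \<xi> / (1 - \<xi>)))"
    by (simp add: c_def s_def mult_ac)
qed

section \<open>From integrals to probabilities\<close>

lemma borel_measurable_smallest_eigenvalue:
  assumes "N \<ge> 1"
  shows "smallest_eigenvalue N \<in> borel_measurable (PiM {..<N} (\<lambda>_. lborel))"
proof (rule borel_measurableI_greater)
  fix y :: real
  have ne: "x ` {..<N} \<noteq> {}" for x :: "nat \<Rightarrow> real" using assms by (auto simp: lessThan_empty_iff)
  have "{x \<in> space (PiM {..<N} (\<lambda>_. lborel)). y < smallest_eigenvalue N x} =
      {x \<in> space (PiM {..<N} (\<lambda>_. lborel)). \<forall>i\<in>{..<N}. y < x i}"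
    unfolding smallest_eigenvalue_def Min_gr_iff[OF finite_imageI[OF finite_lessThan] ne] by auto
  also have "\<dots> \<in> sets (PiM {..<N} (\<lambda>_. lborel))"
    by measurable
  finally show "{x \<in> space (PiM {..<N} (\<lambda>_. lborel)). y < smallest_eigenvalue N x} \<in> sets (PiM {..<N} (\<lambda>_. lborel))" .
qed

text \<open>Points of the product space are extensional, so membership in the cube is a condition on
  the coordinates alone and its indicator factorises.\<close>

lemma jacobi_weight_eq:
  assumes "x \<in> space (PiM {..<N} (\<lambda>_. lborel :: real measure))"
  shows "jacobi_weight N a b x = (\<Prod>i<N. jacobi_w a b (x i)) * (\<Prod>j<N. \<Prod>i<j. \<bar>x j - x i\<bar> ^ 2)"
proof -
  have "indicator (PiE {..<N} (\<lambda>_. {0..1::real})) x = (\<Prod>i<N. indicator {0..1} (x i) :: real)"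
  proof (cases "\<forall>i<N. x i \<in> {0..1}")
    case True
    then have "x \<in> PiE {..<N} (\<lambda>_. {0..1})" using assms by (auto simp: space_PiM PiE_iff)
    then show ?thesis using True by (simp add: prod.neutral)
  next
    case False
    then obtain i where i: "i < N" "x i \<notin> {0..1}" by blast
    then have "(\<Prod>i<N. indicator {0..1} (x i) :: real) = 0"
      by (intro prod_zero) (auto intro!: bexI[of _ i])
    moreover have "x \<notin> PiE {..<N} (\<lambda>_. {0..1})"
    proof
      assume "x \<in> PiE {..<N} (\<lambda>_. {0..1})"
      from PiE_mem[OF this, of i] i show False by simp
    qed
    ultimately show ?thesis by simp
  qed
  then show ?thesis
    unfolding jacobi_weight_def jacobi_w_def by (simp add: prod.distrib)
qed

text \<open>The complementary event, that all coordinates exceed \<open>\<xi>\<close>, has as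
  probability the tail integral divided by the normalising constant; the factors \<open>N!\<close>
  cancel.\<close>

lemma F_smallest_eq:
  assumes "b > -1" "N \<ge> 1" "0 < \<xi>" "\<xi> < 1"
  shows "F_smallest N (real n) b \<xi> = 1 - (1 - \<xi>) powr (real N * (real n + b + real N)) *
     (jac_hankel N n b (- \<xi> / (1 - \<xi>)) / jac_hankel N n b 0)"
proof -
  define L where "L = PiM {..<N} (\<lambda>_. lborel :: real measure)"
  define W where "W = jacobi_weight N (real n) b"
  define Z where "Z = integral\<^sup>L L W"
  define D where "D = jacobi_ensemble N (real n) b"
  let ?V = "\<lambda>x::nat \<Rightarrow> real. \<Prod>j<N. \<Prod>i<j. \<bar>x j - x i\<bar> ^ 2"
  have W: "W x = (\<Prod>i<N. jacobi_w (real n) b (x i)) * ?V x" if "x \<in> space L" for x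
    using jacobi_weight_eq that by (simp add: W_def L_def)
  have intW: "integrable L W"
    using gap_integral_full(1)[OF assms(1), of N n, folded L_def]
    by (rule Bochner_Integration.integrable_cong[THEN iffD1, rotated -1]) (simp_all add: W)
  have W0: "W x \<ge> 0" for x
    unfolding W_def jacobi_weight_def by (intro mult_nonneg_nonneg prod_nonneg) auto
  have Z: "Z = fact N * jac_hankel N n b 0"
    unfolding Z_def using gap_integral_full(2)[OF assms(1), of N n, folded L_def]
    by (subst Bochner_Integration.integral_cong[OF refl W]) simp_all
  \<comment> \<open>Nonnegativity comes from the integrand, nonvanishing from the explicit value at
    \<open>t = 0\<close>; together they make \<open>D\<close> a probability measure.\<close>
  have "Z \<ge> 0" unfolding Z_def by (intro integral_nonneg_AE AE_I2 W0)
  moreover have "Z \<noteq> 0" using jac_hankel_nonzero[OF assms(1), of N n] by (simp add: Z)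
  ultimately have Zpos: "Z > 0" by simp
  have D: "D = density L (\<lambda>x. ennreal (W x / Z))"
    by (simp add: D_def jacobi_ensemble_def L_def W_def Z_def Let_def)
  have [measurable]: "W \<in> borel_measurable L" using intW by (rule borel_measurable_integrable)
  have sets_D [measurable_cong, simp]: "sets D = sets L" and space_D [simp]: "space D = space L"
    by (simp_all add: D)
  have em: "emeasure D A = ennreal (LINT x|L. W x / Z * indicator A x)" if A: "A \<in> sets L" for A
  proof -
    have "emeasure D A = (\<integral>\<^sup>+x. ennreal (W x / Z) * indicator A x \<partial>L)"
      unfolding D using A by (subst emeasure_density) auto
    also have "\<dots> = (\<integral>\<^sup>+x. ennreal (W x / Z * indicator A x) \<partial>L)"
      by (intro nn_integral_cong) (simp add: indicator_def)
    also have "\<dots> = ennreal (LINT x|L. W x / Z * indicator A x)"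
    proof (rule nn_integral_eq_integral)
      show "integrable L (\<lambda>x. W x / Z * indicator A x)"
        using integrable_real_mult_indicator[OF A, of "\<lambda>x. W x / Z"] intW by simp
      show "AE x in L. 0 \<le> W x / Z * indicator A x"
        using W0 Zpos by (intro AE_I2) simp
    qed
    finally show ?thesis .
  qed
  have "emeasure D (space L) = ennreal (LINT x|L. W x / Z)"
    unfolding em[OF sets.top] by (intro arg_cong[where f = ennreal] Bochner_Integration.integral_cong) auto
  also have "(LINT x|L. W x / Z) = 1"
    using Zpos by (simp add: Z_def[symmetric])
  finally have "prob_space D" by (intro prob_spaceI) simp
  then interpret D: prob_space D .
  define S where "S = smallest_eigenvalue N"
  have [measurable]: "S \<in> borel_measurable L"
    unfolding S_def L_def by (rule borel_measurable_smallest_eigenvalue[OF assms(2)])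
  have SD: "S \<in> borel_measurable D" by measurable
  have ne: "x ` {..<N} \<noteq> {}" for x :: "nat \<Rightarrow> real" using assms(2) by (auto simp: lessThan_empty_iff)
  have S: "\<xi> < S x \<longleftrightarrow> (\<forall>i<N. \<xi> < x i)" for x
    unfolding S_def smallest_eigenvalue_def Min_gr_iff[OF finite_imageI[OF finite_lessThan] ne] by auto
  define A where "A = {x \<in> space L. \<xi> < S x}"
  have A: "A \<in> sets L" unfolding A_def by measurable
  have "F_smallest N (real n) b \<xi> = measure D (S -` {..\<xi>} \<inter> space D)"
    unfolding F_smallest_def cdf_def D_def[symmetric] S_def[symmetric]
    by (rule measure_distr[OF SD]) simp
  also have "S -` {..\<xi>} \<inter> space D = space D - A" by (auto simp: A_def)
  also have "measure D (space D - A) = 1 - measure D A"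
    using A by (intro D.prob_compl) simp
  also have "measure D A = (LINT x|L. W x / Z * indicator A x)"
    unfolding measure_def em[OF A]
    by (intro enn2real_ennreal integral_nonneg_AE AE_I2) (use W0 Zpos in simp)
  also have "\<dots> = (LINT x|L. ((\<Prod>i<N. tail_w n b \<xi> (x i)) * ?V x) / Z)"
  proof (intro Bochner_Integration.integral_cong refl)
    fix x assume x: "x \<in> space L"
    have "indicator A x = (\<Prod>i<N. indicator {\<xi><..} (x i) :: real)"
    proof (cases "\<forall>i<N. \<xi> < x i")
      case True
      then have "x \<in> A"
        using x by (simp add: A_def S)
      then show ?thesis using True by (simp add: prod.neutral)
    next
      case False
      then obtain i where i: "i < N" "\<not> \<xi> < x i" by blast
      then have "(\<Prod>i<N. indicator {\<xi><..} (x i) :: real) = 0"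
        by (intro prod_zero) (auto intro!: bexI[of _ i])
      moreover have "x \<notin> A"
        using i by (auto simp: A_def S)
      ultimately show ?thesis by simp
    qed
    then show "W x / Z * indicator A x = ((\<Prod>i<N. tail_w n b \<xi> (x i)) * ?V x) / Z"
      unfolding W[OF x] tail_w_def prod.distrib by simp
  qed
  also have "\<dots> = (1 - \<xi>) powr (real N * (real n + b + real N)) * (fact N * jac_hankel N n b (- \<xi> / (1 - \<xi>))) / Z"
    using gap_integral_tail(2)[OF assms(1,3,4), of N n, folded L_def] by simp
  finally show ?thesis by (simp add: Z)
qed

lemma F_scaled_smallest_eq:
  assumes "N \<ge> 1"
  shows "F_scaled_smallest N a b x = F_smallest N a b (x / real N ^ 2)"
proof -
  define D where "D = jacobi_ensemble N a b"
  have sets_D: "sets D = sets (PiM {..<N} (\<lambda>_. lborel))"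
    by (simp add: D_def jacobi_ensemble_def Let_def)
  have S [measurable]: "smallest_eigenvalue N \<in> borel_measurable D"
    using borel_measurable_smallest_eigenvalue[OF assms] measurable_cong_sets[OF sets_D refl] by blast
  have "(\<lambda>x. real N ^ 2 * smallest_eigenvalue N x) -` {..x} = smallest_eigenvalue N -` {..x / real N ^ 2}"
    using assms by (auto simp: field_simps)
  then show ?thesis
    unfolding F_scaled_smallest_def F_smallest_def cdf_def D_def[symmetric]
    by (simp add: measure_distr)
qed

theorem proposition6p3:
  fixes \<alpha>\<^sub>1 :: nat and \<alpha>\<^sub>2 :: real
  assumes "\<alpha>\<^sub>2 > -1"
  shows
    "(\<forall>N \<xi>. N \<ge> 1 \<and> 0 < \<xi> \<and> \<xi> < 1 \<longrightarrow>
        F_smallest N (real \<alpha>\<^sub>1) \<alpha>\<^sub>2 \<xi> =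
          1 - (-1) ^ (N * \<alpha>\<^sub>1) * (\<Prod>i=1..\<alpha>\<^sub>1. pochhammer (real N + \<alpha>\<^sub>2 + real i) N) *
              (1 - \<xi>) powr (real N * (real \<alpha>\<^sub>1 + \<alpha>\<^sub>2 + real N)) *
              det\<^sub>1 \<alpha>\<^sub>1 (\<lambda>i j. jacobi_entry (int N + int i - int j) (real j - 1) (\<alpha>\<^sub>2 + real j - 1)
                                (- \<xi> / (1 - \<xi>)))) \<and>
     (\<forall>x::real. x > 0 \<longrightarrow>
        (\<lambda>N::nat. F_scaled_smallest N (real \<alpha>\<^sub>1) \<alpha>\<^sub>2 x -
            (1 - exp (- x) * det\<^sub>1 \<alpha>\<^sub>1 (\<lambda>i j. bessel_I (real j - real i) (2 * sqrt x)) +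
             x / real N * (real \<alpha>\<^sub>1 + \<alpha>\<^sub>2) * exp (- x) *
               det\<^sub>1 \<alpha>\<^sub>1 (\<lambda>i j. bessel_I (2 + real j - real i) (2 * sqrt x))))
        \<in> O(\<lambda>N. 1 / real N ^ 2))"
proof (intro conjI allI impI)
  fix N :: nat and \<xi> :: real
  assume *: "N \<ge> 1 \<and> 0 < \<xi> \<and> \<xi> < 1"
  show "F_smallest N (real \<alpha>\<^sub>1) \<alpha>\<^sub>2 \<xi> =
          1 - (-1) ^ (N * \<alpha>\<^sub>1) * (\<Prod>i=1..\<alpha>\<^sub>1. pochhammer (real N + \<alpha>\<^sub>2 + real i) N) *
              (1 - \<xi>) powr (real N * (real \<alpha>\<^sub>1 + \<alpha>\<^sub>2 + real N)) *
              det\<^sub>1 \<alpha>\<^sub>1 (\<lambda>i j. jacobi_entry (int N + int i - int j) (real j - 1) (\<alpha>\<^sub>2 + real j - 1)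
                                (- \<xi> / (1 - \<xi>)))"
    using F_smallest_eq[OF assms, of N \<xi> \<alpha>\<^sub>1] * unfolding jac_hankel_ratio_det[OF assms]
    by (simp add: mult_ac)
next
  fix x :: real
  assume x: "x > 0"
  define n b where "n = \<alpha>\<^sub>1" and "b = \<alpha>\<^sub>2"
  \<comment> \<open>Once \<open>x / N\<^sup>2 < 1\<close>, this is the probability that the rescaled
    smallest eigenvalue exceeds \<open>x\<close>.\<close>
  define G where "G N = (1 - x / real N ^ 2) powr (real N * (real n + b + real N)) *
      fdet n (\<lambda>i j. jacobi_series (real i + b + 1) N i j (x / (1 - x / real N ^ 2)))" for N
  have d0: "det\<^sub>1 n (\<lambda>i j. bessel_I (real j - real i) (2 * sqrt x)) = toeplitz_J 0 n x"
    using det_bessel_I[OF x, of n 0] x by simp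
  have d2: "det\<^sub>1 n (\<lambda>i j. bessel_I (2 + real j - real i) (2 * sqrt x)) = inverse (x ^ n) * toeplitz_J 2 n x"
  proof -
    have "sqrt x powr (- real (2 * n)) = inverse (sqrt x powr real (2 * n))"
      by (rule powr_minus)
    also have "sqrt x powr real (2 * n) = x ^ n"
      using x by (simp only: powr_realpow real_sqrt_gt_zero power_mult real_sqrt_pow2 less_imp_le)
    finally show ?thesis using det_bessel_I[OF x, of n 2] by simp
  qed
  have G: "expands G (exp (- x) * toeplitz_J 0 n x) (- (x * (real n + b) * exp (- x) * (inverse (x ^ n) * toeplitz_J 2 n x)))"
    unfolding G_def by (rule survival_expands) (use x assms in \<open>auto simp: b_def\<close>)
  have ev: "eventually (\<lambda>N. F_scaled_smallest N (real n) b x = 1 - G N) sequentially"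
  proof -
    have "eventually (\<lambda>N. x / real N ^ 2 < 1) sequentially" using x by real_asymp
    with eventually_ge_at_top[of 1] show ?thesis
    proof eventually_elim
      case (elim N)
      then have N: "N \<ge> 1" and pos: "0 < x / real N ^ 2" using x by auto
      have b: "b > -1" using assms by (simp add: b_def)
      define \<xi> where "\<xi> = x / real N ^ 2"
      \<comment> \<open>The argument \<open>N\<^sup>2 s\<close> of the series at
        \<open>s = - t = \<xi> / (1 - \<xi>)\<close>.\<close>
      have X: "real N ^ 2 * (\<xi> / (1 - \<xi>)) = x / (1 - \<xi>)"
        using N by (simp add: \<xi>_def)
      show ?case
        unfolding F_scaled_smallest_eq[OF N] F_smallest_eq[OF b N pos elim(2)]
        using jac_hankel_ratio_jacobi_series[OF b N, of n "\<xi> / (1 - \<xi>)"] X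
        by (simp add: G_def \<xi>_def)
    qed
  qed
  have "(\<lambda>N. - (G N - exp (- x) * toeplitz_J 0 n x - - (x * (real n + b) * exp (- x) * (inverse (x ^ n) * toeplitz_J 2 n x)) / real N))
      \<in> O(\<lambda>N. 1 / real N ^ 2)"
    using G unfolding expands_def by (simp only: landau_o.big.uminus_in_iff)
  then have "(\<lambda>N. F_scaled_smallest N (real n) b x -
            (1 - exp (- x) * toeplitz_J 0 n x +
             x / real N * (real n + b) * exp (- x) * (inverse (x ^ n) * toeplitz_J 2 n x)))
        \<in> O(\<lambda>N. 1 / real N ^ 2)"
  proof (rule landau_o.big.in_cong[THEN iffD1, rotated])
    show "\<forall>\<^sub>F N in sequentially. - (G N - exp (- x) * toeplitz_J 0 n x - - (x * (real n + b) * exp (- x) * (inverse (x ^ n) * toeplitz_J 2 n x)) / real N) =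
       F_scaled_smallest N (real n) b x - (1 - exp (- x) * toeplitz_J 0 n x +
             x / real N * (real n + b) * exp (- x) * (inverse (x ^ n) * toeplitz_J 2 n x))"
      using ev by eventually_elim simp
  qed
  then show "(\<lambda>N::nat. F_scaled_smallest N (real \<alpha>\<^sub>1) \<alpha>\<^sub>2 x -
            (1 - exp (- x) * det\<^sub>1 \<alpha>\<^sub>1 (\<lambda>i j. bessel_I (real j - real i) (2 * sqrt x)) +
             x / real N * (real \<alpha>\<^sub>1 + \<alpha>\<^sub>2) * exp (- x) *
               det\<^sub>1 \<alpha>\<^sub>1 (\<lambda>i j. bessel_I (2 + real j - real i) (2 * sqrt x))))
        \<in> O(\<lambda>N. 1 / real N ^ 2)"
    unfolding d0[unfolded n_def] d2[unfolded n_def] by (simp add: n_def b_def)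
qed

end
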